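(* Let $\mathbb P$ be the probability measure associated to a homogeneous compound Poisson point process on $\mathbb R\times\mathbb T$ with positive weights; that is, under $\mathbb P$ the measure $\mu$ is a sum of point masses located at the points of a homogeneous Poisson point process of positive intensity on $\mathbb R\times\mathbb T$, with i.i.d. weights in $(0,\infty)$ independent of the locations. Then $\mathbb P(\widetilde\Omega)=1$.
   Context: $\mathbb T=\mathbb R/\mathbb Z$; derivatives of $\mathbb T$-valued functions are real-valued (via local lifts). A set is discrete if it has no accumulation points in the ambient space. $\Omega$ is the set of purely atomic (nonnegative) measures $\mu$ on $\mathbb R\times\mathbb T$, with atoms of finite mass, such that $\mathsf N:=\operatorname{supp}\mu$ is discrete. For $\theta\in\mathbb R$, $s<t$ and $X\in H^1([s,t];\mathbb T)$ the action is $\mathcal A_{\theta,s,t}[X]=\frac12\int_s^t(X'(r)-\theta)^2\,dr-\mu(\{(r,X(r)): r\in[s,t)\})$. $\mathscr M^\theta_{s,y\mid t,x}$ is the set of $X\in H^1([s,t];\mathbb T)$ with $X(s)=y$, $X(t)=x$ that minimize $\mathcal A_{\theta,s,t}$ among all such paths. $\mathscr M^\theta_t$ is the set of $X\in H^1_{\mathrm{loc}}((-\infty,t];\mathbb T)$ with $X|_{[s,t]}\in\mathscr M^\theta_{s,X(s)\mid t,X(t)}$ for all $s<t$, and $\mathscr M^\theta_{t,x}=\{X\in\mathscr M^\theta_t: X(t)=x\}$. On $\mathscr M^\theta_{t,x}$ the order is: $X_1\preccurlyeq X_2$ if $\int_r^tX_1'(s)\,ds\ge\int_r^tX_2'(s)\,ds$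 for all $r\le t$. $\widetilde\Omega_1$ is the set of $\mu\in\Omega$ for which there is $M=M(\mu)>0$ such that for all $t\in\mathbb R$ there are $s=s(t)\le t-M$ and $y\in\mathbb T$ with $\mathsf N\cap([s-M,s+M]\times\mathbb T)=\{(s,y)\}$ and $\mu(\{(s,y)\})>\frac1{4M}$, and moreover $s(t)$ can be chosen so that $\lim_{t\to+\infty}s(t)=+\infty$. For $\mu\in\widetilde\Omega_1$, each $\mathscr M^\theta_{t,x}$ is nonempty, consists of piecewise-linear paths, and has unique minimal and maximal elements $X_{\theta,t,x,\mathrm L}$ and $X_{\theta,t,x,\mathrm R}$ under $\preccurlyeq$. Put $u_{\theta,\square}(t,x)=X_{\theta,t,x,\square}'(t-)$ (derivative from below at $t$) for $\square\in\{\mathrm L,\mathrm R\}$. The shock set is $\mathsf S=\{(\theta,t,x)\in\mathbb R\times\mathbb R\times\mathbb T: u_{\theta,\mathrm L}(t,x)>u_{\theta,\mathrm R}(t,x)\}$, and $\mathsf S_\theta=\{(t,x):(\theta,t,x)\in\mathsf S\}$. For $(\theta,t,x)\in\mathsf S$, $T_\vee(\theta,t,x)=\sup\{s<t: X_{\theta,t,x,\mathrm L}(s)=X_{\theta,t,x,\mathrm R}(s)\}$. The set of global shocks is $\mathsf{GS}=\{(\theta,t,x)\in\mathsf S:\int_{T_\vee(\theta,t,x)}^tX_{\theta,t,x,\mathrm L}'(s)\,ds>\int_{T_\vee(\theta,t,x)}^tX_{\theta,t,x,\mathrm R}'(s)\,ds\}$, and $\mathsf{GS}_\theta=\{(t,x):(\theta,t,x)\in\mathsf{GS}\}$.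 Finally, $\widetilde\Omega$ is the set of $\mu\in\widetilde\Omega_1$ such that for every $\theta\in\mathbb R$ we have $\#(\mathsf{GS}_\theta\cap\mathsf N)\le1$ and $(\mathsf S_\theta\cap\mathsf N)\setminus\mathsf{GS}_\theta=\varnothing$. *)

theory Defs
  imports "HOL-Probability.Probability"
begin

section \<open>The circle \<open>\<real>/\<int>\<close>\<close>

quotient_type torus = real / "\<lambda>x y :: real. x - y \<in> \<int>"
  morphisms rep_torus to_torus
proof (rule equivpI)
  show "reflp (\<lambda>x y :: real. x - y \<in> \<int>)"
    by (simp add: reflp_def)
  show "symp (\<lambda>x y :: real. x - y \<in> \<int>)"
  proof (rule sympI)
    fix x y :: real assume "x - y \<in> \<int>"
    from Ints_minus[OF this] show "y - x \<in> \<int>" by simp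
  qed
  show "transp (\<lambda>x y :: real. x - y \<in> \<int>)"
  proof (rule transpI)
    fix x y z :: real assume "x - y \<in> \<int>" "y - z \<in> \<int>"
    from Ints_add[OF this] show "x - z \<in> \<int>" by simp
  qed
qed

lemma to_torus_eq_iff: "to_torus x = to_torus y \<longleftrightarrow> x - y \<in> \<int>"
  by (rule torus.abs_eq_iff)

lemma surj_to_torus: "surj to_torus"
  by (rule surjI) (rule Quotient3_abs_rep[OF Quotient3_torus])

text \<open>The quotient topology.\<close>

instantiation torus :: topological_space
begin

definition open_torus :: "torus set \<Rightarrow> bool" where
  "open_torus U \<longleftrightarrow> open (to_torus -` U)"

instance
proof
  show "open (UNIV :: torus set)" by (simp add: open_torus_def)
next
  fix S T :: "torus set" assume "open S" "open T"
  then show "open (S \<inter> T)" by (simp add: open_torus_def vimage_Int open_Int)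
next
  fix K :: "torus set set" assume "\<forall>S\<in>K. open S"
  then show "open (\<Union>K)" by (auto simp: open_torus_def vimage_Union intro!: open_UN)
qed

end

lemma continuous_on_to_torus: "continuous_on A to_torus"
proof -
  have "continuous_on UNIV to_torus"
    by (simp add: continuous_on_open_vimage open_torus_def)
  then show ?thesis by (rule continuous_on_subset) simp
qed

lemma measurable_to_torus [measurable]: "to_torus \<in> borel_measurable borel"
  by (intro borel_measurable_continuous_onI continuous_on_to_torus)

lemma open_to_torus_image:
  assumes "open U" shows "open (to_torus ` U)"
proof -
  have "to_torus -` (to_torus ` U) = (\<Union>k::int. (\<lambda>x. x + of_int k) ` U)"
  proof (intro set_eqI iffI)
    fix x assume "x \<in> to_torus -` (to_torus ` U)"
    then obtain u where u: "u \<in> U" "x - u \<in> \<int>" by (auto simp: to_torus_eq_iff)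
    from u(2) obtain k where "x - u = of_int k" by (elim Ints_cases)
    then have "x = u + of_int k" by simp
    with u(1) show "x \<in> (\<Union>k::int. (\<lambda>x. x + of_int k) ` U)" by blast
  next
    fix x assume "x \<in> (\<Union>k::int. (\<lambda>x. x + of_int k) ` U)"
    then obtain u k where "u \<in> U" "x = u + of_int k" by blast
    then show "x \<in> to_torus -` (to_torus ` U)"
      by (auto simp: to_torus_eq_iff intro!: image_eqI[of _ _ u])
  qed
  moreover have "open ((\<lambda>x. x + of_int k) ` U)" for k :: int
    using open_translation[OF assms, of "of_int k"] by (simp add: add.commute)
  ultimately show ?thesis by (simp add: open_torus_def open_UN)
qed

instance torus :: second_countable_topology
proof
  obtain B :: "real set set" where B: "countable B" "topological_basis B"
    using ex_countable_basis by blast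
  have "topological_basis ((`) to_torus ` B)"
  proof (rule topological_basisI)
    fix V assume "V \<in> (`) to_torus ` B"
    then show "open V" using B(2) by (auto intro: open_to_torus_image topological_basis_open)
  next
    fix V and x :: torus assume V: "open V" "x \<in> V"
    obtain y where y: "x = to_torus y" using surj_to_torus by (rule surjE)
    have "open (to_torus -` V)" "y \<in> to_torus -` V" using V y by (auto simp: open_torus_def)
    then obtain W where W: "W \<in> B" "y \<in> W" "W \<subseteq> to_torus -` V"
      by (rule topological_basisE[OF B(2)])
    show "\<exists>W\<in>(`) to_torus ` B. x \<in> W \<and> W \<subseteq> V"
    proof (intro bexI conjI)
      show "to_torus ` W \<in> (`) to_torus ` B" using W(1) by (rule imageI)
      show "x \<in> to_torus ` W" unfolding y using W(2) by (rule imageI)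
      show "to_torus ` W \<subseteq> V" using W(3) by (simp only: image_subset_iff_subset_vimage)
    qed
  qed
  with B(1) show "\<exists>B :: torus set set. countable B \<and> open = generate_topology B"
    by (intro exI[of _ "(`) to_torus ` B"] conjI countable_image topological_basis_imp_subbasis)
qed

definition torus_lebesgue :: "torus measure" where
  "torus_lebesgue = distr (restrict_space lborel {0..<1}) borel to_torus"

definition cylinder_lebesgue :: "(real \<times> torus) measure" where
  "cylinder_lebesgue = lborel \<Otimes>\<^sub>M torus_lebesgue"

lemma sets_cylinder_lebesgue: "sets cylinder_lebesgue = sets borel"
proof -
  have "sets cylinder_lebesgue = sets (borel \<Otimes>\<^sub>M (borel :: torus measure))"
    unfolding cylinder_lebesgue_def
    by (rule sets_pair_measure_cong) (simp_all only: sets_lborel sets_distr torus_lebesgue_def)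
  also have "borel \<Otimes>\<^sub>M (borel :: torus measure) = (borel :: (real \<times> torus) measure)"
    by (rule borel_prod)
  finally show ?thesis .
qed


section \<open>Atomic measures\<close>

definition supp :: "'a :: topological_space measure \<Rightarrow> 'a set" where
  "supp \<mu> = {p. \<forall>U. open U \<longrightarrow> p \<in> U \<longrightarrow> emeasure \<mu> U > 0}"

definition purely_atomic :: "'a measure \<Rightarrow> bool" where
  "purely_atomic \<mu> \<longleftrightarrow>
     (\<forall>A\<in>sets \<mu>. emeasure \<mu> A = (\<integral>\<^sup>+ p\<in>A. emeasure \<mu> {p} \<partial>count_space UNIV))"

text \<open>A set is discrete here if it has no accumulation point in the whole space, which is
  stronger than the predicate \<^const>\<open>discrete\<close>.\<close>

definition Omega :: "(real \<times> torus) measure set" where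
  "Omega = {\<mu>. sets \<mu> = sets borel \<and> purely_atomic \<mu> \<and> (\<forall>p. emeasure \<mu> {p} < \<infinity>) \<and>
                (\<forall>p. \<not> p islimpt supp \<mu>)}"


section \<open>\<open>H\<^sup>1\<close> paths in the circle and their derivatives\<close>

text \<open>\<open>v\<close> is the \<open>L\<^sup>2\<close> weak derivative of \<open>X\<close> on \<open>[s,t]\<close>: some lift of \<open>X\<close> to the real line is
  a primitive of \<open>v\<close>. It is determined up to a null set.\<close>

definition is_weak_deriv :: "real \<Rightarrow> real \<Rightarrow> (real \<Rightarrow> torus) \<Rightarrow> (real \<Rightarrow> real) \<Rightarrow> bool" where
  "is_weak_deriv s t X v \<longleftrightarrow>
     set_borel_measurable lborel {s..t} v \<and>
     set_integrable lborel {s..t} (\<lambda>r. (v r)\<^sup>2) \<and>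
     (\<exists>y0. \<forall>r\<in>{s..t}. X r = to_torus (y0 + (LINT q:{s..r}|lborel. v q)))"

definition weak_deriv :: "real \<Rightarrow> real \<Rightarrow> (real \<Rightarrow> torus) \<Rightarrow> real \<Rightarrow> real" where
  "weak_deriv s t X = (SOME v. is_weak_deriv s t X v)"

text \<open>Paths on \<open>I\<close> are represented by functions in \<^term>\<open>extensional I\<close>, so that equality of
  functions is equality of paths.\<close>

definition H1 :: "real \<Rightarrow> real \<Rightarrow> (real \<Rightarrow> torus) set" where
  "H1 s t = {X \<in> extensional {s..t}. \<exists>v. is_weak_deriv s t X v}"

definition H1_loc :: "real \<Rightarrow> (real \<Rightarrow> torus) set" where
  "H1_loc t = {X \<in> extensional {..t}. \<forall>s<t. restrict X {s..t} \<in> H1 s t}"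

text \<open>\<open>\<integral>\<^sub>r\<^sup>t X'(q) dq\<close>\<close>

definition increment :: "real \<Rightarrow> real \<Rightarrow> (real \<Rightarrow> torus) \<Rightarrow> real" where
  "increment r t X = (LINT q:{r..t}|lborel. weak_deriv r t X q)"

text \<open>The classical derivative from below \<open>X'(t-)\<close>, through a lift near \<open>t\<close>. Differentiability
  makes the lift \<open>Y\<close> continuous at \<open>t\<close> from below, so the value does not depend on \<open>Y\<close>.\<close>

definition left_deriv :: "(real \<Rightarrow> torus) \<Rightarrow> real \<Rightarrow> real" where
  "left_deriv X t = (THE d. \<exists>Y. X t = to_torus (Y t) \<and>
      (\<forall>\<^sub>F r in at_left t. X r = to_torus (Y r)) \<and> (Y has_real_derivative d) (at_left t))"


section \<open>Action and minimizers\<close>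

definition action :: "(real \<times> torus) measure \<Rightarrow> real \<Rightarrow> real \<Rightarrow> real \<Rightarrow> (real \<Rightarrow> torus) \<Rightarrow> real" where
  "action \<mu> \<theta> s t X =
     1 / 2 * (LINT r:{s..t}|lborel. (weak_deriv s t X r - \<theta>)\<^sup>2)
     - measure \<mu> {(r, X r) | r. r \<in> {s..<t}}"

definition minimizers_between ::
  "(real \<times> torus) measure \<Rightarrow> real \<Rightarrow> real \<Rightarrow> torus \<Rightarrow> real \<Rightarrow> torus \<Rightarrow> (real \<Rightarrow> torus) set" where
  "minimizers_between \<mu> \<theta> s y t x =
     {X \<in> H1 s t. X s = y \<and> X t = x \<and>
        (\<forall>Z\<in>H1 s t. Z s = y \<longrightarrow> Z t = x \<longrightarrow> action \<mu> \<theta> s t X \<le> action \<mu> \<theta> s t Z)}"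

definition minimizers_to_time ::
  "(real \<times> torus) measure \<Rightarrow> real \<Rightarrow> real \<Rightarrow> (real \<Rightarrow> torus) set" where
  "minimizers_to_time \<mu> \<theta> t =
     {X \<in> H1_loc t. \<forall>s<t. restrict X {s..t} \<in> minimizers_between \<mu> \<theta> s (X s) t (X t)}"

definition minimizers ::
  "(real \<times> torus) measure \<Rightarrow> real \<Rightarrow> real \<Rightarrow> torus \<Rightarrow> (real \<Rightarrow> torus) set" where
  "minimizers \<mu> \<theta> t x = {X \<in> minimizers_to_time \<mu> \<theta> t. X t = x}"

definition path_le :: "real \<Rightarrow> (real \<Rightarrow> torus) \<Rightarrow> (real \<Rightarrow> torus) \<Rightarrow> bool" where
  "path_le t X1 X2 \<longleftrightarrow> (\<forall>r\<le>t. increment r t X1 \<ge> increment r t X2)"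

text \<open>The minimal and the maximal element for \<^const>\<open>path_le\<close>; they exist and are unique for
  the configurations in \<open>Omega1\<close> below, the only ones for which they are used.\<close>

definition X_L :: "(real \<times> torus) measure \<Rightarrow> real \<Rightarrow> real \<Rightarrow> torus \<Rightarrow> real \<Rightarrow> torus" where
  "X_L \<mu> \<theta> t x = (THE X. X \<in> minimizers \<mu> \<theta> t x \<and>
      (\<forall>Z\<in>minimizers \<mu> \<theta> t x. path_le t Z X \<longrightarrow> Z = X))"

definition X_R :: "(real \<times> torus) measure \<Rightarrow> real \<Rightarrow> real \<Rightarrow> torus \<Rightarrow> real \<Rightarrow> torus" where
  "X_R \<mu> \<theta> t x = (THE X. X \<in> minimizers \<mu> \<theta> t x \<and>
      (\<forall>Z\<in>minimizers \<mu> \<theta> t x. path_le t X Z \<longrightarrow> Z = X))"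

definition u_L :: "(real \<times> torus) measure \<Rightarrow> real \<Rightarrow> real \<Rightarrow> torus \<Rightarrow> real" where
  "u_L \<mu> \<theta> t x = left_deriv (X_L \<mu> \<theta> t x) t"

definition u_R :: "(real \<times> torus) measure \<Rightarrow> real \<Rightarrow> real \<Rightarrow> torus \<Rightarrow> real" where
  "u_R \<mu> \<theta> t x = left_deriv (X_R \<mu> \<theta> t x) t"


section \<open>Shocks\<close>

definition shocks :: "(real \<times> torus) measure \<Rightarrow> (real \<times> real \<times> torus) set" where
  "shocks \<mu> = {(\<theta>, t, x). u_L \<mu> \<theta> t x > u_R \<mu> \<theta> t x}"

definition shocks_at :: "(real \<times> torus) measure \<Rightarrow> real \<Rightarrow> (real \<times> torus) set" where
  "shocks_at \<mu> \<theta> = {(t, x). (\<theta>, t, x) \<in> shocks \<mu>}"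

text \<open>For the configurations in \<open>Omega1\<close> below, all minimizers pass through common points at
  arbitrarily early times, so the supremum is over a nonempty set bounded above by \<open>t\<close>.\<close>

definition T_vee :: "(real \<times> torus) measure \<Rightarrow> real \<Rightarrow> real \<Rightarrow> torus \<Rightarrow> real" where
  "T_vee \<mu> \<theta> t x = Sup {s. s < t \<and> X_L \<mu> \<theta> t x s = X_R \<mu> \<theta> t x s}"

definition global_shocks :: "(real \<times> torus) measure \<Rightarrow> (real \<times> real \<times> torus) set" where
  "global_shocks \<mu> = {(\<theta>, t, x). (\<theta>, t, x) \<in> shocks \<mu> \<and>
     increment (T_vee \<mu> \<theta> t x) t (X_L \<mu> \<theta> t x) > increment (T_vee \<mu> \<theta> t x) t (X_R \<mu> \<theta> t x)}"

definition global_shocks_at :: "(real \<times> torus) measure \<Rightarrow> real \<Rightarrow> (real \<times> torus) set" where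
  "global_shocks_at \<mu> \<theta> = {(t, x). (\<theta>, t, x) \<in> global_shocks \<mu>}"


section \<open>The sets of good configurations\<close>

text \<open>In \<open>Omega1\<close> one choice \<open>s\<close> of the times satisfies both requirements; as all members of
  \<^const>\<open>Omega\<close> have finite atoms, \<^const>\<open>measure\<close> gives their true masses.\<close>

definition Omega1 :: "(real \<times> torus) measure set" where
  "Omega1 = {\<mu> \<in> Omega. \<exists>M>0. \<exists>s :: real \<Rightarrow> real.
     (\<forall>t. s t \<le> t - M \<and>
        (\<exists>y. supp \<mu> \<inter> ({s t - M .. s t + M} \<times> UNIV) = {(s t, y)} \<and>
             measure \<mu> {(s t, y)} > 1 / (4 * M))) \<and>
     filterlim s at_top at_top}"

definition Omega_tilde :: "(real \<times> torus) measure set" where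
  "Omega_tilde = {\<mu> \<in> Omega1. \<forall>\<theta>.
     finite (global_shocks_at \<mu> \<theta> \<inter> supp \<mu>) \<and> card (global_shocks_at \<mu> \<theta> \<inter> supp \<mu>) \<le> 1 \<and>
     (shocks_at \<mu> \<theta> \<inter> supp \<mu>) - global_shocks_at \<mu> \<theta> = {}}"


section \<open>Homogeneous compound Poisson processes\<close>

text \<open>The number of points in \<open>B\<close>, possibly infinite.\<close>

definition point_count :: "(nat \<Rightarrow> 'w \<Rightarrow> 'a) \<Rightarrow> 'a set \<Rightarrow> 'w \<Rightarrow> ennreal" where
  "point_count p B \<omega> = emeasure (count_space UNIV) {n. p n \<omega> \<in> B}"

text \<open>The points are enumerated as a sequence, in an arbitrary measurable way; there are almost
  surely infinitely many because the cylinder has infinite volume.\<close>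

definition homogeneous_poisson_process ::
  "'w measure \<Rightarrow> real \<Rightarrow> (nat \<Rightarrow> 'w \<Rightarrow> real \<times> torus) \<Rightarrow> bool" where
  "homogeneous_poisson_process P lam p \<longleftrightarrow>
     (\<forall>n. p n \<in> borel_measurable P) \<and>
     (\<forall>B\<in>sets borel. emeasure cylinder_lebesgue B < \<infinity> \<longrightarrow>
        (\<forall>k. measure P {\<omega> \<in> space P. point_count p B \<omega> = of_nat k} =
              (lam * measure cylinder_lebesgue B) ^ k / fact k *
              exp (- (lam * measure cylinder_lebesgue B)))) \<and>
     (\<forall>B :: nat \<Rightarrow> (real \<times> torus) set.
        (\<forall>i. B i \<in> sets borel \<and> emeasure cylinder_lebesgue (B i) < \<infinity>) \<longrightarrow>
        disjoint_family B \<longrightarrow>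
        prob_space.indep_vars P (\<lambda>_. borel) (\<lambda>i. point_count p (B i)) UNIV)"

definition homogeneous_compound_poisson_process ::
  "'w measure \<Rightarrow> real \<Rightarrow> real measure \<Rightarrow> ('w \<Rightarrow> (real \<times> torus) measure) \<Rightarrow> bool" where
  "homogeneous_compound_poisson_process P lam nu \<mu> \<longleftrightarrow>
     (\<exists>(p :: nat \<Rightarrow> 'w \<Rightarrow> real \<times> torus) (w :: nat \<Rightarrow> 'w \<Rightarrow> real).
        homogeneous_poisson_process P lam p \<and>
        prob_space.indep_vars P (\<lambda>_. borel) w UNIV \<and>
        (\<forall>n. distr P borel (w n) = nu) \<and>
        prob_space.indep_set P
          (sets (vimage_algebra (space P) (\<lambda>\<omega> n. p n \<omega>) (\<Pi>\<^sub>M n\<in>UNIV. borel)))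
          (sets (vimage_algebra (space P) (\<lambda>\<omega> n. w n \<omega>) (\<Pi>\<^sub>M n\<in>UNIV. borel))) \<and>
        (AE \<omega> in P. sets (\<mu> \<omega>) = sets borel \<and>
           (\<forall>A\<in>sets borel. emeasure (\<mu> \<omega>) A = (\<Sum>n. ennreal (w n \<omega>) * indicator A (p n \<omega>)))))"

end

theory Submission
  imports Defs
begin

text \<open>
  \<^bold>\<open>Reduction to arithmetic.\<close> For a configuration in \<^const>\<open>Omega1\<close>, each time \<open>t\<close> is preceded by a heavy atom
  that is alone in a strip of half-width \<open>M\<close>. A path that misses it can be bent to pass through it at the cost
  of at most \<open>1 / (4 * M)\<close> of kinetic energy, which is less than the mass gained (\<open>regeneration\<close>). So all
  minimizers, for all \<open>\<theta>\<close> at once, pass through the same atoms \<open>P\<^sub>1, P\<^sub>2, \<dots>\<close> going back in time, and a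
  one-sided minimizer is a concatenation of minimizers between consecutive \<open>P\<^sub>k\<close>. Between two points a
  minimizer is a polygon with vertices at atoms (\<open>minimizer_chain\<close>), and there are finitely many of them.
  Exchanging pieces of two minimizers between common points gives minimizers again; together with the
  finiteness this yields the extremal minimizers \<^const>\<open>X_L\<close> and \<^const>\<open>X_R\<close>.

  Let \<open>(t, x)\<close> be an atom in the shock set. The two extremal minimizers leave the same atom \<open>P\<^sub>1\<close>, arrive at
  \<open>(t, x)\<close> with different slopes, and have equal action. As
  \<open>(X' - \<theta>)\<^sup>2 / 2 = X'\<^sup>2 / 2 - \<theta> X' + \<theta>\<^sup>2 / 2\<close>, this reads \<open>E\<^sub>1 - E\<^sub>2 = \<theta> K\<close> with \<open>E\<^sub>i\<close> the actions at
  \<open>\<theta> = 0\<close> and \<open>K\<close> the integer difference of the increments (\<open>shock_data\<close>).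
  If \<open>K = 0\<close>, then \<open>E\<^sub>1 = E\<^sub>2\<close>. If two different atoms are shocks for the same \<open>\<theta>\<close>, then eliminating \<open>\<theta>\<close> gives
  \<open>K' (E\<^sub>1 - E\<^sub>2) = K (E'\<^sub>1 - E'\<^sub>2)\<close>. Both are instances of countably many equations in the coordinates
  of finitely many atoms in which \<open>\<theta>\<close> does not occur; a configuration that satisfies none of them is
  called \<open>resonance_free\<close>. In such a configuration shock atoms are global shocks and there is at most one of
  them for each \<open>\<theta>\<close> (\<open>Omega_tilde_of_resonance_free\<close>).

  \<^bold>\<open>Probability.\<close> As a function of the space coordinate of the latest atom \<open>(t, x)\<close>, with all other data
  fixed, each equation has degree at most two and is not an identity, because the two last segments start at different points.
  So it has finitely many solutions. It remains to see that tuples of different points of the Poisson process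
  have a joint law that is absolutely continuous in each coordinate (\<open>AE_tuple_notin\<close>): summed over all tuples
  of indices, the law in disjoint boxes is a product of Lebesgue measures, because counts in disjoint boxes are
  independent. The weights are independent of the points, hence can be frozen. Finally, the events that a block of
  time contains exactly one point, in its middle part, are independent for different blocks and have the same
  positive probability; infinitely many of these points carry a weight above a fixed level, in both directions of time. This gives
  membership in \<^const>\<open>Omega1\<close> (\<open>AE_Omega1\<close>).
\<close>

section \<open>Topology and coordinates of the circle\<close>

instance torus :: t2_space
proof
  fix x y :: torus assume "x \<noteq> y"
  obtain a b where ab: "x = to_torus a" "y = to_torus b"
    using surj_to_torus by (metis surjD)
  with \<open>x \<noteq> y\<close> have nz: "a - b \<notin> \<int>" by (simp add: to_torus_eq_iff)
  define d where "d = frac (a - b)"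
  have d: "0 < d" "d < 1" using nz by (auto simp: d_def frac_gt_0_iff frac_lt_1)
  define e where "e = min d (1 - d) / 2"
  have e: "e > 0" using d by (simp add: e_def)
  let ?U = "to_torus ` ball a e" and ?V = "to_torus ` ball b e"
  have "?U \<inter> ?V = {}"
  proof (rule ccontr)
    assume "?U \<inter> ?V \<noteq> {}"
    then obtain u v where uv: "u \<in> ball a e" "v \<in> ball b e" "to_torus u = to_torus v" by auto
    then have "u - v \<in> \<int>" by (simp add: to_torus_eq_iff)
    then obtain k where k: "u - v = of_int k" by (elim Ints_cases)
    have ab': "a - b = of_int \<lfloor>a - b\<rfloor> + d" by (simp add: d_def frac_def)
    have "\<bar>(a - b) - (u - v)\<bar> < 2 * e" using uv(1,2) by (auto simp: dist_real_def)
    then have "\<bar>of_int (\<lfloor>a - b\<rfloor> - k) + d\<bar> < 2 * e" using k ab' by auto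
    then have 1: "\<bar>of_int (\<lfloor>a - b\<rfloor> - k) + d\<bar> < d" "\<bar>of_int (\<lfloor>a - b\<rfloor> - k) + d\<bar> < 1 - d"
      by (auto simp: e_def)
    then have "of_int (\<lfloor>a - b\<rfloor> - k) < (0::real)" "of_int (\<lfloor>a - b\<rfloor> - k) > (-1::real)" using d by linarith+
    then have "\<lfloor>a - b\<rfloor> - k < 0" "\<lfloor>a - b\<rfloor> - k > -1"
      by (simp_all only: of_int_less_0_iff)
    then show False by linarith
  qed
  then show "\<exists>U V. open U \<and> open V \<and> x \<in> U \<and> y \<in> V \<and> U \<inter> V = {}"
    using e by (intro exI[of _ ?U] exI[of _ ?V]) (auto simp: ab open_to_torus_image)
qed

lemma compact_UNIV_torus: "compact (UNIV :: torus set)"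
proof -
  have "to_torus ` {0..1} = UNIV"
  proof (intro equalityI subsetI UNIV_I)
    fix x :: torus
    obtain a where "x = to_torus a" using surj_to_torus by (rule surjE)
    then have "x = to_torus (frac a)" by (simp add: to_torus_eq_iff frac_def)
    moreover have "frac a \<in> {0..1}" by (simp add: frac_ge_0 frac_lt_1 less_imp_le)
    ultimately show "x \<in> to_torus ` {0..1}" by blast
  qed
  then show ?thesis
    using compact_continuous_image[OF continuous_on_to_torus compact_Icc, of 0 1] by simp
qed

text \<open>The representative in \<open>[0, 1)\<close>. The morphism \<^const>\<open>rep_torus\<close> makes
  an arbitrary choice in each class and has no reason to be measurable.\<close>

definition torus_coord :: "torus \<Rightarrow> real" where
  "torus_coord x = frac (rep_torus x)"

lemma to_torus_coord [simp]: "to_torus (torus_coord x) = x"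
proof -
  have "to_torus (torus_coord x) = to_torus (rep_torus x)"
    by (simp add: torus_coord_def to_torus_eq_iff frac_def)
  then show ?thesis by (simp add: Quotient3_abs_rep[OF Quotient3_torus])
qed

lemma torus_coord_bounds: "0 \<le> torus_coord x" "torus_coord x < 1"
  by (simp_all add: torus_coord_def frac_lt_1)

lemma torus_coord_to_torus: "torus_coord (to_torus a) = frac a"
proof -
  have "torus_coord (to_torus a) - a \<in> \<int>"
    using to_torus_coord[of "to_torus a"] by (simp only: to_torus_eq_iff)
  then obtain k where "torus_coord (to_torus a) = a + of_int k"
    by (metis Ints_cases add.commute diff_add_cancel)
  then have "frac (torus_coord (to_torus a)) = frac a" by simp
  then show ?thesis using torus_coord_bounds[of "to_torus a"] by (metis frac_eq)
qed

lemma measurable_torus_coord [measurable]: "torus_coord \<in> borel_measurable borel"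
proof (rule borel_measurableI_less)
  fix c :: real
  have "{x. torus_coord x < c} = to_torus ` {0..<min c 1}"
  proof (intro equalityI subsetI)
    fix x assume "x \<in> {x. torus_coord x < c}"
    then show "x \<in> to_torus ` {0..<min c 1}"
      using torus_coord_bounds[of x] by (intro image_eqI[of _ _ "torus_coord x"]) auto
  next
    fix x assume "x \<in> to_torus ` {0..<min c 1}"
    then show "x \<in> {x. torus_coord x < c}"
      by (auto simp: torus_coord_to_torus frac_eq[THEN iffD2])
  qed
  also have "\<dots> = (if c > 0 then insert (to_torus 0) (to_torus ` {0<..<min c 1}) else {})"
  proof (cases "c > 0")
    case True
    then have "{0..<min c 1} = insert 0 {0<..<min c 1}" by auto
    then show ?thesis using True by simp
  qed auto
  also have "\<dots> \<in> sets borel"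
    using borel_closed[of "{to_torus 0}"] borel_open[OF open_to_torus_image[of "{0<..<min c 1}"]]
    by auto
  finally show "{x \<in> space borel. torus_coord x < c} \<in> sets borel" by simp
qed

lemma to_torus_add_int [simp]: "to_torus (a + of_int k) = to_torus a"
  by (simp add: to_torus_eq_iff)

section \<open>Weak derivatives, lifts and kinetic energy\<close>

text \<open>Membership in \<^const>\<open>H1\<close> up to extensionality, so that a path can be considered on
  any subinterval without restricting it.\<close>

definition H1_path :: "real \<Rightarrow> real \<Rightarrow> (real \<Rightarrow> torus) \<Rightarrow> bool" where
  "H1_path a b X \<longleftrightarrow> (\<exists>v. is_weak_deriv a b X v)"

definition kinetic :: "real \<Rightarrow> real \<Rightarrow> real \<Rightarrow> (real \<Rightarrow> torus) \<Rightarrow> real" where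
  "kinetic \<theta> a b X = (LINT r:{a..b}|lborel. (weak_deriv a b X r - \<theta>)\<^sup>2)"

lemma set_integrable_const_Icc: "set_integrable lborel {a..b::real} (\<lambda>_. c :: real)"
  by (intro borel_integrable_atLeastAtMost' continuous_intros)

lemma set_integrable_of_sq:
  fixes v :: "real \<Rightarrow> real"
  assumes m: "set_borel_measurable lborel {a..b} v"
    and i: "set_integrable lborel {a..b} (\<lambda>r. (v r)\<^sup>2)"
  shows "set_integrable lborel {a..b} v"
proof (rule set_integrable_bound)
  show "set_integrable lborel {a..b} (\<lambda>r. 1 + (v r)\<^sup>2)"
    by (intro set_integral_add set_integrable_const_Icc i)
  show "AE x in lborel. x \<in> {a..b} \<longrightarrow> norm (v x) \<le> norm (1 + (v x)\<^sup>2)"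
  proof (intro AE_I2 impI)
    fix x
    have "0 \<le> (\<bar>v x\<bar> - 1)\<^sup>2" by simp
    then have "2 * \<bar>v x\<bar> \<le> 1 + (v x)\<^sup>2" by (simp add: power2_eq_square algebra_simps)
    moreover have "\<bar>v x\<bar> \<ge> 0" by simp
    ultimately show "norm (v x) \<le> norm (1 + (v x)\<^sup>2)" by (simp add: abs_if)
  qed
qed (use m in auto)

lemma set_integrable_shift_sq:
  fixes v :: "real \<Rightarrow> real"
  assumes m: "set_borel_measurable lborel {a..b} v"
    and i: "set_integrable lborel {a..b} (\<lambda>r. (v r)\<^sup>2)"
  shows "set_integrable lborel {a..b} (\<lambda>r. (v r - \<theta>)\<^sup>2)"
proof -
  have "set_integrable lborel {a..b} (\<lambda>r. ((v r)\<^sup>2 - 2 * \<theta> * v r) + \<theta>\<^sup>2)"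
    by (intro set_integral_add set_integral_diff set_integrable_mult_right set_integrable_const_Icc i
        set_integrable_of_sq[OF m i])
  then show ?thesis by (simp add: power2_eq_square algebra_simps)
qed

lemma set_integral_split:
  fixes f :: "real \<Rightarrow> real"
  assumes f: "set_integrable lborel {a..b} f" and c: "a \<le> c" "c \<le> b"
  shows "(LINT r:{a..b}|lborel. f r) = (LINT r:{a..c}|lborel. f r) + (LINT r:{c..b}|lborel. f r)"
proof -
  have 1: "set_integrable lborel {a..c} f" "set_integrable lborel {c..b} f"
    using c by (auto intro: set_integrable_subset[OF f])
  show ?thesis
    using Henstock_Kurzweil_Integration.integral_combine[OF c set_borel_integral_eq_integral(1)[OF f]]
    by (simp add: set_borel_integral_eq_integral(2)[OF f] set_borel_integral_eq_integral(2)[OF 1(1)]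
        set_borel_integral_eq_integral(2)[OF 1(2)])
qed

lemma continuous_on_primitive:
  fixes f :: "real \<Rightarrow> real"
  assumes f: "set_integrable lborel {a..b} f"
  shows "continuous_on {a..b} (\<lambda>r. LINT q:{a..r}|lborel. f q)"
proof -
  have "continuous_on {a..b} (\<lambda>r. integral {a..r} f)"
    by (intro indefinite_integral_continuous_1 set_borel_integral_eq_integral(1) f)
  moreover have "(LINT q:{a..r}|lborel. f q) = integral {a..r} f" if "r \<in> {a..b}" for r
    using that by (intro set_borel_integral_eq_integral(2) set_integrable_subset[OF f]) auto
  ultimately show ?thesis by (auto elim!: continuous_on_eq)
qed

text \<open>The signed measure with density \<open>f\<close> vanishes on all half-lines, which generate the
  Borel sets.\<close>

lemma primitive_zero_imp_AE_zero:
  fixes f :: "real \<Rightarrow> real"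
  assumes f: "set_integrable lborel {a..b} f"
    and z: "\<And>r. r \<in> {a..b} \<Longrightarrow> (LINT q:{a..r}|lborel. f q) = 0"
  shows "AE x in lborel. x \<in> {a..b} \<longrightarrow> f x = 0"
proof -
  define g where "g = (\<lambda>x. indicator {a..b} x *\<^sub>R f x)"
  have g: "integrable lborel g" using f by (simp add: set_integrable_def g_def)
  have gA: "set_integrable lborel A g" if "A \<in> sets borel" for A
    using integrable_mult_indicator[of A lborel g] g that by (simp add: set_integrable_def)
  have basic: "(LINT x:{..d}|lborel. g x) = 0" for d
  proof (cases "a \<le> min d b")
    case True
    have "(LINT x:{..d}|lborel. g x) = (LINT q:{a..min d b}|lborel. f q)"
      unfolding set_lebesgue_integral_def g_def
      by (intro Bochner_Integration.integral_cong) (auto simp: indicator_def)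
    then show ?thesis using z[of "min d b"] True by simp
  next
    case False
    have "(LINT x:{..d}|lborel. g x) = (LINT x:{..d}|lborel. 0)"
      unfolding set_lebesgue_integral_def g_def using False
      by (intro Bochner_Integration.integral_cong) (auto simp: indicator_def)
    then show ?thesis by simp
  qed
  have tot: "(LINT x|lborel. g x) = 0"
  proof -
    have "(LINT x|lborel. g x) = (LINT x:{..b}|lborel. g x)"
      unfolding set_lebesgue_integral_def g_def
      by (intro Bochner_Integration.integral_cong) (auto simp: indicator_def)
    then show ?thesis using basic by simp
  qed
  have "(LINT x:A|lborel. g x) = 0" if "A \<in> sets borel" for A
  proof -
    have "Int_stable (range (\<lambda>d::real. {..d}))"
      by (auto simp: Int_stable_def)
    moreover have "range (\<lambda>d::real. {..d}) \<subseteq> Pow UNIV" by simp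
    moreover have "A \<in> sigma_sets UNIV (range (\<lambda>d::real. {..d}))"
      using that by (subst (asm) borel_eq_atMost) simp
    ultimately show ?thesis
    proof (induction rule: sigma_sets_induct_disjoint)
      case (basic A)
      then show ?case using \<open>\<And>d. (LINT x:{..d}|lborel. g x) = 0\<close> by auto
    next
      case empty
      then show ?case by (simp add: set_lebesgue_integral_def)
    next
      case (compl A)
      then have A: "A \<in> sets borel" by (subst borel_eq_atMost) simp
      have "(LINT x|lborel. g x) = (LINT x:A|lborel. g x) + (LINT x:UNIV - A|lborel. g x)"
        using set_integral_Un[OF _ gA[OF A] gA[of "UNIV - A"]] A
        by (simp add: set_lebesgue_integral_def sets.compl_sets[of A borel, simplified])
      then show ?case using compl tot by simp
    next
      case (union F)
      then have F: "\<And>i. F i \<in> sets borel" by (subst borel_eq_atMost) auto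
      have "(LINT x:(\<Union>i. F i)|lborel. g x) = (\<Sum>i. LINT x:F i|lborel. g x)"
        using union(1) F by (intro lebesgue_integral_countable_add gA) (auto simp: disjoint_family_on_def)
      then show ?case using union by simp
    qed
  qed
  then have "AE x in lborel. g x = 0" by (intro sigma_finite_measure.density_zero[OF sigma_finite_lborel] g) auto
  then show ?thesis by eventually_elim (auto simp: g_def indicator_def)
qed

text \<open>A continuous integer-valued function on an interval is constant.\<close>

lemma lifts_differ_by_int:
  assumes "continuous_on {a..b} Y" "continuous_on {a..b} Z" "a \<le> b"
    and "\<And>r. r \<in> {a..b} \<Longrightarrow> to_torus (Y r) = to_torus (Z r)"
  obtains k :: int where "\<And>r. r \<in> {a..b::real} \<Longrightarrow> Y r = Z r + of_int k"
proof -
  have i: "Y r - Z r \<in> \<int>" if "r \<in> {a..b}" for r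
    using assms(4)[OF that] by (simp add: to_torus_eq_iff)
  have "(\<lambda>r. Y r - Z r) constant_on {a..b}"
  proof (rule continuous_discrete_range_constant)
    show "connected {a..b}" by simp
    show "continuous_on {a..b} (\<lambda>r. Y r - Z r)" by (intro continuous_intros assms)
    show "\<exists>e>0. \<forall>y. y \<in> {a..b} \<and> Y y - Z y \<noteq> Y x - Z x \<longrightarrow> e \<le> norm (Y y - Z y - (Y x - Z x))"
      if "x \<in> {a..b}" for x
    proof (intro exI[of _ 1] conjI allI impI)
      fix y assume "y \<in> {a..b} \<and> Y y - Z y \<noteq> Y x - Z x"
      then show "1 \<le> norm (Y y - Z y - (Y x - Z x))"
        using Ints_diff[OF i[of y] i[OF that]] by (simp add: Ints_nonzero_abs_ge1)
    qed simp
  qed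
  then obtain c where c: "\<And>r. r \<in> {a..b} \<Longrightarrow> Y r - Z r = c" unfolding constant_on_def by blast
  have "c \<in> \<int>" using i[of a] c[of a] assms(3) by simp
  then obtain k where "c = of_int k" by (elim Ints_cases)
  with c show ?thesis by (intro that[of k]) (auto simp: algebra_simps)
qed

lemma weak_derivD:
  assumes "is_weak_deriv a b X v"
  shows "set_borel_measurable lborel {a..b} v" "set_integrable lborel {a..b} (\<lambda>r. (v r)\<^sup>2)"
    "set_integrable lborel {a..b} v" "set_integrable lborel {a..b} (\<lambda>r. (v r - \<theta>)\<^sup>2)"
  using assms set_integrable_of_sq set_integrable_shift_sq by (auto simp: is_weak_deriv_def)

lemma weak_deriv_lift:
  assumes "is_weak_deriv a b X v"
  shows "\<exists>Y. continuous_on {a..b} Y \<and> (\<forall>r\<in>{a..b}. X r = to_torus (Y r)) \<and>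
    (\<forall>r\<in>{a..b}. (LINT q:{a..r}|lborel. v q) = Y r - Y a)"
proof -
  obtain y0 where y0: "\<forall>r\<in>{a..b}. X r = to_torus (y0 + (LINT q:{a..r}|lborel. v q))"
    using assms by (auto simp: is_weak_deriv_def)
  have "(LINT q:{a..a}|lborel. v q) = 0"
    using integral_discrete_difference[where X="{a}" and M=lborel and f="\<lambda>x. indicat_real {a} x *\<^sub>R v x" and g="\<lambda>_. 0"]
    by (simp add: set_lebesgue_integral_def)
  then show ?thesis using y0
    by (intro exI[of _ "\<lambda>r. y0 + (LINT q:{a..r}|lborel. v q)"] conjI continuous_intros
        continuous_on_primitive weak_derivD(3)[OF assms]) auto
qed

lemma weak_deriv_primitive:
  assumes v: "is_weak_deriv a b X v" and Y: "continuous_on {a..b} Y"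
    and X: "\<And>r. r \<in> {a..b} \<Longrightarrow> X r = to_torus (Y r)" and r: "r \<in> {a..b}"
  shows "(LINT q:{a..r}|lborel. v q) = Y r - Y a"
proof -
  obtain Z where Z: "continuous_on {a..b} Z" "\<And>r. r \<in> {a..b} \<Longrightarrow> X r = to_torus (Z r)"
    "\<And>r. r \<in> {a..b} \<Longrightarrow> (LINT q:{a..r}|lborel. v q) = Z r - Z a"
    using weak_deriv_lift[OF v] by blast
  obtain k :: int where k: "\<And>r. r \<in> {a..b} \<Longrightarrow> Y r = Z r + of_int k"
    by (rule lifts_differ_by_int[OF Y Z(1)]) (use r X Z in auto)
  show ?thesis using Z(3)[OF r] k[OF r] k[of a] r by auto
qed

text \<open>This makes the action and the increments independent of the choice in
  \<^const>\<open>weak_deriv\<close>.\<close>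

lemma weak_deriv_AE_unique:
  assumes v: "is_weak_deriv a b X v" and w: "is_weak_deriv a b X w"
  shows "AE x in lborel. x \<in> {a..b} \<longrightarrow> v x = w x"
proof -
  obtain Y where Y: "continuous_on {a..b} Y" "\<And>r. r \<in> {a..b} \<Longrightarrow> X r = to_torus (Y r)"
    "\<And>r. r \<in> {a..b} \<Longrightarrow> (LINT q:{a..r}|lborel. v q) = Y r - Y a"
    using weak_deriv_lift[OF v] by blast
  have "AE x in lborel. x \<in> {a..b} \<longrightarrow> v x - w x = 0"
  proof (rule primitive_zero_imp_AE_zero)
    show "set_integrable lborel {a..b} (\<lambda>x. v x - w x)"
      by (intro set_integral_diff weak_derivD(3)[OF v] weak_derivD(3)[OF w])
    fix r assume r: "r \<in> {a..b}"
    have i: "set_integrable lborel {a..r} v" "set_integrable lborel {a..r} w"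
      using r by (auto intro: set_integrable_subset[OF weak_derivD(3)[OF v]]
          set_integrable_subset[OF weak_derivD(3)[OF w]])
    show "(LINT q:{a..r}|lborel. v q - w q) = 0"
      using Y(3)[OF r] weak_deriv_primitive[OF w Y(1,2) r] by (simp add: set_integral_diff(2)[OF i])
  qed
  then show ?thesis by simp
qed

lemma is_weak_deriv_weak_deriv:
  assumes "H1_path a b X" shows "is_weak_deriv a b X (weak_deriv a b X)"
  using assms unfolding H1_path_def weak_deriv_def by (rule someI_ex)

lemma kinetic_eq:
  assumes v: "is_weak_deriv a b X v"
  shows "kinetic \<theta> a b X = (LINT r:{a..b}|lborel. (v r - \<theta>)\<^sup>2)"
proof -
  have w: "is_weak_deriv a b X (weak_deriv a b X)"
    using v by (intro is_weak_deriv_weak_deriv) (auto simp: H1_path_def)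
  show ?thesis unfolding kinetic_def set_lebesgue_integral_def
  proof (rule integral_cong_AE)
    show "AE x in lborel. indicat_real {a..b} x *\<^sub>R (weak_deriv a b X x - \<theta>)\<^sup>2 = indicat_real {a..b} x *\<^sub>R (v x - \<theta>)\<^sup>2"
      using weak_deriv_AE_unique[OF w v] by eventually_elim (auto simp: indicator_def)
    show "(\<lambda>x. indicat_real {a..b} x *\<^sub>R (weak_deriv a b X x - \<theta>)\<^sup>2) \<in> borel_measurable lborel"
      "(\<lambda>x. indicat_real {a..b} x *\<^sub>R (v x - \<theta>)\<^sup>2) \<in> borel_measurable lborel"
      using weak_derivD(4)[OF v, of \<theta>] weak_derivD(4)[OF w, of \<theta>]
      unfolding set_integrable_def by (auto dest: borel_measurable_integrable)
  qed
qed

lemma weak_deriv_cong: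
  assumes "\<And>r. r \<in> {a..b} \<Longrightarrow> X r = Z r"
  shows "is_weak_deriv a b X = is_weak_deriv a b Z" "weak_deriv a b X = weak_deriv a b Z"
    "H1_path a b X = H1_path a b Z" "kinetic \<theta> a b X = kinetic \<theta> a b Z" "increment a b X = increment a b Z"
proof -
  show 1: "is_weak_deriv a b X = is_weak_deriv a b Z"
    using assms by (auto simp: is_weak_deriv_def fun_eq_iff)
  show 2: "weak_deriv a b X = weak_deriv a b Z" by (simp add: weak_deriv_def 1)
  show "H1_path a b X = H1_path a b Z" by (simp add: H1_path_def 1)
  show "kinetic \<theta> a b X = kinetic \<theta> a b Z" by (simp add: kinetic_def 2)
  show "increment a b X = increment a b Z" by (simp add: increment_def 2)
qed

lemma H1_iff: "X \<in> H1 a b \<longleftrightarrow> X \<in> extensional {a..b} \<and> H1_path a b X"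
  by (auto simp: H1_def H1_path_def)

lemma is_weak_deriv_subinterval:
  assumes v: "is_weak_deriv a b X v" and "a \<le> c" "c \<le> d" "d \<le> b"
  shows "is_weak_deriv c d X v"
proof -
  obtain Y where Y: "continuous_on {a..b} Y" "\<And>r. r \<in> {a..b} \<Longrightarrow> X r = to_torus (Y r)"
    "\<And>r. r \<in> {a..b} \<Longrightarrow> (LINT q:{a..r}|lborel. v q) = Y r - Y a"
    using weak_deriv_lift[OF v] by blast
  have sub: "{c..d} \<subseteq> {a..b}" using assms by auto
  have 1: "set_integrable lborel {c..d} (\<lambda>r. (v r)\<^sup>2)"
    using sub by (intro set_integrable_subset[OF weak_derivD(2)[OF v]]) auto
  have "set_integrable lborel {c..d} v"
    using sub by (intro set_integrable_subset[OF weak_derivD(3)[OF v]]) auto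
  then have 2: "set_borel_measurable lborel {c..d} v"
    by (auto simp: set_borel_measurable_def set_integrable_def)
  have 3: "X r = to_torus (Y c + (LINT q:{c..r}|lborel. v q))" if r: "r \<in> {c..d}" for r
  proof -
  have "set_integrable lborel {a..r} v"
    using r assms by (intro set_integrable_subset[OF weak_derivD(3)[OF v]]) auto
  from set_integral_split[OF this, of c] r assms Y(3)[of r] Y(3)[of c] Y(2)[of r]
  show ?thesis by auto
  qed
  show ?thesis unfolding is_weak_deriv_def using 1 2 3 by blast
qed

lemma H1_path_subinterval: "H1_path a b X \<Longrightarrow> a \<le> c \<Longrightarrow> c \<le> d \<Longrightarrow> d \<le> b \<Longrightarrow> H1_path c d X"
  unfolding H1_path_def by (blast intro: is_weak_deriv_subinterval)

lemma H1_path_lift: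
  assumes "H1_path a b X"
  shows "\<exists>Y. continuous_on {a..b} Y \<and> (\<forall>r\<in>{a..b}. X r = to_torus (Y r))"
  using assms weak_deriv_lift unfolding H1_path_def by blast

lemma kinetic_split:
  assumes "H1_path a b X" "a \<le> c" "c \<le> b"
  shows "kinetic \<theta> a b X = kinetic \<theta> a c X + kinetic \<theta> c b X"
proof -
  obtain v where v: "is_weak_deriv a b X v" using assms by (auto simp: H1_path_def)
  have "is_weak_deriv a c X v" "is_weak_deriv c b X v"
    using is_weak_deriv_subinterval[OF v] assms by auto
  then show ?thesis
    using set_integral_split[OF weak_derivD(4)[OF v] assms(2,3)] v by (simp add: kinetic_eq)
qed

lemma increment_lift:
  assumes "H1_path a b X" "continuous_on {a..b} Y" "\<And>r. r \<in> {a..b} \<Longrightarrow> X r = to_torus (Y r)" "a \<le> b"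
  shows "increment a b X = Y b - Y a"
  unfolding increment_def
  using weak_deriv_primitive[OF is_weak_deriv_weak_deriv[OF assms(1)] assms(2,3), of b] assms(4) by simp

lemma increment_split:
  assumes "H1_path a b X" "a \<le> c" "c \<le> b"
  shows "increment a b X = increment a c X + increment c b X"
proof -
  obtain Y where Y: "continuous_on {a..b} Y" "\<And>r. r \<in> {a..b} \<Longrightarrow> X r = to_torus (Y r)"
    using H1_path_lift[OF assms(1)] by blast
  have "continuous_on {a..c} Y" "continuous_on {c..b} Y"
    using assms by (auto intro: continuous_on_subset[OF Y(1)])
  then show ?thesis
    using increment_lift[OF assms(1) Y] increment_lift[of a c X Y] increment_lift[of c b X Y]
      H1_path_subinterval[OF assms(1)] Y(2) assms(2,3) by auto
qed

lemma H1_path_join: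
  assumes X: "H1_path a c X" and Z: "H1_path c b Z" and eq: "X c = Z c" and ab: "a \<le> c" "c \<le> b"
  shows "H1_path a b (\<lambda>r. if r \<le> c then X r else Z r)"
proof -
  obtain v w where v: "is_weak_deriv a c X v" and w: "is_weak_deriv c b Z w"
    using X Z by (auto simp: H1_path_def)
  obtain Y where Y: "continuous_on {a..c} Y" "\<And>r. r \<in> {a..c} \<Longrightarrow> X r = to_torus (Y r)"
    "\<And>r. r \<in> {a..c} \<Longrightarrow> (LINT q:{a..r}|lborel. v q) = Y r - Y a"
    using weak_deriv_lift[OF v] by blast
  obtain W where W: "continuous_on {c..b} W" "\<And>r. r \<in> {c..b} \<Longrightarrow> Z r = to_torus (W r)"
    "\<And>r. r \<in> {c..b} \<Longrightarrow> (LINT q:{c..r}|lborel. w q) = W r - W c"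
    using weak_deriv_lift[OF w] by blast
  define u where "u = (\<lambda>r. if r \<le> c then v r else w r)"
  have U: "{a..b} = {a..c} \<union> {c..b}" using ab by auto
  have i1: "set_integrable lborel {a..c} (\<lambda>r. f (u r))" if "set_integrable lborel {a..c} (\<lambda>r. f (v r))"
    for f :: "real \<Rightarrow> real"
    using that by (subst set_integrable_cong[of lborel lborel _ "{a..c}" _ "\<lambda>r. f (v r)"]) (auto simp: u_def)
  have ii: "set_integrable lborel {c..b} g" if "set_integrable lborel {c..b} h"
    "\<And>r. r > c \<Longrightarrow> g r = h r" for g h :: "real \<Rightarrow> real"
  proof -
    have "integrable lborel (\<lambda>x. indicat_real {c..b} x *\<^sub>R h x) = integrable lborel (\<lambda>x. indicat_real {c..b} x *\<^sub>R g x)"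
      by (rule integrable_discrete_difference[where X="{c}"]) (auto simp: that(2) indicator_def)
    then show ?thesis using that(1) by (simp add: set_integrable_def)
  qed
  have i2: "set_integrable lborel {c..b} (\<lambda>r. f (u r))" if "set_integrable lborel {c..b} (\<lambda>r. f (w r))"
    for f :: "real \<Rightarrow> real"
    by (rule ii[OF that]) (auto simp: u_def)
  have isq: "set_integrable lborel {a..b} (\<lambda>r. (u r)\<^sup>2)"
    unfolding U by (intro set_integrable_Un i1 i2 weak_derivD(2)[OF v] weak_derivD(2)[OF w]) auto
  have i: "set_integrable lborel {a..b} u"
    using i1[of "\<lambda>x. x"] i2[of "\<lambda>x. x"] weak_derivD(3)[OF v] weak_derivD(3)[OF w]
    unfolding U by (intro set_integrable_Un) auto
  have Pv: "(LINT q:{a..r}|lborel. u q) = Y r - Y a" if "r \<in> {a..c}" for r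
  proof -
    have "(LINT q:{a..r}|lborel. u q) = (LINT q:{a..r}|lborel. v q)"
      using that by (intro set_lebesgue_integral_cong) (auto simp: u_def)
    then show ?thesis using Y(3)[OF that] by simp
  qed
  have Pw: "(LINT q:{c..r}|lborel. u q) = W r - W c" if "r \<in> {c..b}" for r
  proof -
    have "(LINT q:{c..r}|lborel. u q) = (LINT q:{c..r}|lborel. w q)"
      unfolding set_lebesgue_integral_def
      by (rule integral_discrete_difference[where X="{c}"]) (auto simp: u_def indicator_def)
    then show ?thesis using W(3)[OF that] by simp
  qed
  have "to_torus (Y c) = to_torus (W c)" using Y(2)[of c] W(2)[of c] eq ab by simp
  then obtain k where k: "Y c = W c + of_int k"
    by (metis Ints_cases add.commute diff_add_cancel to_torus_eq_iff)
  have "is_weak_deriv a b (\<lambda>r. if r \<le> c then X r else Z r) u"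
    unfolding is_weak_deriv_def
  proof (intro conjI exI ballI isq)
    show "set_borel_measurable lborel {a..b} u"
      using i by (auto simp: set_borel_measurable_def set_integrable_def)
    fix r assume r: "r \<in> {a..b}"
    show "(if r \<le> c then X r else Z r) = to_torus (Y a + (LINT q:{a..r}|lborel. u q))"
    proof (cases "r \<le> c")
      case True
      then show ?thesis using Pv[of r] Y(2)[of r] r by simp
    next
      case False
      have "set_integrable lborel {a..r} u"
        using r by (intro set_integrable_subset[OF i]) auto
      from set_integral_split[OF this, of c] False r ab
      have "(LINT q:{a..r}|lborel. u q) = (Y c - Y a) + (W r - W c)"
        using Pv[of c] Pw[of r] by auto
      then have "Y a + (LINT q:{a..r}|lborel. u q) = W r + of_int k" using k by simp
      then show ?thesis using False W(2)[of r] r by simp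
    qed
  qed
  then show ?thesis by (auto simp: H1_path_def)
qed

lemma LINT_const_Icc: "a \<le> b \<Longrightarrow> (LINT q:{a..b::real}|lborel. c :: real) = c * (b - a)"
  by (simp add: set_lebesgue_integral_def)

lemma is_weak_deriv_linear: "is_weak_deriv a b (\<lambda>r. to_torus (y + c * (r - a))) (\<lambda>_. c)"
  unfolding is_weak_deriv_def
  by (intro conjI exI[of _ y] ballI set_integrable_const_Icc) (auto simp: LINT_const_Icc set_borel_measurable_def)

lemma kinetic_linear: "a \<le> b \<Longrightarrow> kinetic \<theta> a b (\<lambda>r. to_torus (y + c * (r - a))) = (c - \<theta>)\<^sup>2 * (b - a)"
  by (subst kinetic_eq[OF is_weak_deriv_linear]) (simp add: LINT_const_Icc)

lemma H1_path_linear: "H1_path a b (\<lambda>r. to_torus (y + c * (r - a)))"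
  unfolding H1_path_def by (rule exI) (rule is_weak_deriv_linear)

lemma kinetic_nonneg: "kinetic \<theta> a b X \<ge> 0"
  unfolding kinetic_def set_lebesgue_integral_def by (intro integral_nonneg_AE) auto

text \<open>Jensen's inequality with its defect: replacing a path by the line with the same lifted end points
  and slope \<open>c\<close> saves exactly the kinetic energy relative to \<open>c\<close>, since the mixed
  term is a multiple of the integral of \<open>v - c\<close>, which is zero.\<close>

lemma kinetic_linear_excess:
  assumes X: "H1_path a b X" and Y: "continuous_on {a..b} Y" "\<And>r. r \<in> {a..b} \<Longrightarrow> X r = to_torus (Y r)"
    and ab: "a < b"
  defines "c \<equiv> (Y b - Y a) / (b - a)"
  shows "kinetic \<theta> a b X = kinetic c a b X + (c - \<theta>)\<^sup>2 * (b - a)"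
proof -
  obtain v where v: "is_weak_deriv a b X v" using X by (auto simp: H1_path_def)
  have "(LINT r:{a..b}|lborel. (v r - \<theta>)\<^sup>2)
      = (LINT r:{a..b}|lborel. (v r - c)\<^sup>2 + (2 * (c - \<theta>) * v r + (\<theta>\<^sup>2 - c\<^sup>2)))"
    by (simp add: power2_eq_square algebra_simps)
  also have "\<dots> = (LINT r:{a..b}|lborel. (v r - c)\<^sup>2)
      + (LINT r:{a..b}|lborel. 2 * (c - \<theta>) * v r + (\<theta>\<^sup>2 - c\<^sup>2))"
    by (intro set_integral_add weak_derivD[OF v] set_integrable_mult_right set_integrable_const_Icc)
  also have "(LINT r:{a..b}|lborel. 2 * (c - \<theta>) * v r + (\<theta>\<^sup>2 - c\<^sup>2))
      = (LINT r:{a..b}|lborel. 2 * (c - \<theta>) * v r) + (LINT r:{a..b}|lborel. \<theta>\<^sup>2 - c\<^sup>2)"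
    by (intro set_integral_add weak_derivD[OF v] set_integrable_mult_right set_integrable_const_Icc)
  also have "\<dots> = 2 * (c - \<theta>) * (Y b - Y a) + (\<theta>\<^sup>2 - c\<^sup>2) * (b - a)"
    using weak_deriv_primitive[OF v Y, of b] ab by (simp add: LINT_const_Icc)
  also have "Y b - Y a = c * (b - a)" using ab by (simp add: c_def)
  finally show ?thesis unfolding kinetic_eq[OF v] by (simp add: power2_eq_square algebra_simps)
qed

lemma kinetic_zero_linear:
  assumes X: "H1_path a b X" and Y: "continuous_on {a..b} Y" "\<And>r. r \<in> {a..b} \<Longrightarrow> X r = to_torus (Y r)"
    and z: "kinetic c a b X = 0" and r: "r \<in> {a..b}"
  shows "Y r = Y a + c * (r - a)"
proof -
  obtain v where v: "is_weak_deriv a b X v" using X by (auto simp: H1_path_def)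
  have "(LINT x|lborel. indicator {a..b} x *\<^sub>R (v x - c)\<^sup>2) = 0"
    using z unfolding kinetic_eq[OF v] by (simp add: set_lebesgue_integral_def)
  then have "AE x in lborel. indicator {a..b} x *\<^sub>R (v x - c)\<^sup>2 = 0"
    using weak_derivD(4)[OF v, of c]
    by (subst (asm) integral_nonneg_eq_0_iff_AE) (auto simp: set_integrable_def)
  then have "AE x in lborel. indicator {a..r} x *\<^sub>R v x = indicator {a..r} x *\<^sub>R c"
  proof eventually_elim
    case (elim x)
    then show ?case using r by (auto simp: indicator_def split: if_splits)
  qed
  moreover have "set_integrable lborel {a..r} v"
    using r by (intro set_integrable_subset[OF weak_derivD(3)[OF v]]) auto
  ultimately have "(LINT q:{a..r}|lborel. v q) = (LINT q:{a..r}|lborel. c)"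
    unfolding set_lebesgue_integral_def set_integrable_def
    by (intro integral_cong_AE) (auto dest: borel_measurable_integrable)
  then show ?thesis using weak_deriv_primitive[OF v Y r] r by (simp add: LINT_const_Icc)
qed

section \<open>The action in a configuration of atoms\<close>

lemma H1_path_liftE:
  assumes "H1_path a b X"
  obtains Y where "continuous_on {a..b} Y" "\<forall>r\<in>{a..b}. X r = to_torus (Y r)"
proof -
  note H1_path_lift[OF assms]
  then obtain Y where "continuous_on {a..b} Y \<and> (\<forall>r\<in>{a..b}. X r = to_torus (Y r))" by (rule exE)
  then show ?thesis by (intro that[of Y]) (rule conjunct1, assumption, rule conjunct2, assumption)
qed

text \<open>Minimality between its own end points, again up to extensionality.\<close>

definition is_minimizer :: "(real \<times> torus) measure \<Rightarrow> real \<Rightarrow> real \<Rightarrow> real \<Rightarrow> (real \<Rightarrow> torus) \<Rightarrow> bool" where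
  "is_minimizer \<mu> \<theta> a b X \<longleftrightarrow> H1_path a b X \<and>
     (\<forall>Z. H1_path a b Z \<longrightarrow> Z a = X a \<longrightarrow> Z b = X b \<longrightarrow> action \<mu> \<theta> a b X \<le> action \<mu> \<theta> a b Z)"

definition graph_mass :: "(real \<times> torus) measure \<Rightarrow> real \<Rightarrow> real \<Rightarrow> (real \<Rightarrow> torus) \<Rightarrow> real" where
  "graph_mass \<mu> a b X = measure \<mu> {(r, X r) | r. r \<in> {a..<b}}"

text \<open>If \<open>X\<close> and \<open>Z\<close> are minimizers with common points at times
  \<open>c\<close> and \<open>d\<close>, this is a minimizer again (\<open>is_minimizer_splice\<close>).\<close>

definition path_splice :: "(real \<Rightarrow> torus) \<Rightarrow> (real \<Rightarrow> torus) \<Rightarrow> real \<Rightarrow> real \<Rightarrow> real \<Rightarrow> torus" where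
  "path_splice X Z c d = (\<lambda>r. if c \<le> r \<and> r \<le> d then Z r else X r)"

lemma action_eq: "action \<mu> \<theta> a b X = kinetic \<theta> a b X / 2 - graph_mass \<mu> a b X"
  by (simp add: action_def kinetic_def graph_mass_def)

lemma action_cong:
  assumes "\<And>r. r \<in> {a..b} \<Longrightarrow> X r = Z r"
  shows "action \<mu> \<theta> a b X = action \<mu> \<theta> a b Z"
proof -
  have "{(r, X r) | r. r \<in> {a..<b}} = {(r, Z r) | r. r \<in> {a..<b}}"
    using assms by force
  then show ?thesis
    unfolding action_eq graph_mass_def using weak_deriv_cong(4)[of a b X Z \<theta>] assms by simp
qed

lemma is_minimizer_cong:
  assumes "\<And>r. r \<in> {a..b} \<Longrightarrow> X r = Z r" "a \<le> b"
  shows "is_minimizer \<mu> \<theta> a b X \<longleftrightarrow> is_minimizer \<mu> \<theta> a b Z"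
  unfolding is_minimizer_def using action_cong[of a b X Z] weak_deriv_cong(3)[of a b X Z] assms by auto

lemma minimizers_between_iff:
  assumes "a \<le> b"
  shows "X \<in> minimizers_between \<mu> \<theta> a y b x \<longleftrightarrow>
    X \<in> extensional {a..b} \<and> is_minimizer \<mu> \<theta> a b X \<and> X a = y \<and> X b = x"
proof
  assume "X \<in> minimizers_between \<mu> \<theta> a y b x"
  then have X: "X \<in> extensional {a..b}" "H1_path a b X" "X a = y" "X b = x"
    and m: "\<And>Z. Z \<in> H1 a b \<Longrightarrow> Z a = y \<Longrightarrow> Z b = x \<Longrightarrow> action \<mu> \<theta> a b X \<le> action \<mu> \<theta> a b Z"
    by (auto simp: minimizers_between_def H1_iff)
  have "action \<mu> \<theta> a b X \<le> action \<mu> \<theta> a b Z" if "H1_path a b Z" "Z a = X a" "Z b = X b" for Z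
    using m[of "restrict Z {a..b}"] that X(3,4) assms weak_deriv_cong(3)[of a b Z "restrict Z {a..b}"]
      action_cong[of a b Z "restrict Z {a..b}" \<mu> \<theta>] by (simp add: H1_iff)
  with X show "X \<in> extensional {a..b} \<and> is_minimizer \<mu> \<theta> a b X \<and> X a = y \<and> X b = x"
    by (simp add: is_minimizer_def)
next
  assume "X \<in> extensional {a..b} \<and> is_minimizer \<mu> \<theta> a b X \<and> X a = y \<and> X b = x"
  then show "X \<in> minimizers_between \<mu> \<theta> a y b x"
    by (auto simp: minimizers_between_def H1_iff is_minimizer_def)
qed

lemma restrict_minimizers_between_iff:
  assumes "a \<le> b"
  shows "restrict X {a..b} \<in> minimizers_between \<mu> \<theta> a y b x \<longleftrightarrow> is_minimizer \<mu> \<theta> a b X \<and> X a = y \<and> X b = x"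
  using assms is_minimizer_cong[of a b "restrict X {a..b}" X \<mu> \<theta>] by (auto simp: minimizers_between_iff)

lemma H1_path_splice:
  assumes X: "H1_path a b X" and Z: "H1_path c d Z" and "a \<le> c" "c \<le> d" "d \<le> b" "Z c = X c" "Z d = X d"
  shows "H1_path a b (path_splice X Z c d)"
proof -
  have "H1_path a d (\<lambda>r. if r \<le> c then X r else Z r)"
    by (rule H1_path_join[OF H1_path_subinterval[OF X, of a c] Z]) (use assms in auto)
  from H1_path_join[OF this H1_path_subinterval[OF X, of d b]] assms
  have "H1_path a b (\<lambda>r. if r \<le> d then if r \<le> c then X r else Z r else X r)" by auto
  moreover have "(if r \<le> d then if r \<le> c then X r else Z r else X r) = path_splice X Z c d r" for r
    using assms by (auto simp: path_splice_def)
  ultimately show ?thesis by simp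
qed

locale configuration =
  fixes \<mu> :: "(real \<times> torus) measure"
  assumes in_Omega: "\<mu> \<in> Omega"
begin

lemma sets_\<mu>: "sets \<mu> = sets borel"
  using in_Omega unfolding Omega_def by blast

lemma finite_atom: "emeasure \<mu> {p} < \<infinity>"
  using in_Omega unfolding Omega_def by blast

lemma atomic: "A \<in> sets borel \<Longrightarrow> emeasure \<mu> A = (\<integral>\<^sup>+ p\<in>A. emeasure \<mu> {p} \<partial>count_space UNIV)"
  using in_Omega unfolding Omega_def purely_atomic_def by blast

lemma no_limpt: "\<not> p islimpt supp \<mu>"
  using in_Omega unfolding Omega_def by blast

lemma emeasure_singleton_zero: "p \<notin> supp \<mu> \<Longrightarrow> emeasure \<mu> {p} = 0"
proof -
  assume "p \<notin> supp \<mu>"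
  then obtain U where U: "open U" "p \<in> U" "emeasure \<mu> U = 0" by (auto simp: supp_def)
  then have "emeasure \<mu> {p} \<le> emeasure \<mu> U" by (intro emeasure_mono) (auto simp: sets_\<mu>)
  with U show ?thesis by simp
qed

lemma emeasure_null: "A \<in> sets borel \<Longrightarrow> A \<inter> supp \<mu> = {} \<Longrightarrow> emeasure \<mu> A = 0"
proof -
  assume A: "A \<in> sets borel" "A \<inter> supp \<mu> = {}"
  have "(\<integral>\<^sup>+ p\<in>A. emeasure \<mu> {p} \<partial>count_space UNIV) = (\<integral>\<^sup>+ p. 0 \<partial>count_space (UNIV :: (real \<times> torus) set))"
  proof (rule nn_integral_cong)
    fix p show "emeasure \<mu> {p} * indicator A p = 0"
      using A(2) emeasure_singleton_zero[of p] by (cases "p \<in> A") auto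
  qed
  then show ?thesis by (simp add: atomic[OF A(1)])
qed

lemma measure_not_atom: "p \<notin> supp \<mu> \<Longrightarrow> measure \<mu> {p} = 0"
  by (simp add: measure_def emeasure_singleton_zero)

lemma finite_strip: "finite (supp \<mu> \<inter> ({a..b} \<times> UNIV))"
proof (rule ccontr)
  assume inf: "infinite (supp \<mu> \<inter> ({a..b} \<times> UNIV))"
  have "compact ({a..b::real} \<times> (UNIV :: torus set))"
    by (intro compact_Times compact_UNIV_torus) auto
  from Heine_Borel_imp_Bolzano_Weierstrass[OF this inf]
  obtain p where "p islimpt (supp \<mu> \<inter> ({a..b} \<times> UNIV))" by auto
  then have "p islimpt supp \<mu>" by (rule islimpt_subset) auto
  with no_limpt show False by blast
qed

lemma emeasure_strip: "A \<in> sets borel \<Longrightarrow> A \<subseteq> {a..b} \<times> UNIV \<Longrightarrow> emeasure \<mu> A \<noteq> \<infinity>"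
proof -
  assume A: "A \<in> sets borel" "A \<subseteq> {a..b} \<times> UNIV"
  let ?F = "supp \<mu> \<inter> ({a..b} \<times> UNIV)"
  have "emeasure \<mu> A = (\<Sum>p\<in>?F. emeasure \<mu> {p} * indicator A p)"
    unfolding atomic[OF A(1)] using A(2)
    by (intro nn_integral_count_space') (auto simp: finite_strip emeasure_singleton_zero indicator_def)
  also have "\<dots> < \<infinity>"
    using finite_atom by (auto simp: ennreal_mult_less_top indicator_def finite_strip)
  finally show ?thesis by simp
qed

text \<open>In coordinates of the cylinder the graph is the set where the difference from a continuous lift is
  an integer.\<close>

lemma graph_borel:
  assumes "H1_path a b X"
  shows "{(r, X r) | r. r \<in> {a..<b}} \<in> sets borel"
proof -
  obtain Y where Y: "continuous_on {a..b} Y" "\<forall>r\<in>{a..b}. X r = to_torus (Y r)"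
    by (rule H1_path_liftE[OF assms])
  define Y' where "Y' = (\<lambda>r. if r \<in> {a..b} then Y r else 0)"
  have [measurable]: "Y' \<in> borel_measurable borel"
    unfolding Y'_def by (intro borel_measurable_continuous_on_if Y(1) continuous_on_const) auto
  have [measurable]: "(fst :: real \<times> torus \<Rightarrow> real) \<in> borel_measurable borel"
      "(snd :: real \<times> torus \<Rightarrow> torus) \<in> borel_measurable borel"
    by (auto intro!: borel_measurable_continuous_onI continuous_on_fst continuous_on_snd continuous_on_id)
  have eq: "{(r, X r) | r. r \<in> {a..<b}} = {p \<in> space borel. fst p \<in> {a..<b} \<and> torus_coord (snd p) - Y' (fst p) \<in> \<int>}"
  proof (intro equalityI subsetI)
    fix p assume "p \<in> {(r, X r) | r. r \<in> {a..<b}}"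
    then obtain r where r: "p = (r, to_torus (Y r))" "r \<in> {a..<b}" using Y(2) by force
    have "torus_coord (to_torus (Y r)) - Y r \<in> \<int>"
      by (subst to_torus_eq_iff[symmetric]) simp
    then show "p \<in> {p \<in> space borel. fst p \<in> {a..<b} \<and> torus_coord (snd p) - Y' (fst p) \<in> \<int>}"
      using r by (auto simp: Y'_def)
  next
    fix p assume "p \<in> {p \<in> space borel. fst p \<in> {a..<b} \<and> torus_coord (snd p) - Y' (fst p) \<in> \<int>}"
    then have r: "fst p \<in> {a..<b}" "torus_coord (snd p) - Y (fst p) \<in> \<int>" by (auto simp: Y'_def)
    from r(2) have "snd p = to_torus (Y (fst p))"
      by (subst (asm) to_torus_eq_iff[symmetric]) simp
    then have "p = (fst p, X (fst p))" using r(1) Y(2) by (cases p) auto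
    then show "p \<in> {(r, X r) | r. r \<in> {a..<b}}" using r(1) by blast
  qed
  have "\<int> \<in> sets (borel :: real measure)" by (intro borel_closed closed_Ints)
  then show ?thesis unfolding eq by measurable
qed

lemma graph_finite:
  assumes "H1_path a b X"
  shows "emeasure \<mu> {(r, X r) | r. r \<in> {a..<b}} \<noteq> \<infinity>"
  by (rule emeasure_strip[OF graph_borel[OF assms], of a b]) auto

lemma graph_mass_split:
  assumes X: "H1_path a b X" and c: "a \<le> c" "c \<le> b"
  shows "graph_mass \<mu> a b X = graph_mass \<mu> a c X + graph_mass \<mu> c b X"
proof -
  have b: "{(r, X r) | r. r \<in> {a..<c}} \<in> sets borel" "{(r, X r) | r. r \<in> {c..<b}} \<in> sets borel"
    using graph_borel[OF H1_path_subinterval[OF X, of a c]] graph_borel[OF H1_path_subinterval[OF X, of c b]] c by auto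
  have "{(r, X r) | r. r \<in> {a..<b}} = {(r, X r) | r. r \<in> {a..<c}} \<union> {(r, X r) | r. r \<in> {c..<b}}"
    using c by auto
  moreover have "{(r, X r) | r. r \<in> {a..<c}} \<inter> {(r, X r) | r. r \<in> {c..<b}} = {}" by auto
  ultimately show ?thesis
    unfolding graph_mass_def using b graph_finite[OF H1_path_subinterval[OF X, of a c]]
      graph_finite[OF H1_path_subinterval[OF X, of c b]] c
    by (simp add: measure_Union sets_\<mu>)
qed

text \<open>The interval of times in the action is closed on the left: the starting point counts and the end
  point does not.\<close>

lemma graph_mass_start_le:
  assumes X: "H1_path a b X" and ab: "a < b"
  shows "measure \<mu> {(a, X a)} \<le> graph_mass \<mu> a b X"
  unfolding graph_mass_def measure_def
  using graph_borel[OF X] graph_finite[OF X] ab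
  by (intro enn2real_mono emeasure_mono) (auto simp: sets_\<mu> less_top)

lemma graph_mass_no_hits:
  assumes X: "H1_path a b X" and ab: "a < b" and no: "\<And>r. a < r \<Longrightarrow> r < b \<Longrightarrow> (r, X r) \<notin> supp \<mu>"
  shows "graph_mass \<mu> a b X = measure \<mu> {(a, X a)}"
proof -
  have sub: "{(a, X a)} \<subseteq> {(r, X r) | r. r \<in> {a..<b}}" using ab by auto
  have m: "{(r, X r) | r. r \<in> {a..<b}} - {(a, X a)} \<in> sets borel"
    using graph_borel[OF X] by (intro sets.Diff) auto
  have "emeasure \<mu> ({(r, X r) | r. r \<in> {a..<b}} - {(a, X a)}) = 0"
    by (intro emeasure_null m) (use no in force)
  with m have "emeasure \<mu> ({(a, X a)} \<union> ({(r, X r) | r. r \<in> {a..<b}} - {(a, X a)})) = emeasure \<mu> {(a, X a)}"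
    by (intro emeasure_Un_null_set) (simp_all add: sets_\<mu> null_sets_def)
  also have "{(a, X a)} \<union> ({(r, X r) | r. r \<in> {a..<b}} - {(a, X a)}) = {(r, X r) | r. r \<in> {a..<b}}"
    using sub by blast
  finally have "emeasure \<mu> {(r, X r) | r. r \<in> {a..<b}} = emeasure \<mu> {(a, X a)}" .
  then show ?thesis by (simp add: graph_mass_def measure_def)
qed

lemma action_split:
  assumes "H1_path a b X" "a \<le> c" "c \<le> b"
  shows "action \<mu> \<theta> a b X = action \<mu> \<theta> a c X + action \<mu> \<theta> c b X"
  using graph_mass_split[OF assms] kinetic_split[OF assms, of \<theta>] by (simp add: action_eq add_divide_distrib)

lemma action_splice:
  assumes X: "H1_path a b X" and Z: "H1_path c d Z" and o: "a \<le> c" "c \<le> d" "d \<le> b" "Z c = X c" "Z d = X d"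
  shows "action \<mu> \<theta> a b (path_splice X Z c d) = action \<mu> \<theta> a c X + action \<mu> \<theta> c d Z + action \<mu> \<theta> d b X"
proof -
  let ?W = "path_splice X Z c d"
  have W: "H1_path a b ?W" by (rule H1_path_splice[OF assms])
  have "action \<mu> \<theta> a c ?W = action \<mu> \<theta> a c X" "action \<mu> \<theta> c d ?W = action \<mu> \<theta> c d Z"
     "action \<mu> \<theta> d b ?W = action \<mu> \<theta> d b X"
    using o by (auto intro!: action_cong simp: path_splice_def)
  then show ?thesis
    using action_split[OF W, of c \<theta>] action_split[OF H1_path_subinterval[OF W, of c b], of d \<theta>] o by simp
qed

lemma is_minimizer_sub:
  assumes X: "is_minimizer \<mu> \<theta> a b X" and o: "a \<le> c" "c \<le> d" "d \<le> b"
  shows "is_minimizer \<mu> \<theta> c d X"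
  unfolding is_minimizer_def
proof (intro conjI allI impI)
  have XH: "H1_path a b X" using X by (simp add: is_minimizer_def)
  then show XH': "H1_path c d X" using H1_path_subinterval o by blast
  fix Z assume Z: "H1_path c d Z" "Z c = X c" "Z d = X d"
  have e: "path_splice X Z c d a = X a" "path_splice X Z c d b = X b" using Z o by (auto simp: path_splice_def)
  have "action \<mu> \<theta> a b X \<le> action \<mu> \<theta> a b (path_splice X Z c d)"
    using X e H1_path_splice[OF XH Z(1) o Z(2,3)] by (simp add: is_minimizer_def)
  also have "\<dots> = action \<mu> \<theta> a c X + action \<mu> \<theta> c d Z + action \<mu> \<theta> d b X"
    by (rule action_splice[OF XH Z(1) o Z(2,3)])
  finally show "action \<mu> \<theta> c d X \<le> action \<mu> \<theta> c d Z"
    using action_split[OF XH, of c \<theta>] action_split[OF H1_path_subinterval[OF XH, of c b], of d \<theta>] o by simp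
qed

text \<open>Two minimizers with common points at times \<open>c\<close> and \<open>d\<close> have equal action
  between these times.\<close>

lemma is_minimizer_splice:
  assumes X: "is_minimizer \<mu> \<theta> a b X" and Z: "is_minimizer \<mu> \<theta> c d Z" and o: "a \<le> c" "c \<le> d" "d \<le> b"
    and e: "Z c = X c" "Z d = X d"
  shows "is_minimizer \<mu> \<theta> a b (path_splice X Z c d)"
proof -
  have XH: "H1_path a b X" and ZH: "H1_path c d Z" using X Z by (simp_all add: is_minimizer_def)
  have ee: "path_splice X Z c d a = X a" "path_splice X Z c d b = X b" using e o by (auto simp: path_splice_def)
  have "action \<mu> \<theta> c d Z \<le> action \<mu> \<theta> c d X"
    using Z H1_path_subinterval[OF XH o] e by (simp add: is_minimizer_def)
  then have "action \<mu> \<theta> a b (path_splice X Z c d) \<le> action \<mu> \<theta> a b X"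
    unfolding action_splice[OF XH ZH o e]
    using action_split[OF XH, of c \<theta>] action_split[OF H1_path_subinterval[OF XH, of c b], of d \<theta>] o by simp
  then show ?thesis
    using X H1_path_splice[OF XH ZH o e] ee unfolding is_minimizer_def by force
qed

lemma action_join:
  assumes X: "H1_path a c X" and Z: "H1_path c b Z" and e: "X c = Z c" and o: "a \<le> c" "c \<le> b"
  shows "action \<mu> \<theta> a b (\<lambda>r. if r \<le> c then X r else Z r) = action \<mu> \<theta> a c X + action \<mu> \<theta> c b Z"
proof -
  have "action \<mu> \<theta> a c (\<lambda>r. if r \<le> c then X r else Z r) = action \<mu> \<theta> a c X"
    "action \<mu> \<theta> c b (\<lambda>r. if r \<le> c then X r else Z r) = action \<mu> \<theta> c b Z"
    using e by (auto intro!: action_cong)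
  then show ?thesis using action_split[OF H1_path_join[OF X Z e o] o] by simp
qed

end

section \<open>Existence and finiteness of minimizers\<close>

text \<open>Only finitely many winding numbers can compete with the winding number zero.\<close>

lemma int_shift_square_finite:
  fixes c d :: real
  assumes "d > 0"
  shows "finite {k::int. ((of_int k + c) / d - \<theta>)\<^sup>2 \<le> (c / d - \<theta>)\<^sup>2}"
proof -
  define R where "R = (\<bar>c / d - \<theta>\<bar> + \<bar>\<theta>\<bar>) * d + \<bar>c\<bar>"
  have "{k::int. ((of_int k + c) / d - \<theta>)\<^sup>2 \<le> (c / d - \<theta>)\<^sup>2} \<subseteq> {\<lfloor>-R\<rfloor>..\<lceil>R\<rceil>}"
  proof
    fix k :: int assume "k \<in> {k::int. ((of_int k + c) / d - \<theta>)\<^sup>2 \<le> (c / d - \<theta>)\<^sup>2}"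
    then have "\<bar>(of_int k + c) / d - \<theta>\<bar> \<le> \<bar>c / d - \<theta>\<bar>" by (simp add: abs_le_square_iff)
    then have "\<bar>(of_int k + c) / d\<bar> \<le> \<bar>c / d - \<theta>\<bar> + \<bar>\<theta>\<bar>" by linarith
    then have "\<bar>of_int k + c\<bar> \<le> (\<bar>c / d - \<theta>\<bar> + \<bar>\<theta>\<bar>) * d"
      using assms by (simp add: abs_divide pos_divide_le_eq)
    then have "\<bar>of_int k :: real\<bar> \<le> R" by (simp add: R_def)
    then show "k \<in> {\<lfloor>-R\<rfloor>..\<lceil>R\<rceil>}" by (simp add: abs_le_iff) linarith
  qed
  then show ?thesis by (rule finite_subset) simp
qed

definition line :: "real \<Rightarrow> real \<Rightarrow> real \<Rightarrow> real \<Rightarrow> real \<Rightarrow> torus" where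
  "line a u b w = (\<lambda>r. to_torus (u + (w - u) / (b - a) * (r - a)))"

lemma line_ends: "line a u b w a = to_torus u" "a < b \<Longrightarrow> line a u b w b = to_torus w"
  by (simp_all add: line_def)

lemma H1_path_line: "H1_path a b (line a u b w)"
  unfolding line_def by (rule H1_path_linear)

lemma kinetic_line: "a < b \<Longrightarrow> kinetic \<theta> a b (line a u b w) = ((w - u) / (b - a) - \<theta>)\<^sup>2 * (b - a)"
  unfolding line_def by (rule kinetic_linear) simp

context configuration
begin

lemma action_line_le: "a < b \<Longrightarrow>
  action \<mu> \<theta> a b (line a u b w) \<le> ((w - u) / (b - a) - \<theta>)\<^sup>2 * (b - a) / 2 - measure \<mu> {(a, to_torus u)}"
  using graph_mass_start_le[OF H1_path_line, of a b u w] by (simp add: action_eq kinetic_line line_ends)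

text \<open>A path that meets no atom in the open interval collects at most the mass of its starting point, so
  only the kinetic energy is left to compare.\<close>

lemma action_no_hits:
  assumes X: "H1_path a b X" and ab: "a < b" and no: "\<And>r. a < r \<Longrightarrow> r < b \<Longrightarrow> (r, X r) \<notin> supp \<mu>"
    and Y: "continuous_on {a..b} Y" "\<And>r. r \<in> {a..b} \<Longrightarrow> X r = to_torus (Y r)"
  shows "action \<mu> \<theta> a b X = kinetic ((Y b - Y a) / (b - a)) a b X / 2 +
    (((Y b - Y a) / (b - a) - \<theta>)\<^sup>2 * (b - a) / 2 - measure \<mu> {(a, to_torus (Y a))})"
proof -
  have "X a = to_torus (Y a)" using Y(2)[of a] ab by simp
  then show ?thesis
    using kinetic_linear_excess[OF X Y ab, of \<theta>] graph_mass_no_hits[OF X ab no] by (simp add: action_eq add_divide_distrib)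
qed

lemma no_hits_linear:
  assumes X: "is_minimizer \<mu> \<theta> a b X" and ab: "a < b" and no: "\<And>r. a < r \<Longrightarrow> r < b \<Longrightarrow> (r, X r) \<notin> supp \<mu>"
    and Y: "continuous_on {a..b} Y" "\<And>r. r \<in> {a..b} \<Longrightarrow> X r = to_torus (Y r)"
  shows "\<And>r. r \<in> {a..b} \<Longrightarrow> Y r = Y a + (Y b - Y a) / (b - a) * (r - a)"
    "action \<mu> \<theta> a b X = ((Y b - Y a) / (b - a) - \<theta>)\<^sup>2 * (b - a) / 2 - measure \<mu> {(a, to_torus (Y a))}"
proof -
  have XH: "H1_path a b X" using X by (simp add: is_minimizer_def)
  have "action \<mu> \<theta> a b X \<le> action \<mu> \<theta> a b (line a (Y a) b (Y b))"
    using X H1_path_line[of a b "Y a" "Y b"] Y(2)[of a] Y(2)[of b] ab by (simp add: is_minimizer_def line_ends)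
  also note action_line_le[OF ab]
  finally have "kinetic ((Y b - Y a) / (b - a)) a b X \<le> 0"
    using action_no_hits[OF XH ab no Y, of \<theta>] by simp
  then have z: "kinetic ((Y b - Y a) / (b - a)) a b X = 0" using kinetic_nonneg[of "(Y b - Y a) / (b - a)" a b X] by simp
  show "\<And>r. r \<in> {a..b} \<Longrightarrow> Y r = Y a + (Y b - Y a) / (b - a) * (r - a)"
    by (rule kinetic_zero_linear[OF XH Y z])
  show "action \<mu> \<theta> a b X = ((Y b - Y a) / (b - a) - \<theta>)\<^sup>2 * (b - a) / 2 - measure \<mu> {(a, to_torus (Y a))}"
    using action_no_hits[OF XH ab no Y] z by simp
qed

text \<open>Cutting at an atom leaves fewer atoms in the interior of both pieces: the induction parameter for
  the structure of minimizers.\<close>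

lemma substrip_card:
  assumes p: "p \<in> supp \<mu>" "a < fst p" "fst p < b" and o: "a \<le> c" "d \<le> b" "fst p \<le> c \<or> d \<le> fst p"
  shows "card (supp \<mu> \<inter> ({c<..<d} \<times> UNIV)) < card (supp \<mu> \<inter> ({a<..<b} \<times> UNIV))"
proof (rule psubset_card_mono)
  show "finite (supp \<mu> \<inter> ({a<..<b} \<times> UNIV))"
    by (rule finite_subset[OF _ finite_strip[of a b]]) auto
  have "supp \<mu> \<inter> ({c<..<d} \<times> UNIV) \<subseteq> supp \<mu> \<inter> ({a<..<b} \<times> UNIV)" using o by auto
  moreover have "p \<in> supp \<mu> \<inter> ({a<..<b} \<times> UNIV)" using p by (cases p) auto
  moreover have "p \<notin> supp \<mu> \<inter> ({c<..<d} \<times> UNIV)" using o by (cases p) auto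
  ultimately show "supp \<mu> \<inter> ({c<..<d} \<times> UNIV) \<subset> supp \<mu> \<inter> ({a<..<b} \<times> UNIV)" by blast
qed

text \<open>Among the paths that meet no atom in the open interval, finitely many straight lines suffice. A
  line may meet further atoms by accident, which only lowers its action.\<close>

lemma straight_line_beats:
  fixes \<theta> :: real
  assumes X: "H1_path a b X" "X \<in> extensional {a..b}" and ab: "a < b" and no: "\<And>r. a < r \<Longrightarrow> r < b \<Longrightarrow> (r, X r) \<notin> supp \<mu>"
  defines "u \<equiv> torus_coord (X a)" and "w \<equiv> torus_coord (X b)"
  defines "K \<equiv> {k::int. ((of_int k + (w - u)) / (b - a) - \<theta>)\<^sup>2 \<le> ((w - u) / (b - a) - \<theta>)\<^sup>2}"
  shows "\<exists>k\<in>K. action \<mu> \<theta> a b (line a u b (w + of_int k)) \<le> action \<mu> \<theta> a b X \<and>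
    (X = restrict (line a u b (w + of_int k)) {a..b} \<or> action \<mu> \<theta> a b (line a u b (w + of_int k)) < action \<mu> \<theta> a b X)"
proof -
  obtain Y0 where Y0: "continuous_on {a..b} Y0" "\<forall>r\<in>{a..b}. X r = to_torus (Y0 r)"
    by (rule H1_path_liftE[OF X(1)])
  have "to_torus u = to_torus (Y0 a)" using Y0(2) ab by (simp add: u_def)
  then obtain j where j: "u = Y0 a + of_int j"
    by (metis Ints_cases add.commute diff_add_cancel to_torus_eq_iff)
  define Y where "Y = (\<lambda>r. Y0 r + of_int j)"
  have Y: "continuous_on {a..b} Y" "\<And>r. r \<in> {a..b} \<Longrightarrow> X r = to_torus (Y r)"
    using Y0 by (auto simp: Y_def intro!: continuous_intros)
  have Ya: "Y a = u" by (simp add: Y_def j)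
  have "to_torus (Y b) = to_torus w" using Y(2)[of b] ab by (simp add: w_def)
  then obtain k where k: "Y b = w + of_int k"
    by (metis Ints_cases add.commute diff_add_cancel to_torus_eq_iff)
  let ?c = "(Y b - Y a) / (b - a)"
  let ?m = "measure \<mu> {(a, to_torus u)}"
  have A: "action \<mu> \<theta> a b X = kinetic ?c a b X / 2 + ((?c - \<theta>)\<^sup>2 * (b - a) / 2 - ?m)"
    using action_no_hits[OF X(1) ab no Y] by (simp add: Ya)
  have L: "action \<mu> \<theta> a b (line a u b (w + of_int i)) \<le> ((of_int i + (w - u)) / (b - a) - \<theta>)\<^sup>2 * (b - a) / 2 - ?m" for i :: int
    using action_line_le[OF ab, of \<theta> u "w + of_int i"] by (simp add: algebra_simps)
  have c: "?c = (of_int k + (w - u)) / (b - a)" by (simp add: Ya k algebra_simps)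
  show ?thesis
  proof (cases "k \<in> K")
    case True
    show ?thesis
    proof (intro bexI[of _ k] conjI True)
      show le: "action \<mu> \<theta> a b (line a u b (w + of_int k)) \<le> action \<mu> \<theta> a b X"
        using L[of k] A kinetic_nonneg[of ?c a b X] by (simp add: c)
      show "X = restrict (line a u b (w + of_int k)) {a..b} \<or> action \<mu> \<theta> a b (line a u b (w + of_int k)) < action \<mu> \<theta> a b X"
      proof (cases "kinetic ?c a b X = 0")
        case True
        have "X r = restrict (line a u b (w + of_int k)) {a..b} r" for r
        proof (cases "r \<in> {a..b}")
          case r: True
          then show ?thesis using kinetic_zero_linear[OF X(1) Y True r] Y(2)[OF r] by (simp add: line_def Ya k)
        next
          case False
          then show ?thesis using X(2) by (simp add: extensional_def restrict_def del: atLeastAtMost_iff)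
        qed
        then show ?thesis by blast
      next
        case False
        then have "kinetic ?c a b X > 0" using kinetic_nonneg[of ?c a b X] by linarith
        then show ?thesis using L[of k] A by (simp add: c)
      qed
    qed
  next
    case False
    have "0 \<in> K" by (simp add: K_def)
    moreover have "((w - u) / (b - a) - \<theta>)\<^sup>2 * (b - a) < (?c - \<theta>)\<^sup>2 * (b - a)"
      using False ab unfolding c K_def by simp
    then have "action \<mu> \<theta> a b (line a u b (w + of_int 0)) < action \<mu> \<theta> a b X"
      using L[of 0] A kinetic_nonneg[of ?c a b X] by simp
    ultimately show ?thesis by (intro bexI[of _ 0]) (auto intro: less_imp_le)
  qed
qed

text \<open>Induction on the number of atoms strictly between the two times. A path meets one of them, and
  then it is not better than a concatenation of minimizers from the start to that atom and from there to the
  end; or it meets none, and a straight line does as well. This reduces the infinite-dimensional problem to a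
  finite set of candidates.\<close>

lemma minimizers_between_finite_nonempty:
  "a < b \<Longrightarrow> finite (minimizers_between \<mu> \<theta> a y b x) \<and> minimizers_between \<mu> \<theta> a y b x \<noteq> {}"
proof (induction "card (supp \<mu> \<inter> ({a<..<b} \<times> UNIV))" arbitrary: a b x y rule: less_induct)
  case less
  note ab = less.prems
  let ?MB = "minimizers_between \<mu> \<theta>"
  let ?S = "supp \<mu> \<inter> ({a<..<b} \<times> UNIV)"
  let ?A = "action \<mu> \<theta> a b"
  define u w where "u = torus_coord y" and "w = torus_coord x"
  define K where "K = {k::int. ((of_int k + (w - u)) / (b - a) - \<theta>)\<^sup>2 \<le> ((w - u) / (b - a) - \<theta>)\<^sup>2}"
  define L where "L = (\<lambda>k::int. restrict (line a u b (w + of_int k)) {a..b})"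
  define J where "J = (\<lambda>p. (\<lambda>(X1, X2) r. if r \<le> fst p then X1 r else X2 r :: torus) `
      (?MB a y (fst p) (snd p) \<times> ?MB (fst p) (snd p) b x))"
  \<comment> \<open>the candidates: straight lines \<open>L\<close> and concatenations \<open>J p\<close> at an atom \<open>p\<close>\<close>
  define C where "C = L ` K \<union> (\<Union>p\<in>?S. J p)"
  have IH: "finite (?MB a y (fst p) (snd p)) \<and> ?MB a y (fst p) (snd p) \<noteq> {}"
      "finite (?MB (fst p) (snd p) b x) \<and> ?MB (fst p) (snd p) b x \<noteq> {}" if "p \<in> ?S" for p
    using that substrip_card[of p a b a "fst p"] substrip_card[of p a b "fst p" b]
    by (auto intro!: less.hyps)
  have finS: "finite ?S" by (rule finite_subset[OF _ finite_strip[of a b]]) auto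
  have finC: "finite C"
    unfolding C_def J_def using finS IH int_shift_square_finite[of "b - a" "w - u" \<theta>] ab
    by (intro finite_UnI finite_UN_I finite_imageI finite_cartesian_product) (auto simp: K_def)
  have "L 0 \<in> C" by (auto simp: C_def K_def)
  then have neC: "C \<noteq> {}" by blast
  have C: "H1_path a b c \<and> c \<in> extensional {a..b} \<and> c a = y \<and> c b = x" if "c \<in> C" for c
    using that unfolding C_def
  proof (elim UnE UN_E)
    assume "c \<in> L ` K"
    then obtain k where c: "c = L k" by blast
    have "H1_path a b (L k)"
      using H1_path_line[of a b u "w + of_int k"] weak_deriv_cong(3)[of a b "L k" "line a u b (w + of_int k)"]
      by (simp add: L_def)
    then show ?thesis using ab by (simp add: c) (simp add: L_def line_ends u_def w_def)
  next
    fix p assume p: "p \<in> ?S" "c \<in> J p"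
    then obtain X1 X2 where X: "X1 \<in> ?MB a y (fst p) (snd p)" "X2 \<in> ?MB (fst p) (snd p) b x"
      and c: "c = (\<lambda>r. if r \<le> fst p then X1 r else X2 r)" by (auto simp: J_def)
    have o: "a < fst p" "fst p < b" using p by auto
    have X1: "X1 \<in> extensional {a..fst p}" "H1_path a (fst p) X1" "X1 a = y" "X1 (fst p) = snd p"
      using X(1) o by (auto simp: minimizers_between_iff is_minimizer_def)
    have X2: "X2 \<in> extensional {fst p..b}" "H1_path (fst p) b X2" "X2 (fst p) = snd p" "X2 b = x"
      using X(2) o by (auto simp: minimizers_between_iff is_minimizer_def)
    have "c r = undefined" if "r \<notin> {a..b}" for r
      using that X1(1) X2(1) o by (auto simp: c extensional_def)
    then show ?thesis
      using H1_path_join[OF X1(2) X2(2)] X1(3,4) X2(3,4) o by (auto simp: c extensional_def)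
  qed
  have beat: "\<exists>c\<in>C. ?A c \<le> ?A X \<and> (X \<in> C \<or> ?A c < ?A X)"
    if X: "H1_path a b X" "X \<in> extensional {a..b}" "X a = y" "X b = x" for X
  proof (cases "\<exists>r. a < r \<and> r < b \<and> (r, X r) \<in> supp \<mu>")
    case True
    then obtain r where r: "a < r" "r < b" "(r, X r) \<in> supp \<mu>" by blast
    then have p: "(r, X r) \<in> ?S" by simp
    obtain X1 X2 where M: "X1 \<in> ?MB a y r (X r)" "X2 \<in> ?MB r (X r) b x"
      using IH[OF p] by auto
    have X1: "X1 \<in> extensional {a..r}" "is_minimizer \<mu> \<theta> a r X1" "X1 a = y" "X1 r = X r"
      using M(1) r by (auto simp: minimizers_between_iff)
    have X2: "X2 \<in> extensional {r..b}" "is_minimizer \<mu> \<theta> r b X2" "X2 r = X r" "X2 b = x"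
      using M(2) r by (auto simp: minimizers_between_iff)
    define c where "c = (\<lambda>q. if q \<le> r then X1 q else X2 q)"
    have cC: "c \<in> C" unfolding C_def J_def c_def using M p by (auto intro!: bexI[OF _ p] image_eqI[of _ _ "(X1, X2)"])
    have Ac: "?A c = action \<mu> \<theta> a r X1 + action \<mu> \<theta> r b X2"
      unfolding c_def using X1 X2 r by (intro action_join) (auto simp: is_minimizer_def)
    have AX: "?A X = action \<mu> \<theta> a r X + action \<mu> \<theta> r b X"
      using r by (intro action_split[OF X(1)]) auto
    have XX: "H1_path a r X" "H1_path r b X" using H1_path_subinterval[OF X(1)] r by auto
    have le: "action \<mu> \<theta> a r X1 \<le> action \<mu> \<theta> a r X" "action \<mu> \<theta> r b X2 \<le> action \<mu> \<theta> r b X"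
      using X1 X2 X XX by (auto simp: is_minimizer_def)
    have "X \<in> C" if eq: "?A c = ?A X"
    proof -
      have e: "action \<mu> \<theta> a r X1 = action \<mu> \<theta> a r X" "action \<mu> \<theta> r b X2 = action \<mu> \<theta> r b X"
        using eq Ac AX le by linarith+
      have "is_minimizer \<mu> \<theta> a r X" "is_minimizer \<mu> \<theta> r b X"
        using X1 X2 X XX e by (auto simp: is_minimizer_def)
      then have "restrict X {a..r} \<in> ?MB a y r (X r)" "restrict X {r..b} \<in> ?MB r (X r) b x"
        using X r by (auto simp: restrict_minimizers_between_iff)
      moreover have "X = (\<lambda>(X1, X2) q. if q \<le> r then X1 q else X2 q) (restrict X {a..r}, restrict X {r..b})"
        using X(2) r by (auto simp: fun_eq_iff extensional_def)
      ultimately show ?thesis unfolding C_def J_def using p by (intro UnI2 UN_I[OF p] image_eqI) auto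
    qed
    then show ?thesis using cC le Ac AX by (intro bexI[OF _ cC]) linarith
  next
    case False
    then have no: "\<And>r. a < r \<Longrightarrow> r < b \<Longrightarrow> (r, X r) \<notin> supp \<mu>" by blast
    from straight_line_beats[OF X(1,2) ab no, of \<theta>] obtain k where k: "k \<in> K"
      "?A (line a u b (w + of_int k)) \<le> ?A X"
      "X = L k \<or> ?A (line a u b (w + of_int k)) < ?A X"
      unfolding X(3,4) u_def[symmetric] w_def[symmetric] K_def[symmetric] L_def by blast
    have "?A (L k) = ?A (line a u b (w + of_int k))" by (intro action_cong) (simp add: L_def)
    moreover have "L k \<in> C" using k(1) by (simp add: C_def)
    ultimately show ?thesis using k(2,3) by metis
  qed
  have "?MB a y b x \<subseteq> C"
  proof
    fix X assume "X \<in> ?MB a y b x"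
    then have X: "X \<in> extensional {a..b}" "is_minimizer \<mu> \<theta> a b X" "X a = y" "X b = x"
      using ab by (auto simp: minimizers_between_iff)
    from beat[OF _ X(1,3,4)] X(2) obtain c where c: "c \<in> C" "X \<in> C \<or> ?A c < ?A X" by (auto simp: is_minimizer_def)
    moreover have "?A X \<le> ?A c" using X C[OF c(1)] by (auto simp: is_minimizer_def)
    ultimately show "X \<in> C" by auto
  qed
  moreover have "arg_min_on ?A C \<in> ?MB a y b x"
  proof -
    define c where "c = arg_min_on ?A C"
    have c: "c \<in> C" unfolding c_def by (rule arg_min_if_finite(1)[OF finC neC])
    have "?A c \<le> ?A Z" if Z: "H1_path a b Z" "Z a = y" "Z b = x" for Z
    proof -
      let ?Z = "restrict Z {a..b}"
      have "H1_path a b ?Z" using Z weak_deriv_cong(3)[of a b ?Z Z] by simp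
      from beat[OF this] Z ab obtain c' where c': "c' \<in> C" "?A c' \<le> ?A ?Z" by auto
      have "?A c \<le> ?A c'" unfolding c_def by (rule arg_min_least[OF finC neC c'(1)])
      also note c'(2)
      also have "?A ?Z = ?A Z" by (intro action_cong) simp
      finally show ?thesis .
    qed
    then show ?thesis using C[OF c] ab by (auto simp: minimizers_between_iff is_minimizer_def c_def[symmetric])
  qed
  ultimately show ?case using finC by (auto intro: finite_subset)
qed

end

section \<open>Chains of atoms and regeneration\<close>

text \<open>The preimage of the atoms in the universal cover of the cylinder.\<close>

definition atom_lifts :: "(real \<times> torus) measure \<Rightarrow> (real \<times> real) set" where
  "atom_lifts \<mu> = {(r, u). (r, to_torus u) \<in> supp \<mu>}"

definition lift_mass :: "(real \<times> torus) measure \<Rightarrow> real \<times> real \<Rightarrow> real" where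
  "lift_mass \<mu> p = measure \<mu> {(fst p, to_torus (snd p))}"

text \<open>The action of the polygon through the given points of the universal cover, where \<open>m\<close>
  is the mass at a vertex. The last vertex is not counted, as for \<^const>\<open>action\<close>.\<close>

fun chain_action :: "(real \<times> real \<Rightarrow> real) \<Rightarrow> real \<Rightarrow> (real \<times> real) list \<Rightarrow> real" where
  "chain_action m \<theta> (p # q # l) =
     ((snd q - snd p) / (fst q - fst p) - \<theta>)\<^sup>2 * (fst q - fst p) / 2 - m p + chain_action m \<theta> (q # l)"
| "chain_action m \<theta> _ = 0"

lemma chain_action_append:
  "chain_action m \<theta> (xs @ q # ys) = chain_action m \<theta> (xs @ [q]) + chain_action m \<theta> (q # ys)"
proof (induction xs)
  case (Cons x xs)
  then show ?case by (cases xs) auto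
qed simp

lemma sorted_wrt_less_append:
  fixes r :: "'a :: linorder"
  shows "sorted_wrt (<) (xs @ [r]) \<Longrightarrow> sorted_wrt (<) (r # ys) \<Longrightarrow> sorted_wrt (<) (xs @ r # ys)"
  by (induction xs) (auto intro: less_trans)

text \<open>For given times of the vertices, the parameter \<open>\<theta>\<close> couples to the total
  increment only: \<open>(X' - \<theta>)\<^sup>2 / 2 = X'\<^sup>2 / 2 - \<theta> X' + \<theta>\<^sup>2 /
  2\<close>.\<close>

lemma chain_action_theta:
  "sorted_wrt (<) (map fst l) \<Longrightarrow> l \<noteq> [] \<Longrightarrow>
   chain_action m \<theta> l = chain_action m 0 l - \<theta> * (snd (last l) - snd (hd l)) + \<theta>\<^sup>2 / 2 * (fst (last l) - fst (hd l))"
proof (induction l rule: induct_list012)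
  case (3 p q l)
  define d e A0 A where "d = fst q - fst p" and "e = snd q - snd p"
    and "A0 = (e / d - 0)\<^sup>2 * d" and "A = (e / d - \<theta>)\<^sup>2 * d"
  have "d > 0" using 3(3) by (simp add: d_def)
  then have "e / d * d = e" by simp
  moreover have "A = A0 - 2 * \<theta> * (e / d * d) + \<theta>\<^sup>2 * d"
    unfolding A_def A0_def by (simp only: power2_eq_square) (simp only: algebra_simps diff_zero mult_zero_left mult_zero_right, simp)
  ultimately have A: "A = A0 - 2 * \<theta> * (snd q - snd p) + \<theta>\<^sup>2 * (fst q - fst p)"
    by (simp add: d_def e_def)
  have "chain_action m \<theta> (p # q # l) = A / 2 - m p + chain_action m \<theta> (q # l)"
    "chain_action m 0 (p # q # l) = A0 / 2 - m p + chain_action m 0 (q # l)"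
    by (simp_all add: A_def A0_def d_def e_def)
  moreover have "chain_action m \<theta> (q # l) = chain_action m 0 (q # l) - \<theta> * (snd (last (q # l)) - snd q)
      + \<theta>\<^sup>2 / 2 * (fst (last (q # l)) - fst q)"
    using 3 by simp
  ultimately show ?case by (simp add: A algebra_simps add_divide_distrib diff_divide_distrib)
qed auto

text \<open>The lift \<open>Y\<close> of \<open>X\<close> is represented by the vertices \<open>l\<close>,
  followed by the end point. All vertices after the first are atoms; the course of the path is recorded on the
  last segment only, which determines the slope at the end.\<close>

definition chain_rep :: "(real \<times> torus) measure \<Rightarrow> real \<Rightarrow> real \<Rightarrow> real \<Rightarrow> (real \<Rightarrow> torus) \<Rightarrow> (real \<Rightarrow> real)
    \<Rightarrow> (real \<times> real) list \<Rightarrow> bool" where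
  "chain_rep \<mu> \<theta> a b X Y l \<longleftrightarrow> l \<noteq> [] \<and> hd l = (a, Y a) \<and> set (tl l) \<subseteq> atom_lifts \<mu> \<and>
     sorted_wrt (<) (map fst (l @ [(b, Y b)])) \<and>
     (\<forall>r\<in>{fst (last l)..b}. Y r = Y b + (Y b - snd (last l)) / (b - fst (last l)) * (r - b)) \<and>
     action \<mu> \<theta> a b X = chain_action (lift_mass \<mu>) \<theta> (l @ [(b, Y b)])"

lemma chain_repD:
  assumes "chain_rep \<mu> \<theta> a b X Y l"
  shows "l \<noteq> []" "hd l = (a, Y a)" "set (tl l) \<subseteq> atom_lifts \<mu>" "sorted_wrt (<) (map fst (l @ [(b, Y b)]))"
    "\<forall>r\<in>{fst (last l)..b}. Y r = Y b + (Y b - snd (last l)) / (b - fst (last l)) * (r - b)"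
    "action \<mu> \<theta> a b X = chain_action (lift_mass \<mu>) \<theta> (l @ [(b, Y b)])"
  using assms unfolding chain_rep_def by blast+

context configuration
begin

text \<open>Cut at the atoms that are met, until none is left inside; a minimizer that meets no atom is a
  straight line.\<close>

lemma minimizer_chain:
  "a < b \<Longrightarrow> is_minimizer \<mu> \<theta> a b X \<Longrightarrow> continuous_on {a..b} Y \<Longrightarrow> \<forall>r\<in>{a..b}. X r = to_torus (Y r) \<Longrightarrow>
   \<exists>l. chain_rep \<mu> \<theta> a b X Y l"
proof (induction "card (supp \<mu> \<inter> ({a<..<b} \<times> UNIV))" arbitrary: a b rule: less_induct)
  case less
  note ab = less.prems(1) and X = less.prems(2) and Y = less.prems(3,4)
  show ?case
  proof (cases "\<exists>r. a < r \<and> r < b \<and> (r, X r) \<in> supp \<mu>")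
    case True
    then obtain r where r: "a < r" "r < b" "(r, X r) \<in> supp \<mu>" by blast
    have "\<exists>l. chain_rep \<mu> \<theta> a r X Y l"
      using r Y is_minimizer_sub[OF X, of a r] substrip_card[OF r(3), of a b a r]
      by (intro less.hyps) (auto intro: continuous_on_subset[OF Y(1)])
    then obtain l1 where l1: "chain_rep \<mu> \<theta> a r X Y l1" by blast
    have "\<exists>l. chain_rep \<mu> \<theta> r b X Y l"
      using r Y is_minimizer_sub[OF X, of r b] substrip_card[OF r(3), of a b r b]
      by (intro less.hyps) (auto intro: continuous_on_subset[OF Y(1)])
    then obtain l2 where l2: "chain_rep \<mu> \<theta> r b X Y l2" by blast
    note c1 = chain_repD[OF l1] and c2 = chain_repD[OF l2]
    obtain l2' where l2': "l2 = (r, Y r) # l2'" using c2(1,2) by (cases l2) auto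
    have "(r, Y r) \<in> atom_lifts \<mu>" using r Y(2) by (simp add: atom_lifts_def)
    then have "set (tl (l1 @ l2)) \<subseteq> atom_lifts \<mu>" using c1(1,3) c2(3) l2' by auto
    moreover have "sorted_wrt (<) (map fst ((l1 @ l2) @ [(b, Y b)]))"
      using c1(4) c2(4) sorted_wrt_less_append[of "map fst l1" r "map fst l2' @ [b]"] by (simp add: l2')
    moreover have "action \<mu> \<theta> a b X = chain_action (lift_mass \<mu>) \<theta> ((l1 @ l2) @ [(b, Y b)])"
      using c1(6) c2(6) action_split[of a b X r \<theta>] X r
        chain_action_append[of "lift_mass \<mu>" \<theta> l1 "(r, Y r)" "l2' @ [(b, Y b)]"]
      by (simp add: is_minimizer_def l2')
    moreover have "last (l1 @ l2) = last l2" "hd (l1 @ l2) = hd l1" using c1(1) c2(1) by simp_all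
    ultimately have "chain_rep \<mu> \<theta> a b X Y (l1 @ l2)"
      unfolding chain_rep_def using c1(1,2) c2(5) by (metis append_is_Nil_conv)
    then show ?thesis by blast
  next
    case False
    then have no: "\<And>r. a < r \<Longrightarrow> r < b \<Longrightarrow> (r, X r) \<notin> supp \<mu>" by blast
    have Y2: "\<And>r. r \<in> {a..b} \<Longrightarrow> X r = to_torus (Y r)" using Y(2) by blast
    have "Y r = Y b + (Y b - Y a) / (b - a) * (r - b)" if "r \<in> {a..b}" for r
    proof -
      have "(Y b - Y a) / (b - a) * (r - a) = (Y b - Y a) + (Y b - Y a) / (b - a) * (r - b)"
        using ab by (simp add: field_simps)
      then show ?thesis using no_hits_linear(1)[OF X ab no Y(1) Y2 that] by simp
    qed
    note eq = this
    have lin: "\<forall>r\<in>{fst (last [(a, Y a)])..b}. Y r =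
        Y b + (Y b - snd (last [(a, Y a)])) / (b - fst (last [(a, Y a)])) * (r - b)"
      unfolding last.simps fst_conv snd_conv simp_thms if_True by (intro ballI eq)
    have "action \<mu> \<theta> a b X = chain_action (lift_mass \<mu>) \<theta> ([(a, Y a)] @ [(b, Y b)])"
      using no_hits_linear(2)[OF X ab no Y(1) Y2] by (simp add: lift_mass_def)
    then have "chain_rep \<mu> \<theta> a b X Y [(a, Y a)]"
      unfolding chain_rep_def by (intro conjI lin) (simp_all add: ab)
    then show ?thesis by blast
  qed
qed

text \<open>A straight line over a time interval of length \<open>2 * M\<close> can be bent at half time to
  pass through a given point of the circle. The point has a lift at distance \<open>d \<le> 1 / 2\<close> from
  the line, and the additional kinetic energy is \<open>d\<^sup>2 / M \<le> 1 / (4 * M)\<close>, independently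
  of \<open>\<theta>\<close>.\<close>

lemma regeneration:
  assumes X: "is_minimizer \<mu> \<theta> a b X" and M: "M > 0" and o: "a \<le> \<sigma> - M" "\<sigma> + M \<le> b"
    and lone: "supp \<mu> \<inter> ({\<sigma> - M..\<sigma> + M} \<times> UNIV) = {(\<sigma>, \<eta>)}"
    and heavy: "measure \<mu> {(\<sigma>, \<eta>)} > 1 / (4 * M)"
  shows "X \<sigma> = \<eta>"
proof (rule ccontr)
  assume ne: "X \<sigma> \<noteq> \<eta>"
  let ?a = "\<sigma> - M" and ?b = "\<sigma> + M"
  have ab: "?a < ?b" "?a < \<sigma>" "\<sigma> < ?b" using M by auto
  have X': "is_minimizer \<mu> \<theta> ?a ?b X" by (rule is_minimizer_sub[OF X]) (use o M in auto)
  have no: "(r, X r) \<notin> supp \<mu>" if "r \<in> {?a..?b}" for r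
  proof
    assume "(r, X r) \<in> supp \<mu>"
    then have "(r, X r) \<in> supp \<mu> \<inter> ({?a..?b} \<times> UNIV)" using that by blast
    then have "r = \<sigma>" "X r = \<eta>" using lone by auto
    then show False using ne by simp
  qed
  have "H1_path ?a ?b X" using X' by (simp add: is_minimizer_def)
  then obtain Y where Y: "continuous_on {?a..?b} Y" "\<forall>r\<in>{?a..?b}. X r = to_torus (Y r)"
    by (rule H1_path_liftE)
  have Y2: "\<And>r. r \<in> {?a..?b} \<Longrightarrow> X r = to_torus (Y r)" using Y(2) by blast
  define u w where "u = Y ?a" and "w = Y ?b"
  have Xuw: "X ?a = to_torus u" "X ?b = to_torus w" using Y2[of ?a] Y2[of ?b] ab by (auto simp: u_def w_def)
  have "measure \<mu> {(?a, to_torus u)} = 0"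
    using no[of ?a] ab Xuw by (intro measure_not_atom) auto
  then have A: "action \<mu> \<theta> ?a ?b X = ((w - u) / (2 * M) - \<theta>)\<^sup>2 * M"
    using no_hits_linear(2)[OF X' ab(1) _ Y(1) Y2] no by (simp add: u_def w_def)
  \<comment> \<open>the lift of \<open>\<eta>\<close> closest to the midpoint of the straight path\<close>
  define e where "e = torus_coord \<eta> + of_int (round ((u + w) / 2 - torus_coord \<eta>))"
  have e: "to_torus e = \<eta>" "\<bar>e - (u + w) / 2\<bar> \<le> 1 / 2"
    using of_int_round_abs_le[of "(u + w) / 2 - torus_coord \<eta>"] by (simp_all add: e_def algebra_simps)
  define Z where "Z = (\<lambda>r. if r \<le> \<sigma> then line ?a u \<sigma> e r else line \<sigma> e ?b w r)"
  have "H1_path ?a ?b Z" unfolding Z_def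
    by (intro H1_path_join H1_path_line) (use ab in \<open>auto simp: line_ends\<close>)
  moreover have "Z ?a = X ?a" "Z ?b = X ?b" using ab Xuw by (auto simp: Z_def line_ends)
  ultimately have "action \<mu> \<theta> ?a ?b X \<le> action \<mu> \<theta> ?a ?b Z" using X' by (simp add: is_minimizer_def)
  also have "\<dots> = action \<mu> \<theta> ?a \<sigma> (line ?a u \<sigma> e) + action \<mu> \<theta> \<sigma> ?b (line \<sigma> e ?b w)"
    unfolding Z_def by (intro action_join H1_path_line) (use ab in \<open>auto simp: line_ends\<close>)
  also have "\<dots> \<le> (((e - u) / M - \<theta>)\<^sup>2 * M / 2) + (((w - e) / M - \<theta>)\<^sup>2 * M / 2 - measure \<mu> {(\<sigma>, \<eta>)})"
  proof -
    have s: "\<sigma> - (\<sigma> - M) = M" "\<sigma> + M - \<sigma> = M" by simp_all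
    have "measure \<mu> {(?a, to_torus u)} \<ge> 0" by simp
    then show ?thesis
      using action_line_le[OF ab(2), of \<theta> u e, unfolded s] action_line_le[OF ab(3), of \<theta> e w, unfolded e(1) s]
      by linarith
  qed
  also have "\<dots> = ((w - u) / (2 * M) - \<theta>)\<^sup>2 * M + (e - (u + w) / 2)\<^sup>2 / M - measure \<mu> {(\<sigma>, \<eta>)}"
    using M by (simp add: field_simps power2_eq_square)
  finally have "measure \<mu> {(\<sigma>, \<eta>)} \<le> (e - (u + w) / 2)\<^sup>2 / M" unfolding A by simp
  also have "\<dots> \<le> (1 / 2)\<^sup>2 / M"
    using e(2) M by (intro divide_right_mono power2_le_iff_abs_le[THEN iffD2]) auto
  also have "\<dots> = 1 / (4 * M)" by (simp add: power2_eq_square)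
  finally show False using heavy by simp
qed

end

section \<open>Extremal one-sided minimizers\<close>

lemma first_zero:
  fixes f :: "real \<Rightarrow> real"
  assumes f: "continuous_on {r..t} f" "f r > 0" "f t \<le> 0" "r \<le> t"
  shows "\<exists>b. r < b \<and> b \<le> t \<and> f b = 0 \<and> (\<forall>q\<in>{r..b}. f q \<ge> 0)"
proof -
  define S where "S = {q \<in> {r..t}. f q \<le> 0}"
  have "closed S" unfolding S_def
    using continuous_closed_preimage[OF f(1), of "{..0}"] by (simp add: vimage_def Int_def conj_commute)
  moreover have ne: "t \<in> S" and bdd: "bdd_below S" using f by (auto simp: S_def intro!: bdd_belowI[of _ r])
  ultimately have b: "Inf S \<in> S" by (intro closed_contains_Inf) auto
  have pos: "f q > 0" if "q \<in> {r..<Inf S}" for q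
  proof (rule ccontr)
    assume "\<not> f q > 0"
    then have "q \<in> S" using that b by (auto simp: S_def)
    then show False using cInf_lower[OF _ bdd, of q] that by auto
  qed
  have rb: "r < Inf S" using b f(2) by (auto simp: S_def less_le)
  have "f (Inf S) = 0"
  proof (rule ccontr)
    assume "f (Inf S) \<noteq> 0"
    then have "f (Inf S) < 0" using b by (auto simp: S_def)
    moreover have "continuous_on {r..Inf S} f" by (rule continuous_on_subset[OF f(1)]) (use b in \<open>auto simp: S_def\<close>)
    ultimately obtain q where "r \<le> q" "q \<le> Inf S" "f q = 0"
      using IVT2'[of f "Inf S" 0 r] f(2) rb by auto
    then show False using pos[of q] \<open>f (Inf S) < 0\<close> by (cases "q = Inf S") auto
  qed
  then show ?thesis using rb b pos by (intro exI[of _ "Inf S"]) (force simp: S_def less_le)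
qed

lemma last_zero:
  fixes f :: "real \<Rightarrow> real"
  assumes f: "continuous_on {a..r} f" "f r > 0" "f a \<le> 0" "a \<le> r"
  shows "\<exists>c. a \<le> c \<and> c < r \<and> f c = 0 \<and> (\<forall>q\<in>{c..r}. f q \<ge> 0)"
proof -
  have "continuous_on {-r..-a} (\<lambda>q. f (- q))"
    by (rule continuous_on_compose2[OF f(1)]) (auto intro!: continuous_intros)
  from first_zero[OF this] f obtain b where b: "-r < b" "b \<le> -a" "f (-b) = 0" "\<forall>q\<in>{-r..b}. f (-q) \<ge> 0" by auto
  have "f q \<ge> 0" if "q \<in> {-b..r}" for q using b(4)[rule_format, of "-q"] that by auto
  then show ?thesis using b by (intro exI[of _ "-b"]) auto
qed

lemma continuous_on_increment:
  assumes "H1_path a t X"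
  shows "continuous_on {a..t} (\<lambda>r. increment r t X)"
proof -
  obtain Y where Y: "continuous_on {a..t} Y" "\<forall>r\<in>{a..t}. X r = to_torus (Y r)"
    by (rule H1_path_liftE[OF assms])
  have "increment r t X = Y t - Y r" if "r \<in> {a..t}" for r
    using that Y by (intro increment_lift H1_path_subinterval[OF assms] continuous_on_subset[OF Y(1)]) auto
  then have "\<And>r. r \<in> {a..t} \<Longrightarrow> Y t - Y r = increment r t X" by simp
  moreover have "continuous_on {a..t} (\<lambda>r. Y t - Y r)" by (intro continuous_intros Y)
  ultimately show ?thesis by (rule continuous_on_eq[rotated])
qed

text \<open>Increments up to a fixed end point determine the path; \<open>torus_coord (X t) - increment r t
  X\<close> is the lift used for minimizers throughout.\<close>

lemma path_from_increment:
  assumes "H1_path r t X" "r \<le> t"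
  shows "X r = to_torus (torus_coord (X t) - increment r t X)"
proof -
  obtain Y where Y: "continuous_on {r..t} Y" "\<forall>q\<in>{r..t}. X q = to_torus (Y q)"
    by (rule H1_path_liftE[OF assms(1)])
  have i: "increment r t X = Y t - Y r" using Y assms by (intro increment_lift) auto
  have "to_torus (torus_coord (X t)) = to_torus (Y t)" using Y(2) assms(2) by simp
  then have "torus_coord (X t) - Y t \<in> \<int>" by (simp only: to_torus_eq_iff)
  then have "to_torus (torus_coord (X t) - increment r t X) = to_torus (Y r)"
    unfolding to_torus_eq_iff i by (simp add: algebra_simps)
  then show ?thesis using Y(2) assms(2) by simp
qed

lemma increment_refl [simp]: "increment t t X = 0"
  using integral_discrete_difference[where X="{t}" and M=lborel and f="\<lambda>x. indicat_real {t} x *\<^sub>R weak_deriv t t X x" and g="\<lambda>_. 0"]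
  by (simp add: increment_def set_lebesgue_integral_def)

lemma minimizers_iff: "X \<in> minimizers \<mu> \<theta> t x \<longleftrightarrow>
    X \<in> extensional {..t} \<and> X t = x \<and> (\<forall>a<t. is_minimizer \<mu> \<theta> a t X)"
proof -
  have "restrict X {a..t} \<in> H1 a t" if "is_minimizer \<mu> \<theta> a t X" "a < t" for a
    using that weak_deriv_cong(3)[of a t "restrict X {a..t}" X] by (simp add: H1_iff is_minimizer_def)
  then show ?thesis
    unfolding minimizers_def minimizers_to_time_def H1_loc_def
    by (auto simp: restrict_minimizers_between_iff)
qed

context configuration
begin

text \<open>Finitely many minimizers have a maximal element \<open>G\<close> for the pointwise order of
  increments. It is the greatest one: if another minimizer \<open>Z\<close> were ahead of \<open>G\<close>
  somewhere, then following \<open>Z\<close> on the excursion around that time would give a minimizer strictly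
  above \<open>G\<close>. The excursion ends at a time where both have the same increment; it begins at such a
  time or at the common starting point, where the increments may differ by an integer. The sign of
  \<open>sg\<close> selects the left or the right extreme.\<close>

lemma greatest_minimizer:
  assumes at: "a < t" and sg: "sg \<noteq> (0::real)"
  shows "\<exists>G\<in>minimizers_between \<mu> \<theta> a y t x. \<forall>Z\<in>minimizers_between \<mu> \<theta> a y t x. \<forall>r\<in>{a..t}.
    sg * increment r t Z \<le> sg * increment r t G"
proof -
  let ?MB = "minimizers_between \<mu> \<theta> a y t x"
  define le where "le = (\<lambda>X Z. \<forall>r\<in>{a..t}. sg * increment r t X \<le> sg * increment r t Z)"
  have le_trans: "le X Z \<Longrightarrow> le Z W \<Longrightarrow> le X W" for X Z W unfolding le_def by (meson order_trans)
  have le_refl: "le X X" for X by (simp add: le_def)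
  have "\<exists>m\<in>?MB. \<forall>Z\<in>?MB. Z \<noteq> m \<longrightarrow> \<not> (le m Z \<and> \<not> le Z m)"
    using minimizers_between_finite_nonempty[OF at, of \<theta> y x]
    by (intro Finite_Set.bex_max_element) (auto intro!: asymp_onI transp_onI intro: le_trans)
  then obtain G where G: "G \<in> ?MB" and max: "\<And>Z. Z \<in> ?MB \<Longrightarrow> le G Z \<Longrightarrow> le Z G"
    using le_refl by metis
  have G': "G \<in> extensional {a..t}" "is_minimizer \<mu> \<theta> a t G" "G a = y" "G t = x"
    using G at by (auto simp: minimizers_between_iff)
  have GH: "H1_path a t G" using G' by (simp add: is_minimizer_def)
  have "le Z G" if Z: "Z \<in> ?MB" for Z
  proof (rule ccontr)
    assume "\<not> le Z G"
    then obtain r where r: "r \<in> {a..t}" "sg * increment r t Z > sg * increment r t G"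
      by (auto simp: le_def not_le)
    have Z': "Z \<in> extensional {a..t}" "is_minimizer \<mu> \<theta> a t Z" "Z a = y" "Z t = x"
      using Z at by (auto simp: minimizers_between_iff)
    have ZH: "H1_path a t Z" using Z' by (simp add: is_minimizer_def)
    define f where "f = (\<lambda>q. sg * increment q t Z - sg * increment q t G)"
    have fc: "continuous_on {a..t} f" unfolding f_def
      by (intro continuous_intros continuous_on_increment GH ZH)
    have "\<exists>b. r < b \<and> b \<le> t \<and> f b = 0 \<and> (\<forall>q\<in>{r..b}. f q \<ge> 0)"
      using r by (intro first_zero continuous_on_subset[OF fc]) (auto simp: f_def)
    then obtain b where b: "r < b" "b \<le> t" "f b = 0" "\<forall>q\<in>{r..b}. f q \<ge> 0" by blast
    have "\<exists>c. a \<le> c \<and> c \<le> r \<and> (f c = 0 \<or> c = a) \<and> (\<forall>q\<in>{c..r}. f q \<ge> 0)"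
    proof (cases "\<exists>q\<in>{a..r}. f q \<le> 0")
      case True
      then obtain q where q: "q \<in> {a..r}" "f q \<le> 0" by blast
      have "\<exists>c. q \<le> c \<and> c < r \<and> f c = 0 \<and> (\<forall>p\<in>{c..r}. f p \<ge> 0)"
        using q r by (intro last_zero continuous_on_subset[OF fc]) (auto simp: f_def)
      then show ?thesis using q by (meson atLeastAtMost_iff less_imp_le order_trans)
    next
      case False
      then show ?thesis using r by (intro exI[of _ a]) (auto simp: not_le intro: less_imp_le)
    qed
    then obtain c where c: "a \<le> c" "c \<le> r" "f c = 0 \<or> c = a" "\<forall>q\<in>{c..r}. f q \<ge> 0" by blast
    have feq: "increment q t Z = increment q t G" if "f q = 0" for q
      using that sg by (simp add: f_def)
    have meet: "Z q = G q" if "f q = 0" "q \<in> {a..t}" for q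
      using feq[OF that(1)] that(2) path_from_increment[of q t Z] path_from_increment[of q t G]
        H1_path_subinterval[OF ZH, of q t] H1_path_subinterval[OF GH, of q t] Z'(4) G'(4) by simp
    have o: "a \<le> c" "c \<le> b" "b \<le> t" using b c by auto
    have ends: "Z c = G c" "Z b = G b"
      using meet[of c] meet[of b] c(3) b(3) o Z'(3) G'(3) by auto
    \<comment> \<open>follow \<open>Z\<close> on its excursion \<open>[c, b]\<close> ahead of \<open>G\<close>\<close>
    define W where "W = path_splice G Z c b"
    have "is_minimizer \<mu> \<theta> a t W" unfolding W_def
      by (rule is_minimizer_splice[OF G'(2) is_minimizer_sub[OF Z'(2) o] o ends])
    moreover have "W \<in> extensional {a..t}" using G'(1) o by (auto simp: W_def path_splice_def extensional_def)
    moreover have "W a = y" "W t = x" using o G'(3,4) Z'(3,4) by (auto simp: W_def path_splice_def)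
    ultimately have W: "W \<in> ?MB" and WH: "H1_path a t W" using at by (auto simp: minimizers_between_iff is_minimizer_def)
    have "W q = G q" if "q \<in> {b..t}" for q
      using that ends by (cases "q = b") (auto simp: W_def path_splice_def)
    then have i3: "increment q t W = increment q t G" if "q \<in> {b..t}" for q
      using that by (intro weak_deriv_cong(5)) auto
    have i2: "increment q t W = increment q t Z" if q: "q \<in> {c..b}" for q
    proof -
      have "increment q b W = increment q b Z"
        using q by (intro weak_deriv_cong(5)) (auto simp: W_def path_splice_def)
      then show ?thesis
        using increment_split[OF H1_path_subinterval[OF WH, of q t], of b] increment_split[OF H1_path_subinterval[OF ZH, of q t], of b]
          i3[of b] feq[OF b(3)] q o by auto
    qed
    have i1: "increment q t W = increment q t G" if q: "a \<le> q" "q < c" for q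
    proof -
      have "increment q c W = increment q c G"
        using q ends by (intro weak_deriv_cong(5)) (auto simp: W_def path_splice_def)
      moreover have "f c = 0" using c(3) q by auto
      ultimately show ?thesis
        using increment_split[OF H1_path_subinterval[OF WH, of q t], of c] increment_split[OF H1_path_subinterval[OF GH, of q t], of c]
          i2[of c] feq[of c] q o by auto
    qed
    have "le G W" unfolding le_def
    proof
      fix q assume q: "q \<in> {a..t}"
      consider "q < c" | "q \<in> {c..b}" | "q \<in> {b..t}" using q by force
      then show "sg * increment q t G \<le> sg * increment q t W"
      proof cases
        case 1 then show ?thesis using i1[of q] q by simp
      next
        case 2
        then have "f q \<ge> 0" using b(4) c(4) by (cases "q \<le> r") auto
        then show ?thesis using i2[OF 2] by (simp add: f_def)
      next
        case 3 then show ?thesis using i3[of q] by simp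
      qed
    qed
    from max[OF W this] have "sg * increment r t W \<le> sg * increment r t G" using r by (simp add: le_def)
    then show False using i2[of r] r b c by simp
  qed
  then show ?thesis using G unfolding le_def by blast
qed

end

text \<open>A configuration in which each time has a lone heavy atom before it, as in
  \<^const>\<open>Omega1\<close>.\<close>

locale regenerative = configuration +
  fixes M :: real and s :: "real \<Rightarrow> real"
  assumes M_pos: "M > 0"
    and s_le: "s t \<le> t - M"
    and lone_heavy: "\<exists>y. supp \<mu> \<inter> ({s t - M..s t + M} \<times> UNIV) = {(s t, y)} \<and> measure \<mu> {(s t, y)} > 1 / (4 * M)"
begin

definition site :: "real \<Rightarrow> torus" where
  "site t = (SOME y. supp \<mu> \<inter> ({s t - M..s t + M} \<times> UNIV) = {(s t, y)} \<and> measure \<mu> {(s t, y)} > 1 / (4 * M))"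

lemma site: "supp \<mu> \<inter> ({s t - M..s t + M} \<times> UNIV) = {(s t, site t)}" "measure \<mu> {(s t, site t)} > 1 / (4 * M)"
  using someI_ex[OF lone_heavy[of t]] unfolding site_def by blast+

lemma site_in_supp: "(s t, site t) \<in> supp \<mu>"
  using site(1)[of t] by blast

text \<open>The site \<open>(s t, site t)\<close> does not depend on \<open>\<theta>\<close>.\<close>

lemma through_site: "is_minimizer \<mu> \<theta> a b X \<Longrightarrow> a \<le> s t - M \<Longrightarrow> t \<le> b \<Longrightarrow> X (s t) = site t"
  using regeneration[OF _ M_pos _ _ site, of \<theta> a b X t] s_le[of t] by simp

text \<open>The successive regeneration times before \<open>t\<close>, preceded by \<open>t\<close> itself as
  number zero.\<close>

primrec past :: "real \<Rightarrow> nat \<Rightarrow> real" where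
  "past t 0 = t"
| "past t (Suc k) = s (past t k)"

lemma past_le: "past t k \<le> t - of_nat k * M"
proof (induction k)
  case (Suc k)
  then show ?case using s_le[of "past t k"] by (simp add: algebra_simps)
qed simp

lemma past_antimono: "j \<le> k \<Longrightarrow> past t k \<le> past t j"
proof (induction k rule: dec_induct)
  case (step k)
  then show ?case using s_le[of "past t k"] M_pos by simp
qed simp

lemma past_Suc_less: "past t (Suc k) < t"
  using past_le[of t "Suc k"] M_pos by (simp add: algebra_simps) (smt (verit) mult_nonneg_nonneg of_nat_0_le_iff)

lemma past_unbounded: "\<exists>k. past t (Suc k) \<le> r"
proof -
  obtain k :: nat where k: "of_nat k * M > t - r" using reals_Archimedean3[OF M_pos] by blast
  have "past t (Suc k) \<le> past t k" by (rule past_antimono) simp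
  then show ?thesis using past_le[of t k] k by (intro exI[of _ k]) linarith
qed

lemma through_past: 
  assumes "is_minimizer \<mu> \<theta> a t X" "a \<le> past t (Suc k) - M"
  shows "X (past t (Suc k)) = site (past t k)"
proof -
  have o: "past t k \<le> t" "s (past t k) \<le> past t k - M"
    using past_antimono[of 0 k] s_le by simp_all
  then have "is_minimizer \<mu> \<theta> a (past t k) X"
    using assms(2) M_pos by (intro is_minimizer_sub[OF assms(1)]) auto
  from through_site[OF this] assms(2) show ?thesis by simp
qed

text \<open>The greatest minimizers \<open>G k\<close> from the \<open>k\<close>-th regeneration point before
  \<open>t\<close> to \<open>(t, x)\<close> extend each other: \<open>G k\<close> passes through the
  \<open>j\<close>-th point for \<open>j \<le> k\<close>, where it can be compared with \<open>G j\<close>,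
  and \<open>G j\<close> can be continued to the past by \<open>G k\<close>. Their union is the extremal
  one-sided minimizer.\<close>

lemma extremal_minimizer:
  assumes sg: "sg \<noteq> (0::real)"
  shows "\<exists>G\<in>minimizers \<mu> \<theta> t x. \<forall>Z\<in>minimizers \<mu> \<theta> t x. \<forall>r\<le>t. sg * increment r t Z \<le> sg * increment r t G"
proof -
  define a where "a = (\<lambda>k. past t (Suc k))"
  define \<eta> where "\<eta> = (\<lambda>k. site (past t k))"
  let ?MB = "\<lambda>k. minimizers_between \<mu> \<theta> (a k) (\<eta> k) t x"
  have at: "a k < t" for k unfolding a_def by (rule past_Suc_less)
  have amono: "a k \<le> a j" if "j \<le> k" for j k unfolding a_def using that by (intro past_antimono) simp
  have "\<forall>k. \<exists>G\<in>?MB k. \<forall>Z\<in>?MB k. \<forall>r\<in>{a k..t}. sg * increment r t Z \<le> sg * increment r t G"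
    using greatest_minimizer[OF at sg] by blast
  then obtain G where G: "\<And>k. G k \<in> ?MB k"
    and Gmax: "\<And>k Z r. Z \<in> ?MB k \<Longrightarrow> r \<in> {a k..t} \<Longrightarrow> sg * increment r t Z \<le> sg * increment r t (G k)"
    by metis
  have G': "G k \<in> extensional {a k..t}" "is_minimizer \<mu> \<theta> (a k) t (G k)" "G k (a k) = \<eta> k" "G k t = x" for k
    using G[of k] at[of k] by (auto simp: minimizers_between_iff)
  have GH: "H1_path (a k) t (G k)" for k using G'(2) by (simp add: is_minimizer_def)
  have pass: "G k (a j) = \<eta> j" if "j \<le> k" for j k
  proof (cases "j = k")
    case False
    then have "a k \<le> a (Suc j)" using that by (intro amono) simp
    also have "a (Suc j) \<le> a j - M" unfolding a_def using s_le[of "past t (Suc j)"] by simp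
    finally show ?thesis
      unfolding a_def \<eta>_def by (intro through_past[OF G'(2)[of k]]) (simp add: a_def)
  qed (simp add: G')
  have agree_inc: "increment r t (G k) = increment r t (G j)" if jk: "j \<le> k" and r: "r \<in> {a j..t}" for j k r
  proof -
    have "is_minimizer \<mu> \<theta> (a j) t (G k)" by (rule is_minimizer_sub[OF G'(2)]) (use amono[OF jk] at[of j] in auto)
    then have "restrict (G k) {a j..t} \<in> ?MB j"
      using pass[OF jk] at[of j] by (simp add: restrict_minimizers_between_iff G')
    from Gmax[OF this r] have 1: "sg * increment r t (G k) \<le> sg * increment r t (G j)"
      using r weak_deriv_cong(5)[of r t "G k" "restrict (G k) {a j..t}"] by simp
    \<comment> \<open>continue \<open>G j\<close> to the past by \<open>G k\<close>\<close>
    define W where "W = path_splice (G k) (G j) (a j) t"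
    have o: "a k \<le> a j" "a j \<le> t" "t \<le> t" using amono[OF jk] at[of j] by auto
    have e: "G j (a j) = G k (a j)" "G j t = G k t" using pass[OF jk] G' by auto
    have "is_minimizer \<mu> \<theta> (a k) t W" unfolding W_def by (rule is_minimizer_splice[OF G'(2) G'(2) o e])
    moreover have "W \<in> extensional {a k..t}" "W (a k) = \<eta> k" "W t = x"
      using G'[of k] G'[of j] o e by (auto simp: W_def path_splice_def extensional_def)
    ultimately have "W \<in> ?MB k" using at[of k] by (simp add: minimizers_between_iff)
    from Gmax[OF this, of r] have "sg * increment r t W \<le> sg * increment r t (G k)" using r o by auto
    moreover have "increment r t W = increment r t (G j)"
      using r by (intro weak_deriv_cong(5)) (auto simp: W_def path_splice_def)
    ultimately show ?thesis using 1 sg by simp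
  qed
  have agree: "G k r = G j r" if "j \<le> k" "r \<in> {a j..t}" for j k r
    using agree_inc[OF that] that amono[OF that(1)] path_from_increment[of r t "G k"] path_from_increment[of r t "G j"]
      H1_path_subinterval[OF GH[of k], of r t] H1_path_subinterval[OF GH[of j], of r t] G' by auto
  \<comment> \<open>any \<open>G k\<close> that is defined at time \<open>r\<close> gives the same value\<close>
  define X where "X = (\<lambda>r. if r \<le> t then G (LEAST k. a k \<le> r) r else undefined)"
  have X: "X r = G k r" if "r \<in> {a k..t}" for r k
  proof -
    have k: "a k \<le> r" using that by simp
    have "a (LEAST k. a k \<le> r) \<le> r" by (rule LeastI[of _ k]) (rule k)
    moreover have "(LEAST k. a k \<le> r) \<le> k" by (rule Least_le) (rule k)
    ultimately show ?thesis using agree[of "LEAST k. a k \<le> r" k r] that by (simp add: X_def)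
  qed
  have Xmin: "is_minimizer \<mu> \<theta> c t X" if "c < t" for c
  proof -
    obtain k where k: "a k \<le> c" using past_unbounded[of t c] by (auto simp: a_def)
    have "is_minimizer \<mu> \<theta> c t (G k)" by (rule is_minimizer_sub[OF G'(2)]) (use k that in auto)
    then show ?thesis using is_minimizer_cong[of c t X "G k"] X[of _ k] k that by auto
  qed
  have "X \<in> minimizers \<mu> \<theta> t x"
    using Xmin X[of t 0] G'(4)[of 0] at[of 0] by (auto simp: minimizers_iff X_def extensional_def)
  moreover have "sg * increment r t Z \<le> sg * increment r t X" if Z: "Z \<in> minimizers \<mu> \<theta> t x" and r: "r \<le> t" for Z r
  proof -
    obtain k where k: "a k \<le> r" using past_unbounded[of t r] by (auto simp: a_def)
    have Z': "Z t = x" "\<And>c. c < t \<Longrightarrow> is_minimizer \<mu> \<theta> c t Z" using Z by (auto simp: minimizers_iff)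
    have "Z (a k) = \<eta> k" unfolding a_def \<eta>_def
      by (rule through_past[OF Z'(2)[of "a k - M"]]) (use at[of k] M_pos in \<open>auto simp: a_def\<close>)
    then have "restrict Z {a k..t} \<in> ?MB k"
      using Z'(2)[of "a k"] at[of k] Z'(1) by (simp add: restrict_minimizers_between_iff)
    from Gmax[OF this, of r] have "sg * increment r t Z \<le> sg * increment r t (G k)"
      using k r weak_deriv_cong(5)[of r t Z "restrict Z {a k..t}"] by simp
    also have "increment r t (G k) = increment r t X"
      using k X[of _ k] by (intro weak_deriv_cong(5)) auto
    finally show ?thesis .
  qed
  ultimately show ?thesis by blast
qed

lemma minimizers_eqI:
  assumes X: "X \<in> minimizers \<mu> \<theta> t x" and Z: "Z \<in> minimizers \<mu> \<theta> t x"
    and eq: "\<And>r. r \<le> t \<Longrightarrow> increment r t X = increment r t Z"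
  shows "X = Z"
proof
  fix r
  show "X r = Z r"
  proof (cases "r < t")
    case True
    then show ?thesis
      using X Z eq[of r] path_from_increment[of r t X] path_from_increment[of r t Z]
      by (auto simp: minimizers_iff is_minimizer_def)
  next
    case False
    then show ?thesis using X Z by (cases "r = t") (auto simp: minimizers_iff extensional_def)
  qed
qed

lemma X_L: "X_L \<mu> \<theta> t x \<in> minimizers \<mu> \<theta> t x" "Z \<in> minimizers \<mu> \<theta> t x \<Longrightarrow> path_le t (X_L \<mu> \<theta> t x) Z"
proof -
  obtain G where G: "G \<in> minimizers \<mu> \<theta> t x" "\<And>Z. Z \<in> minimizers \<mu> \<theta> t x \<Longrightarrow> path_le t G Z"
    using extremal_minimizer[of 1 \<theta> t x] unfolding path_le_def by auto
  have "X_L \<mu> \<theta> t x = G" unfolding X_L_def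
  proof (rule the_equality)
    show "G \<in> minimizers \<mu> \<theta> t x \<and> (\<forall>Z\<in>minimizers \<mu> \<theta> t x. path_le t Z G \<longrightarrow> Z = G)"
      using G by (auto intro!: minimizers_eqI[OF _ G(1)] antisym simp: path_le_def)
  qed (use G in auto)
  with G show "X_L \<mu> \<theta> t x \<in> minimizers \<mu> \<theta> t x" "Z \<in> minimizers \<mu> \<theta> t x \<Longrightarrow> path_le t (X_L \<mu> \<theta> t x) Z" by auto
qed

lemma X_R: "X_R \<mu> \<theta> t x \<in> minimizers \<mu> \<theta> t x" "Z \<in> minimizers \<mu> \<theta> t x \<Longrightarrow> path_le t Z (X_R \<mu> \<theta> t x)"
proof -
  obtain G where G: "G \<in> minimizers \<mu> \<theta> t x" "\<And>Z. Z \<in> minimizers \<mu> \<theta> t x \<Longrightarrow> path_le t Z G"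
    using extremal_minimizer[of "-1" \<theta> t x] unfolding path_le_def by auto
  have "X_R \<mu> \<theta> t x = G" unfolding X_R_def
  proof (rule the_equality)
    show "G \<in> minimizers \<mu> \<theta> t x \<and> (\<forall>Z\<in>minimizers \<mu> \<theta> t x. path_le t G Z \<longrightarrow> Z = G)"
      using G by (auto intro!: minimizers_eqI[OF _ G(1)] antisym simp: path_le_def)
  qed (use G in auto)
  with G show "X_R \<mu> \<theta> t x \<in> minimizers \<mu> \<theta> t x" "Z \<in> minimizers \<mu> \<theta> t x \<Longrightarrow> path_le t Z (X_R \<mu> \<theta> t x)" by auto
qed

end

section \<open>Shocks at atoms\<close>

text \<open>Another lift differs by an integer-valued function that is continuous at \<open>t\<close> from
  below, hence constant near \<open>t\<close>.\<close>

lemma left_deriv_linear: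
  assumes ct: "c < t" and X: "\<And>r. r \<in> {c..t} \<Longrightarrow> X r = to_torus (u + m * (r - t))"
  shows "left_deriv X t = m"
  unfolding left_deriv_def
proof (rule the_equality)
  define L where "L = (\<lambda>r. u + m * (r - t))"
  have ev: "\<forall>\<^sub>F r in at_left t. X r = to_torus (L r)"
    unfolding eventually_at_left_field using ct X by (auto intro!: exI[of _ c] simp: L_def)
  have L': "(L has_real_derivative m) (at_left t)"
    unfolding L_def by (auto intro!: derivative_eq_intros)
  show "\<exists>Y. X t = to_torus (Y t) \<and> (\<forall>\<^sub>F r in at_left t. X r = to_torus (Y r)) \<and> (Y has_real_derivative m) (at_left t)"
    using ev L' X[of t] ct by (intro exI[of _ L]) (simp add: L_def)
  fix d assume "\<exists>Y. X t = to_torus (Y t) \<and> (\<forall>\<^sub>F r in at_left t. X r = to_torus (Y r)) \<and> (Y has_real_derivative d) (at_left t)"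
  then obtain Y where Y: "X t = to_torus (Y t)" "\<forall>\<^sub>F r in at_left t. X r = to_torus (Y r)"
    "(Y has_real_derivative d) (at_left t)" by blast
  define D where "D = (\<lambda>r. Y r - L r)"
  have D': "(D has_real_derivative d - m) (at_left t)" unfolding D_def by (intro DERIV_diff Y L')
  have "X t = to_torus (L t)" using X[of t] ct by (simp add: L_def)
  with Y(1) have Dt: "D t \<in> \<int>" by (simp add: D_def to_torus_eq_iff[symmetric])
  have "(D \<longlongrightarrow> D t) (at_left t)"
    using D' has_field_derivative_imp_has_derivative has_derivative_continuous by (force simp: continuous_within)
  then have "\<forall>\<^sub>F r in at_left t. dist (D r) (D t) < 1" by (rule tendstoD) simp
  with ev Y(2) have "\<forall>\<^sub>F r in at_left t. D r = D t"
  proof eventually_elim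
    case (elim r)
    then have "D r - D t \<in> \<int>" using Dt by (intro Ints_diff) (simp_all add: D_def to_torus_eq_iff[symmetric])
    with elim(3) show ?case using Ints_nonzero_abs_less1[of "D r - D t"] by (simp add: dist_real_def)
  qed
  then have ev0: "\<forall>\<^sub>F r in at_left t. (D r - D t) / (r - t) = 0" by eventually_elim simp
  have lim: "((\<lambda>r. (D r - D t) / (r - t)) \<longlongrightarrow> d - m) (at_left t)"
    using D' by (simp add: has_field_derivative_iff)
  have "((\<lambda>r::real. 0::real) \<longlongrightarrow> d - m) (at_left t)"
    by (rule Lim_transform_eventually[OF lim ev0])
  then have "d - m = 0" by (intro tendsto_unique[OF trivial_limit_at_left_real _ tendsto_const])
  then show "d = m" by simp
qed

text \<open>In the intended use \<open>l1 @ [z]\<close> and \<open>l2 @ [z]\<close> are two minimizing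
  polygons with different last segments that end in the atom \<open>z\<close>, and \<open>l3\<close>,
  \<open>l4\<close> are two such polygons that end in another atom, not later than \<open>z\<close>. The
  projections of \<open>z\<close> to the cylinder and of all the other vertices are different, so the left
  side varies with the position of \<open>z\<close> while the right side is fixed. The factor \<open>K =
  0\<close> covers two polygons with the same increment.\<close>

definition resonance_free :: "(real \<times> torus) measure \<Rightarrow> bool" where
  "resonance_free \<mu> \<longleftrightarrow> (\<forall>z\<in>atom_lifts \<mu>. \<forall>l1 l2 l3 l4. \<forall>K K' :: int.
     set (l1 @ l2 @ l3 @ l4) \<subseteq> {q \<in> atom_lifts \<mu>. (fst q, to_torus (snd q)) \<noteq> (fst z, to_torus (snd z))} \<longrightarrow>
     l1 \<noteq> [] \<longrightarrow> l2 \<noteq> [] \<longrightarrow> last l1 \<noteq> last l2 \<longrightarrow> fst (last l1) < fst z \<longrightarrow> fst (last l2) < fst z \<longrightarrow> K' \<noteq> 0 \<longrightarrow>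
     of_int K' * (chain_action (lift_mass \<mu>) 0 (l1 @ [z]) - chain_action (lift_mass \<mu>) 0 (l2 @ [z])) \<noteq>
     of_int K * (chain_action (lift_mass \<mu>) 0 l3 - chain_action (lift_mass \<mu>) 0 l4))"

context configuration
begin

lemma minimizer_lift_chain:
  assumes X: "is_minimizer \<mu> \<theta> a t X" and at: "a < t"
  defines "u \<equiv> torus_coord (X t)"
  shows "\<exists>l. chain_rep \<mu> \<theta> a t X (\<lambda>r. u - increment r t X) l \<and>
    (\<forall>r\<in>{fst (last l)..t}. X r = to_torus (u + left_deriv X t * (r - t))) \<and>
    left_deriv X t = (u - snd (last l)) / (t - fst (last l)) \<and> a \<le> fst (last l) \<and> (\<forall>q\<in>set l. fst q < t) \<and> l \<noteq> []"
proof -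
  let ?Y = "\<lambda>r. u - increment r t X"
  have H: "H1_path a t X" using X by (simp add: is_minimizer_def)
  have Y: "\<forall>r\<in>{a..t}. X r = to_torus (?Y r)"
    using path_from_increment[OF H1_path_subinterval[OF H]] by (auto simp: u_def)
  have "continuous_on {a..t} ?Y" by (intro continuous_intros continuous_on_increment H)
  from minimizer_chain[OF at X this Y] obtain l where l: "chain_rep \<mu> \<theta> a t X ?Y l" by blast
  note c = chain_repD[OF l]
  have lt: "\<forall>q\<in>set l. fst q < t" using c(4) by (auto simp: sorted_wrt_append)
  have "a \<le> fst (last l)"
  proof (cases l rule: list.exhaust)
    case (Cons p l')
    then show ?thesis using c(2,4) by (cases l' rule: rev_cases) (auto simp: sorted_wrt_append)
  qed (use c(1) in simp)
  moreover have lin: "X r = to_torus (u + (u - snd (last l)) / (t - fst (last l)) * (r - t))"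
    if r: "r \<in> {fst (last l)..t}" for r
  proof -
    have "X r = to_torus (?Y r)" using Y r \<open>a \<le> fst (last l)\<close> by auto
    also have "?Y r = ?Y t + (?Y t - snd (last l)) / (t - fst (last l)) * (r - t)"
      using c(5) r by blast
    finally show ?thesis by simp
  qed
  moreover have "left_deriv X t = (u - snd (last l)) / (t - fst (last l))"
    by (rule left_deriv_linear[OF _ lin]) (use lt c(1) in auto)
  ultimately show ?thesis using l lt c(1) by auto
qed

end

context regenerative
begin

lemma s_less: "s t < t"
  using s_le[of t] M_pos by simp

text \<open>The equation of the two actions at a shock; the increments differ by an integer because both
  minimizers start at the site of \<open>t\<close>.\<close>

lemma shock_data:
  assumes X1: "is_minimizer \<mu> \<theta> (s t) t X1" "X1 (s t) = site t" "X1 t = x"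
    and X2: "is_minimizer \<mu> \<theta> (s t) t X2" "X2 (s t) = site t" "X2 t = x"
    and ne: "left_deriv X1 t \<noteq> left_deriv X2 t"
  shows "\<exists>l1 l2 (K::int). l1 \<noteq> [] \<and> l2 \<noteq> [] \<and> set l1 \<subseteq> atom_lifts \<mu> \<and> set l2 \<subseteq> atom_lifts \<mu> \<and>
    (\<forall>q\<in>set l1 \<union> set l2. fst q < t) \<and> last l1 \<noteq> last l2 \<and>
    increment (s t) t X1 - increment (s t) t X2 = of_int K \<and>
    chain_action (lift_mass \<mu>) 0 (l1 @ [(t, torus_coord x)]) -
      chain_action (lift_mass \<mu>) 0 (l2 @ [(t, torus_coord x)]) = \<theta> * of_int K"
proof -
  let ?u = "torus_coord x" and ?a = "s t"
  let ?m = "lift_mass \<mu>"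
  have data: "\<exists>l. l \<noteq> [] \<and> set l \<subseteq> atom_lifts \<mu> \<and> (\<forall>q\<in>set l. fst q < t) \<and>
      left_deriv X t = (?u - snd (last l)) / (t - fst (last l)) \<and>
      action \<mu> \<theta> ?a t X = chain_action ?m 0 (l @ [(t, ?u)]) - \<theta> * increment ?a t X + \<theta>\<^sup>2 / 2 * (t - ?a)"
    if X: "is_minimizer \<mu> \<theta> ?a t X" "X ?a = site t" "X t = x" for X
  proof -
    obtain l where l: "chain_rep \<mu> \<theta> ?a t X (\<lambda>r. ?u - increment r t X) l"
      "left_deriv X t = (?u - snd (last l)) / (t - fst (last l))" "\<forall>q\<in>set l. fst q < t"
      using minimizer_lift_chain[OF X(1) s_less] unfolding X(3) by blast
    note c = chain_repD[OF l(1)]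
    have "X ?a = to_torus (?u - increment ?a t X)"
      using path_from_increment[of ?a t X] X s_less[of t] by (simp add: is_minimizer_def)
    then have "hd l \<in> atom_lifts \<mu>" using site_in_supp[of t] X(2) c(2) by (simp add: atom_lifts_def)
    then have sub: "set l \<subseteq> atom_lifts \<mu>" using c(1,3) by (cases l) auto
    have "action \<mu> \<theta> ?a t X = chain_action ?m \<theta> (l @ [(t, ?u)])" using c(6) by simp
    also have "\<dots> = chain_action ?m 0 (l @ [(t, ?u)]) - \<theta> * increment ?a t X + \<theta>\<^sup>2 / 2 * (t - ?a)"
      using chain_action_theta[of "l @ [(t, ?u)]" ?m \<theta>] c(1,2,4) by simp
    finally show ?thesis using c(1) sub l by blast
  qed
  obtain l1 where l1: "l1 \<noteq> []" "set l1 \<subseteq> atom_lifts \<mu>" "\<forall>q\<in>set l1. fst q < t"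
      "left_deriv X1 t = (?u - snd (last l1)) / (t - fst (last l1))"
      "action \<mu> \<theta> ?a t X1 = chain_action ?m 0 (l1 @ [(t, ?u)]) - \<theta> * increment ?a t X1 + \<theta>\<^sup>2 / 2 * (t - ?a)"
    using data[OF X1] by blast
  obtain l2 where l2: "l2 \<noteq> []" "set l2 \<subseteq> atom_lifts \<mu>" "\<forall>q\<in>set l2. fst q < t"
      "left_deriv X2 t = (?u - snd (last l2)) / (t - fst (last l2))"
      "action \<mu> \<theta> ?a t X2 = chain_action ?m 0 (l2 @ [(t, ?u)]) - \<theta> * increment ?a t X2 + \<theta>\<^sup>2 / 2 * (t - ?a)"
    using data[OF X2] by blast
  have "action \<mu> \<theta> ?a t X1 = action \<mu> \<theta> ?a t X2"
    using X1 X2 by (intro antisym) (auto simp: is_minimizer_def)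
  then have e: "chain_action ?m 0 (l1 @ [(t, ?u)]) - chain_action ?m 0 (l2 @ [(t, ?u)])
      = \<theta> * (increment ?a t X1 - increment ?a t X2)"
    unfolding l1(5) l2(5) by (simp add: algebra_simps)
  have "to_torus (?u - increment ?a t X1) = to_torus (?u - increment ?a t X2)"
    using path_from_increment[of ?a t X1] path_from_increment[of ?a t X2] X1 X2 s_less[of t] by (simp add: is_minimizer_def)
  then have "(?u - increment ?a t X1) - (?u - increment ?a t X2) \<in> \<int>" by (simp only: to_torus_eq_iff)
  then have "increment ?a t X1 - increment ?a t X2 \<in> \<int>"
    using Ints_minus[of "(?u - increment ?a t X1) - (?u - increment ?a t X2)"] by simp
  then obtain K where K: "increment ?a t X1 - increment ?a t X2 = of_int K" by (elim Ints_cases)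
  have "last l1 \<noteq> last l2" using ne l1(4) l2(4) by auto
  with l1 l2 e K show ?thesis by (intro exI[of _ l1] exI[of _ l2] exI[of _ K]) auto
qed

lemma minimizer_from_site:
  assumes "X \<in> minimizers \<mu> \<theta> t x"
  shows "is_minimizer \<mu> \<theta> (s t) t X" "X (s t) = site t" "X t = x"
proof -
  have X: "\<And>a. a < t \<Longrightarrow> is_minimizer \<mu> \<theta> a t X" "X t = x" using assms by (auto simp: minimizers_iff)
  show "is_minimizer \<mu> \<theta> (s t) t X" "X t = x" using X s_less by auto
  show "X (s t) = site t"
    by (rule through_site[OF X(1)[of "s t - M"]]) (use s_less[of t] M_pos in auto)
qed

lemma atom_lift_coord: "(t, torus_coord x) \<in> atom_lifts \<mu> \<longleftrightarrow> (t, x) \<in> supp \<mu>"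
  by (simp add: atom_lifts_def)

text \<open>With equal increments the actions of the two polygons at \<open>\<theta> = 0\<close> agree, which
  is a resonance.\<close>

lemma increments_differ:
  assumes res: "resonance_free \<mu>" and tx: "(t, x) \<in> supp \<mu>"
    and X1: "is_minimizer \<mu> \<theta> (s t) t X1" "X1 (s t) = site t" "X1 t = x"
    and X2: "is_minimizer \<mu> \<theta> (s t) t X2" "X2 (s t) = site t" "X2 t = x"
    and ne: "left_deriv X1 t \<noteq> left_deriv X2 t"
  shows "increment (s t) t X1 \<noteq> increment (s t) t X2"
proof
  assume eq: "increment (s t) t X1 = increment (s t) t X2"
  obtain l1 l2 K where l: "l1 \<noteq> []" "l2 \<noteq> []" "set l1 \<subseteq> atom_lifts \<mu>" "set l2 \<subseteq> atom_lifts \<mu>"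
    "\<forall>q\<in>set l1 \<union> set l2. fst q < t" "last l1 \<noteq> last l2"
    "increment (s t) t X1 - increment (s t) t X2 = of_int K"
    "chain_action (lift_mass \<mu>) 0 (l1 @ [(t, torus_coord x)]) -
      chain_action (lift_mass \<mu>) 0 (l2 @ [(t, torus_coord x)]) = \<theta> * of_int K"
    using shock_data[OF X1 X2 ne] by blast
  let ?z = "(t, torus_coord x)"
  have "?z \<in> atom_lifts \<mu>" using tx by (simp add: atom_lift_coord)
  moreover have "set (l1 @ l2 @ [] @ []) \<subseteq> {q \<in> atom_lifts \<mu>. (fst q, to_torus (snd q)) \<noteq> (fst ?z, to_torus (snd ?z))}"
    using l(3,4,5) by force
  moreover have "fst (last l1) < fst ?z" "fst (last l2) < fst ?z" using l(1,2,5) by auto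
  moreover have "(1::int) \<noteq> 0" by simp
  ultimately have "of_int 1 * (chain_action (lift_mass \<mu>) 0 (l1 @ [?z]) - chain_action (lift_mass \<mu>) 0 (l2 @ [?z])) \<noteq>
     of_int 0 * (chain_action (lift_mass \<mu>) 0 [] - chain_action (lift_mass \<mu>) 0 [])"
    using res[unfolded resonance_free_def] l(1,2,6) by blast
  then show False using l(7,8) eq by simp
qed

lemma shock_iff: "(t, x) \<in> shocks_at \<mu> \<theta> \<longleftrightarrow> left_deriv (X_L \<mu> \<theta> t x) t > left_deriv (X_R \<mu> \<theta> t x) t"
  by (simp add: shocks_at_def shocks_def u_L_def u_R_def)

text \<open>Let \<open>T\<close> be the last meeting time of \<open>X_L\<close> and \<open>X_R\<close> before
  \<open>t\<close>. If their increments from \<open>T\<close> to \<open>t\<close> were equal, then following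
  \<open>X_R\<close> up to \<open>T\<close> and \<open>X_L\<close> after \<open>T\<close> would give a
  minimizer with the same increment as \<open>X_R\<close> from the site of \<open>t\<close>, but with the
  final slope of \<open>X_L\<close>. So they differ, and the order of \<open>X_L\<close> and
  \<open>X_R\<close> gives the sign.\<close>

lemma shock_at_atom_global:
  assumes res: "resonance_free \<mu>" and tx: "(t, x) \<in> supp \<mu>" and sh: "(t, x) \<in> shocks_at \<mu> \<theta>"
  shows "(t, x) \<in> global_shocks_at \<mu> \<theta>"
proof -
  define XL XR where "XL = X_L \<mu> \<theta> t x" and "XR = X_R \<mu> \<theta> t x"
  define T where "T = T_vee \<mu> \<theta> t x"
  let ?a = "s t"
  have LM: "XL \<in> minimizers \<mu> \<theta> t x" and RM: "XR \<in> minimizers \<mu> \<theta> t x" and le: "path_le t XL XR"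
    using X_L X_R unfolding XL_def XR_def by blast+
  note L = minimizer_from_site[OF LM] and R = minimizer_from_site[OF RM]
  have LH: "H1_path ?a t XL" and RH: "H1_path ?a t XR" using L R by (auto simp: is_minimizer_def)
  have d: "left_deriv XL t > left_deriv XR t" using sh by (simp add: shock_iff XL_def XR_def)
  obtain l1 :: "(real \<times> real) list" where l1: "\<forall>r\<in>{fst (last l1)..t}. XL r = to_torus (torus_coord x + left_deriv XL t * (r - t))"
      "?a \<le> fst (last l1)" "\<forall>q\<in>set l1. fst q < t" "l1 \<noteq> []"
    using minimizer_lift_chain[OF L(1) s_less] unfolding L(3) by blast
  obtain l2 :: "(real \<times> real) list" where l2: "\<forall>r\<in>{fst (last l2)..t}. XR r = to_torus (torus_coord x + left_deriv XR t * (r - t))"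
      "?a \<le> fst (last l2)" "\<forall>q\<in>set l2. fst q < t" "l2 \<noteq> []"
    using minimizer_lift_chain[OF R(1) s_less] unfolding R(3) by blast
  define D where "D = left_deriv XL t - left_deriv XR t"
  have D: "D > 0" using d by (simp add: D_def)
  \<comment> \<open>after time \<open>e\<close> both paths are straight and their lifts to the same end point differ, but by less than one before time \<open>t\<close>\<close>
  define e where "e = max (max (fst (last l1)) (fst (last l2))) (t - 1 / (2 * D))"
  have e: "e < t" "?a \<le> e" using l1 l2 D by (auto simp: e_def)
  have apart: "XL r \<noteq> XR r" if r: "e < r" "r < t" for r
  proof
    assume "XL r = XR r"
    then have "to_torus (torus_coord x + left_deriv XL t * (r - t)) = to_torus (torus_coord x + left_deriv XR t * (r - t))"
      using l1(1) l2(1) r by (simp add: e_def)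
    then have "D * (r - t) \<in> \<int>" by (simp add: to_torus_eq_iff D_def algebra_simps)
    moreover have "\<bar>D * (r - t)\<bar> < 1"
    proof -
      have "D * (t - r) < D * (1 / D)" using r D by (intro mult_strict_left_mono) (auto simp: e_def field_simps)
      then show ?thesis using D r by (simp add: abs_mult)
    qed
    ultimately have "D * (r - t) = 0" using Ints_nonzero_abs_less1 by blast
    then show False using D r by simp
  qed
  \<comment> \<open>The meeting times form a closed set, and none lies in the final stretch, so the last one is attained.\<close>
  define C where "C = {r \<in> {?a..e}. XL r = XR r}"
  have "C = {r \<in> {?a..e}. increment r t XR - increment r t XL \<in> \<int>}"
  proof -
    have "XL r = XR r \<longleftrightarrow> increment r t XR - increment r t XL \<in> \<int>" if "r \<in> {?a..e}" for r
    proof -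
      have "XL r = to_torus (torus_coord x - increment r t XL)" "XR r = to_torus (torus_coord x - increment r t XR)"
        using path_from_increment[of r t XL] path_from_increment[of r t XR] H1_path_subinterval[OF LH, of r t]
          H1_path_subinterval[OF RH, of r t] that e L(3) R(3) by auto
      then show ?thesis by (simp add: to_torus_eq_iff)
    qed
    then show ?thesis unfolding C_def by blast
  qed
  moreover have "continuous_on {?a..e} (\<lambda>r. increment r t XR - increment r t XL)"
    using e by (intro continuous_intros continuous_on_subset[OF continuous_on_increment[OF LH]]
        continuous_on_subset[OF continuous_on_increment[OF RH]]) auto
  ultimately have "closed C"
    using continuous_closed_preimage[of "{?a..e}" "\<lambda>r. increment r t XR - increment r t XL" \<int>] closed_Ints
    by (simp add: vimage_def Int_def conj_commute)
  moreover have aC: "?a \<in> C" using e L(2) R(2) by (simp add: C_def)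
  moreover have bdd: "bdd_above C" by (auto simp: C_def intro!: bdd_aboveI[of _ e])
  ultimately have SC: "Sup C \<in> C" by (intro closed_contains_Sup) auto
  \<comment> \<open>\<open>T_vee\<close> allows meeting times before \<open>s t\<close>, which do not affect the supremum\<close>
  have "T = Sup C" unfolding T_def T_vee_def XL_def[symmetric] XR_def[symmetric]
  proof (rule cSup_eq_maximum)
    show "Sup C \<in> {r. r < t \<and> XL r = XR r}" using SC e by (auto simp: C_def)
    fix r assume r: "r \<in> {r. r < t \<and> XL r = XR r}"
    then have "r \<le> e" using apart[of r] by (auto simp: not_less[symmetric])
    then show "r \<le> Sup C"
    proof (cases "r \<ge> ?a")
      case True
      then show ?thesis using r \<open>r \<le> e\<close> by (intro cSup_upper bdd) (auto simp: C_def)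
    next
      case False
      then show ?thesis using cSup_upper[OF aC bdd] by simp
    qed
  qed
  then have T: "?a \<le> T" "T < t" "XL T = XR T" using SC e by (auto simp: C_def)
  have "increment T t XL \<ge> increment T t XR" using le T by (simp add: path_le_def)
  moreover have "increment T t XL \<noteq> increment T t XR"
  proof
    assume eq: "increment T t XL = increment T t XR"
    \<comment> \<open>a minimizer with the increment of \<open>XR\<close> and the final slope of \<open>XL\<close>\<close>
    define Z where "Z = path_splice XR XL T t"
    have Zmin: "is_minimizer \<mu> \<theta> ?a t Z" unfolding Z_def
      by (rule is_minimizer_splice[OF R(1) is_minimizer_sub[OF L(1)]]) (use T L R in auto)
    then have ZH: "H1_path ?a t Z" by (simp add: is_minimizer_def)
    have Ze: "Z ?a = site t" "Z t = x" using T L R by (auto simp: Z_def path_splice_def)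
    have "increment T t Z = increment T t XL"
      by (rule weak_deriv_cong(5)) (auto simp: Z_def path_splice_def)
    moreover have "increment ?a T Z = increment ?a T XR"
      by (rule weak_deriv_cong(5)) (use T in \<open>auto simp: Z_def path_splice_def\<close>)
    ultimately have inc: "increment ?a t Z = increment ?a t XR"
      using increment_split[OF ZH, of T] increment_split[OF RH, of T] T eq by simp
    have "left_deriv Z t = left_deriv XL t"
      by (rule left_deriv_linear[of "max T (fst (last l1))" _ _ "torus_coord x"])
        (use T l1 in \<open>auto simp: Z_def path_splice_def\<close>)
    then show False
      using increments_differ[OF res tx Zmin Ze R] inc d by simp
  qed
  ultimately show ?thesis
    using sh unfolding global_shocks_at_def global_shocks_def shocks_at_def T_def XL_def XR_def by auto
qed

text \<open>Both shocks express \<open>\<theta>\<close> by the positions of atoms; cross-multiplying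
  eliminates \<open>\<theta>\<close>. The later of the two atoms is not a vertex of the polygons of the other
  one.\<close>

lemma global_shock_atoms_unique:
  assumes res: "resonance_free \<mu>"
    and 1: "(t, x) \<in> supp \<mu>" "(t, x) \<in> shocks_at \<mu> \<theta>"
    and 2: "(t', x') \<in> supp \<mu>" "(t', x') \<in> shocks_at \<mu> \<theta>" and le: "t' \<le> t"
  shows "(t, x) = (t', x')"
proof (rule ccontr)
  assume ne: "(t, x) \<noteq> (t', x')"
  have data: "\<exists>l1 l2 (K::int). l1 \<noteq> [] \<and> l2 \<noteq> [] \<and> set l1 \<subseteq> atom_lifts \<mu> \<and> set l2 \<subseteq> atom_lifts \<mu> \<and>
    (\<forall>q\<in>set l1 \<union> set l2. fst q < t) \<and> last l1 \<noteq> last l2 \<and> K \<noteq> 0 \<and>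
    chain_action (lift_mass \<mu>) 0 (l1 @ [(t, torus_coord x)]) -
      chain_action (lift_mass \<mu>) 0 (l2 @ [(t, torus_coord x)]) = \<theta> * of_int K"
    if tx: "(t, x) \<in> supp \<mu>" "(t, x) \<in> shocks_at \<mu> \<theta>" for t x
  proof -
    note L = minimizer_from_site[OF X_L(1)[of \<theta> t x]] and R = minimizer_from_site[OF X_R(1)[of \<theta> t x]]
    have d: "left_deriv (X_L \<mu> \<theta> t x) t \<noteq> left_deriv (X_R \<mu> \<theta> t x) t"
      using tx(2) by (simp add: shock_iff)
    obtain l1 l2 and K :: int where l: "l1 \<noteq> []" "l2 \<noteq> []" "set l1 \<subseteq> atom_lifts \<mu>" "set l2 \<subseteq> atom_lifts \<mu>"
      "\<forall>q\<in>set l1 \<union> set l2. fst q < t" "last l1 \<noteq> last l2"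
      "increment (s t) t (X_L \<mu> \<theta> t x) - increment (s t) t (X_R \<mu> \<theta> t x) = of_int K"
      "chain_action (lift_mass \<mu>) 0 (l1 @ [(t, torus_coord x)]) -
        chain_action (lift_mass \<mu>) 0 (l2 @ [(t, torus_coord x)]) = \<theta> * of_int K"
      using shock_data[OF L R d] by blast
    moreover have "K \<noteq> 0" using increments_differ[OF res tx(1) L R d] l(7) by auto
    ultimately show ?thesis by blast
  qed
  obtain l1 l2 and K :: int where l: "l1 \<noteq> []" "l2 \<noteq> []" "set l1 \<subseteq> atom_lifts \<mu>" "set l2 \<subseteq> atom_lifts \<mu>"
      "\<forall>q\<in>set l1 \<union> set l2. fst q < t" "last l1 \<noteq> last l2" "K \<noteq> 0"
      "chain_action (lift_mass \<mu>) 0 (l1 @ [(t, torus_coord x)]) -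
        chain_action (lift_mass \<mu>) 0 (l2 @ [(t, torus_coord x)]) = \<theta> * of_int K"
    using data[OF 1] by blast
  obtain l3 l4 and K' :: int where l': "set l3 \<subseteq> atom_lifts \<mu>" "set l4 \<subseteq> atom_lifts \<mu>"
      "\<forall>q\<in>set l3 \<union> set l4. fst q < t'" "K' \<noteq> 0"
      "chain_action (lift_mass \<mu>) 0 (l3 @ [(t', torus_coord x')]) -
        chain_action (lift_mass \<mu>) 0 (l4 @ [(t', torus_coord x')]) = \<theta> * of_int K'"
    using data[OF 2] by blast
  let ?z = "(t, torus_coord x)" and ?z' = "(t', torus_coord x')"
  have "?z \<in> atom_lifts \<mu>" "?z' \<in> atom_lifts \<mu>" using 1 2 by (simp_all add: atom_lift_coord)
  moreover have "set (l1 @ l2 @ (l3 @ [?z']) @ (l4 @ [?z'])) \<subseteq>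
      {q \<in> atom_lifts \<mu>. (fst q, to_torus (snd q)) \<noteq> (fst ?z, to_torus (snd ?z))}"
  proof
    fix q assume "q \<in> set (l1 @ l2 @ (l3 @ [?z']) @ (l4 @ [?z']))"
    moreover have "\<forall>q\<in>set l3 \<union> set l4. fst q < t" using l'(3) le by (auto intro: less_le_trans)
    ultimately consider "q = ?z'" | "q \<in> atom_lifts \<mu>" "fst q < t"
      using l(3,4,5) l'(1,2) by auto
    then show "q \<in> {q \<in> atom_lifts \<mu>. (fst q, to_torus (snd q)) \<noteq> (fst ?z, to_torus (snd ?z))}"
      using ne \<open>?z' \<in> atom_lifts \<mu>\<close> by cases auto
  qed
  moreover have "fst (last l1) < fst ?z" "fst (last l2) < fst ?z" using l(1,2,5) by auto
  ultimately have "of_int K' * (chain_action (lift_mass \<mu>) 0 (l1 @ [?z]) - chain_action (lift_mass \<mu>) 0 (l2 @ [?z])) \<noteq>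
     of_int K * (chain_action (lift_mass \<mu>) 0 (l3 @ [?z']) - chain_action (lift_mass \<mu>) 0 (l4 @ [?z']))"
    using res[unfolded resonance_free_def] l(1,2,6) l'(4) by blast
  then show False unfolding l(8) l'(5) by simp
qed

end

theorem Omega_tilde_of_resonance_free:
  assumes O: "\<mu> \<in> Omega1" and res: "resonance_free \<mu>"
  shows "\<mu> \<in> Omega_tilde"
proof -
  obtain M s where Ms: "\<mu> \<in> Omega" "M > 0" "\<And>t. s t \<le> t - M"
    "\<And>t. \<exists>y. supp \<mu> \<inter> ({s t - M..s t + M} \<times> UNIV) = {(s t, y)} \<and> measure \<mu> {(s t, y)} > 1 / (4 * M)"
    using O unfolding Omega1_def by blast
  interpret regenerative \<mu> M s by unfold_locales (use Ms in auto)
  have "finite (global_shocks_at \<mu> \<theta> \<inter> supp \<mu>) \<and> card (global_shocks_at \<mu> \<theta> \<inter> supp \<mu>) \<le> 1 \<and>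
     (shocks_at \<mu> \<theta> \<inter> supp \<mu>) - global_shocks_at \<mu> \<theta> = {}" for \<theta>
  proof -
    let ?A = "global_shocks_at \<mu> \<theta> \<inter> supp \<mu>"
    have "p = q" if pq: "p \<in> ?A" "q \<in> ?A" for p q
    proof -
      have "p \<in> shocks_at \<mu> \<theta>" "q \<in> shocks_at \<mu> \<theta>"
        using pq by (auto simp: global_shocks_at_def global_shocks_def shocks_at_def)
      then show ?thesis
        using pq global_shock_atoms_unique[OF res, of "fst p" "snd p" \<theta> "fst q" "snd q"]
          global_shock_atoms_unique[OF res, of "fst q" "snd q" \<theta> "fst p" "snd p"]
        by (cases "fst q \<le> fst p") auto
    qed
    then have "\<exists>p. ?A \<subseteq> {p}" by blast
    then obtain p where "?A \<subseteq> {p}" by blast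
    then have "finite ?A \<and> card ?A \<le> 1" using finite_subset[of ?A "{p}"] card_mono[of "{p}" ?A] by simp
    then show ?thesis using shock_at_atom_global[OF res] by auto
  qed
  then show ?thesis using O by (simp add: Omega_tilde_def)
qed

section \<open>Counting the points of a Poisson process\<close>

interpretation torus_lebesgue: prob_space torus_lebesgue
proof
  have "emeasure torus_lebesgue (space torus_lebesgue) = emeasure (restrict_space lborel {0..<1}) {0..<1::real}"
    unfolding torus_lebesgue_def
    by (subst emeasure_distr) (auto intro!: measurable_restrict_space1 simp: space_restrict_space)
  also have "\<dots> = 1" by (subst emeasure_restrict_space) auto
  finally show "emeasure torus_lebesgue (space torus_lebesgue) = 1" .
qed

lemma sets_torus_lebesgue [simp, measurable_cong]: "sets torus_lebesgue = sets borel"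
  and space_torus_lebesgue [simp]: "space torus_lebesgue = UNIV"
  by (simp_all add: torus_lebesgue_def)

lemma borel_prod_torus: "borel \<Otimes>\<^sub>M borel = (borel :: (real \<times> torus) measure)"
  by (rule borel_prod)

lemma time_slice_borel [measurable]: "A \<in> sets borel \<Longrightarrow> A \<times> (UNIV :: torus set) \<in> sets (borel :: (real \<times> torus) measure)"
  unfolding borel_prod_torus[symmetric] by simp

lemma cylinder_time_slice:
  assumes "A \<in> sets (borel :: real measure)"
  shows "emeasure cylinder_lebesgue (A \<times> UNIV) = emeasure lborel A"
  unfolding cylinder_lebesgue_def
  using torus_lebesgue.emeasure_space_1 assms
  by (subst torus_lebesgue.emeasure_pair_measure_Times) auto

interpretation cylinder: sigma_finite_measure cylinder_lebesgue
proof -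
  interpret pair_sigma_finite "lborel :: real measure" torus_lebesgue ..
  show "sigma_finite_measure cylinder_lebesgue"
    unfolding cylinder_lebesgue_def by (rule sigma_finite_pair_measure) unfold_locales
qed

lemma cylinder_slice_volume: "a \<le> b \<Longrightarrow> measure cylinder_lebesgue ({a..<b} \<times> UNIV) = b - a"
  and cylinder_slice_finite: "emeasure cylinder_lebesgue ({a..<b} \<times> UNIV) < \<infinity>"
  by (simp add: measure_def cylinder_time_slice) (cases "a \<le> b"; simp add: cylinder_time_slice)

locale poisson_process = prob_space P for P :: "'w measure" +
  fixes lam :: real and p :: "nat \<Rightarrow> 'w \<Rightarrow> real \<times> torus"
  assumes lam_pos: "lam > 0"
    and poisson: "homogeneous_poisson_process P lam p"
begin

lemma p_measurable [measurable]: "p n \<in> borel_measurable P"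
  using poisson by (simp add: homogeneous_poisson_process_def)

lemma count_law:
  assumes "B \<in> sets borel" "emeasure cylinder_lebesgue B < \<infinity>"
  shows "prob {\<omega> \<in> space P. point_count p B \<omega> = of_nat k} =
    (lam * measure cylinder_lebesgue B) ^ k / fact k * exp (- (lam * measure cylinder_lebesgue B))"
  using poisson assms unfolding homogeneous_poisson_process_def by blast

lemma counts_indep:
  fixes B :: "nat \<Rightarrow> (real \<times> torus) set"
  assumes "\<And>i. B i \<in> sets borel" "\<And>i. emeasure cylinder_lebesgue (B i) < \<infinity>" "disjoint_family B"
  shows "indep_vars (\<lambda>_. borel) (\<lambda>i. point_count p (B i)) UNIV"
  using poisson assms unfolding homogeneous_poisson_process_def by blast

lemma point_count_suminf: "point_count p B \<omega> = (\<Sum>n. indicator B (p n \<omega>))"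
proof -
  have "point_count p B \<omega> = (\<integral>\<^sup>+ n. indicator {n. p n \<omega> \<in> B} n \<partial>count_space UNIV)"
    by (simp add: point_count_def)
  also have "\<dots> = (\<Sum>n. indicator B (p n \<omega>))"
    unfolding nn_integral_count_space_nat by (rule suminf_cong) (simp add: indicator_def)
  finally show ?thesis .
qed

lemma point_count_measurable [measurable]: "B \<in> sets borel \<Longrightarrow> point_count p B \<in> borel_measurable P"
proof -
  assume [measurable]: "B \<in> sets borel"
  show ?thesis unfolding point_count_suminf[abs_def] by measurable
qed

lemma point_count_ge2:
  assumes "m \<noteq> n" "p m \<omega> \<in> B" "p n \<omega> \<in> B"
  shows "point_count p B \<omega> \<noteq> of_nat 0" "point_count p B \<omega> \<noteq> of_nat 1"
proof -
  have "emeasure (count_space UNIV) {m, n} \<le> point_count p B \<omega>"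
    unfolding point_count_def using assms by (intro emeasure_mono) auto
  then have "2 \<le> point_count p B \<omega>" using assms(1) by simp
  moreover have "\<not> (2::ennreal) \<le> 1" "\<not> (2::ennreal) \<le> 0"
    by simp_all
  ultimately show "point_count p B \<omega> \<noteq> of_nat 0" "point_count p B \<omega> \<noteq> of_nat 1" by (metis of_nat_0, metis of_nat_1)
qed

text \<open>The Poisson probabilities of the finite values have sum one.\<close>

lemma AE_count_finite:
  assumes B: "B \<in> sets borel" "emeasure cylinder_lebesgue B < \<infinity>"
  shows "AE \<omega> in P. \<exists>k. point_count p B \<omega> = of_nat k"
proof -
  let ?v = "lam * measure cylinder_lebesgue B"
  let ?E = "\<lambda>k::nat. {\<omega> \<in> space P. point_count p B \<omega> = of_nat k}"
  have "(\<lambda>k. prob (?E k)) sums prob (\<Union>k. ?E k)"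
    using B by (intro finite_measure_UNION) (auto simp: disjoint_family_on_def)
  moreover have "(\<lambda>k. prob (?E k)) sums 1"
  proof -
    have "(\<lambda>k. ?v ^ k /\<^sub>R fact k * exp (- ?v)) sums (exp ?v * exp (- ?v))"
      by (intro sums_mult2 exp_converges)
    then show ?thesis by (simp add: count_law[OF B] exp_minus_inverse divide_inverse mult_ac)
  qed
  ultimately have "prob (\<Union>k. ?E k) = 1" by (rule sums_unique2)
  moreover have "(\<Union>k. ?E k) \<in> events" using B by measurable
  ultimately have "AE \<omega> in P. \<omega> \<in> (\<Union>k. ?E k)" by (simp add: prob_eq_1)
  then show ?thesis by eventually_elim auto
qed

lemma count_mean:
  assumes B: "B \<in> sets borel" "emeasure cylinder_lebesgue B < \<infinity>"
  shows "(\<integral>\<^sup>+ \<omega>. point_count p B \<omega> \<partial>P) = ennreal (lam * measure cylinder_lebesgue B)"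
proof -
  let ?v = "lam * measure cylinder_lebesgue B"
  let ?E = "\<lambda>k::nat. {\<omega> \<in> space P. point_count p B \<omega> = of_nat k}"
  have v: "?v \<ge> 0" using lam_pos by simp
  have "(\<integral>\<^sup>+ \<omega>. point_count p B \<omega> \<partial>P) = (\<integral>\<^sup>+ \<omega>. (\<Sum>k. of_nat k * indicator (?E k) \<omega>) \<partial>P)"
  proof (rule nn_integral_cong_AE)
    show "AE \<omega> in P. point_count p B \<omega> = (\<Sum>k. of_nat k * indicator (?E k) \<omega>)"
      using AE_count_finite[OF B] AE_space
    proof eventually_elim
      case (elim \<omega>)
      then obtain j :: nat where j: "point_count p B \<omega> = of_nat j" by blast
      have "(\<Sum>k. of_nat k * indicator (?E k) \<omega>) = (\<Sum>k\<in>{j}. of_nat k * indicator (?E k) \<omega> :: ennreal)"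
        using j elim by (intro suminf_finite) (auto simp: indicator_def)
      then show ?case using j elim by simp
    qed
  qed
  also have "\<dots> = (\<Sum>k. of_nat k * emeasure P (?E k))"
    using B by (subst nn_integral_suminf) (auto simp: nn_integral_cmult)
  also have "\<dots> = (\<Sum>k. ennreal (real k * (?v ^ k / fact k * exp (- ?v))))"
  proof (rule suminf_cong)
    fix k
    have "of_nat k * emeasure P (?E k) = ennreal (real k) * ennreal (?v ^ k / fact k * exp (- ?v))"
      unfolding emeasure_eq_measure count_law[OF B] by (simp only: ennreal_of_nat_eq_real_of_nat)
    also have "\<dots> = ennreal (real k * (?v ^ k / fact k * exp (- ?v)))"
      using v by (intro ennreal_mult[symmetric]) auto
    finally show "of_nat k * emeasure P (?E k) = ennreal (real k * (?v ^ k / fact k * exp (- ?v)))" .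
  qed
  also have "\<dots> = ennreal ?v"
  proof (rule suminf_ennreal_eq)
    show "0 \<le> real k * (?v ^ k / fact k * exp (- ?v))" for k using v by simp
    have "(\<lambda>k. ?v * (?v ^ k /\<^sub>R fact k) * exp (- ?v)) sums (?v * exp ?v * exp (- ?v))"
      by (intro sums_mult2 sums_mult exp_converges)
    moreover have "?v * (?v ^ k /\<^sub>R fact k) * exp (- ?v) = real (Suc k) * (?v ^ Suc k / fact (Suc k) * exp (- ?v))" for k
      by (simp add: field_simps del: of_nat_Suc)
    ultimately have "(\<lambda>k. real (Suc k) * (?v ^ Suc k / fact (Suc k) * exp (- ?v))) sums ?v"
      by (simp add: mult.assoc exp_minus_inverse)
    from sums_Suc[OF this] show "(\<lambda>k. real k * (?v ^ k / fact k * exp (- ?v))) sums ?v" by simp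
  qed
  finally show ?thesis .
qed

text \<open>Two indices with points in \<open>B\<close> make the count at least two, and \<open>1 - (1 + v)
  exp (- v) \<le> v\<^sup>2\<close>.\<close>

lemma prob_two_points_le:
  assumes B: "B \<in> sets borel" "emeasure cylinder_lebesgue B < \<infinity>" and mn: "m \<noteq> n"
  shows "prob {\<omega> \<in> space P. p m \<omega> \<in> B \<and> p n \<omega> \<in> B} \<le> (lam * measure cylinder_lebesgue B)\<^sup>2"
proof -
  let ?v = "lam * measure cylinder_lebesgue B"
  let ?E = "\<lambda>k::nat. {\<omega> \<in> space P. point_count p B \<omega> = of_nat k}"
  have [measurable]: "B \<in> sets borel" by fact
  have v: "?v \<ge> 0" using lam_pos by simp
  have "prob {\<omega> \<in> space P. p m \<omega> \<in> B \<and> p n \<omega> \<in> B} \<le> prob (space P - (?E 0 \<union> ?E 1))"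
    using point_count_ge2[OF mn] by (intro finite_measure_mono) auto
  also have "\<dots> = 1 - (prob (?E 0) + prob (?E 1))"
  proof -
    have "prob (?E 0 \<union> ?E 1) = prob (?E 0) + prob (?E 1)"
      by (intro finite_measure_Union) auto
    then show ?thesis by (subst prob_compl) auto
  qed
  also have "\<dots> = 1 - (1 + ?v) * exp (- ?v)" using count_law[OF B, of 0] count_law[OF B, of 1] by (simp add: algebra_simps)
  also have "\<dots> \<le> 1 - (1 + ?v) * (1 - ?v)"
    using exp_ge_add_one_self[of "- ?v"] v by (intro diff_left_mono mult_left_mono) auto
  also have "\<dots> = ?v\<^sup>2" by (simp add: power2_eq_square algebra_simps)
  finally show ?thesis .
qed

text \<open>Cover the times in \<open>[-R, R)\<close> by slices of length \<open>1 / K\<close>. Two points at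
  the same time lie in the same slice; this has probability at most \<open>2 R K (lam / K)\<^sup>2\<close>,
  which tends to zero. In particular the enumeration of the points is almost surely injective.\<close>

lemma AE_distinct_times:
  assumes mn: "m \<noteq> n"
  shows "AE \<omega> in P. fst (p m \<omega>) \<noteq> fst (p n \<omega>)"
proof -
  have [measurable]: "(fst :: real \<times> torus \<Rightarrow> real) \<in> borel_measurable borel"
    by (auto intro!: borel_measurable_continuous_onI continuous_on_fst continuous_on_id)
  have "AE \<omega> in P. \<not> (fst (p m \<omega>) = fst (p n \<omega>) \<and> \<bar>fst (p m \<omega>)\<bar> < real R)" for R :: nat
  proof -
    let ?E = "{\<omega> \<in> space P. fst (p m \<omega>) = fst (p n \<omega>) \<and> \<bar>fst (p m \<omega>)\<bar> < real R}"
    have bound: "prob ?E \<le> 2 * real R * lam\<^sup>2 / real K" if K: "K > 0" for K :: nat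
    proof -
      define B where "B = (\<lambda>i::nat. {- real R + real i / real K ..< - real R + (real i + 1) / real K} \<times> (UNIV :: torus set))"
      have vol: "measure cylinder_lebesgue (B i) = 1 / real K" for i
        unfolding B_def using K by (subst cylinder_slice_volume) (auto simp: field_simps)
      have B: "B i \<in> sets borel" "emeasure cylinder_lebesgue (B i) < \<infinity>" for i
        unfolding B_def by (simp, rule cylinder_slice_finite)
      have "?E \<subseteq> (\<Union>i<2 * R * K. {\<omega> \<in> space P. p m \<omega> \<in> B i \<and> p n \<omega> \<in> B i})"
      proof
        fix \<omega> assume \<omega>: "\<omega> \<in> ?E"
        define x where "x = (fst (p m \<omega>) + real R) * real K"
        define i where "i = nat \<lfloor>x\<rfloor>"
        have x0: "0 \<le> x" using \<omega> K by (auto simp: x_def)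
        then have i: "real i \<le> x" "x < real i + 1" by (simp_all add: i_def)
        have "x < 2 * real R * real K" using \<omega> K by (auto simp: x_def)
        then have "real i < real (2 * R * K)" using i by simp
        then have iK: "i < 2 * R * K" by (simp only: of_nat_less_iff)
        have xK: "fst (p m \<omega>) = - real R + x / real K" using K by (simp add: x_def)
        have "p q \<omega> \<in> B i" if "fst (p q \<omega>) = fst (p m \<omega>)" for q
          using that i K xK unfolding B_def by (cases "p q \<omega>") (auto simp: divide_right_mono divide_strict_right_mono)
        then show "\<omega> \<in> (\<Union>i<2 * R * K. {\<omega> \<in> space P. p m \<omega> \<in> B i \<and> p n \<omega> \<in> B i})" using iK \<omega> by auto
      qed
      then have "prob ?E \<le> prob (\<Union>i<2 * R * K. {\<omega> \<in> space P. p m \<omega> \<in> B i \<and> p n \<omega> \<in> B i})"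
        using B by (intro finite_measure_mono) auto
      also have "\<dots> \<le> (\<Sum>i<2 * R * K. prob {\<omega> \<in> space P. p m \<omega> \<in> B i \<and> p n \<omega> \<in> B i})"
        using B by (intro finite_measure_subadditive_finite) auto
      also have "\<dots> \<le> (\<Sum>i<2 * R * K. (lam * (1 / real K))\<^sup>2)"
        using prob_two_points_le[OF B mn] by (intro sum_mono) (simp add: vol)
      also have "\<dots> = 2 * real R * lam\<^sup>2 / real K"
        using K by (simp add: power2_eq_square field_simps)
      finally show ?thesis .
    qed
    have "prob ?E \<le> 0"
    proof (rule tendsto_lowerbound[of _ _ sequentially])
      show "(\<lambda>K. 2 * real R * lam\<^sup>2 / real K) \<longlonglongrightarrow> 0" by real_asymp
      show "\<forall>\<^sub>F K in sequentially. prob ?E \<le> 2 * real R * lam\<^sup>2 / real K"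
        using eventually_gt_at_top[of "0::nat"] by eventually_elim (rule bound)
    qed simp
    then have "prob ?E = 0" by (simp add: measure_le_0_iff)
    then show ?thesis by (subst AE_iff_measurable[of ?E]) (auto simp: emeasure_eq_measure)
  qed
  then have "AE \<omega> in P. \<forall>R::nat. \<not> (fst (p m \<omega>) = fst (p n \<omega>) \<and> \<bar>fst (p m \<omega>)\<bar> < real R)"
    by (subst AE_all_countable) blast
  then show ?thesis by eventually_elim (use reals_Archimedean2 in blast)
qed

end

section \<open>Absolute continuity of tuples of points\<close>

lemma AE_torus_notin_countable:
  assumes "countable (F :: torus set)"
  shows "AE x in torus_lebesgue. x \<notin> F"
proof -
  have pt: "AE x in torus_lebesgue. x \<noteq> q" for q
  proof -
    obtain a where a: "q = to_torus a" using surj_to_torus by (rule surjE)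
    have "{y. to_torus y = q} \<subseteq> range (\<lambda>k::int. a + of_int k)"
    proof
      fix y assume "y \<in> {y. to_torus y = q}"
      then have "y - a \<in> \<int>" by (simp add: a to_torus_eq_iff)
      then obtain k where "y - a = of_int k" by (elim Ints_cases)
      then have "y = a + of_int k" by simp
      then show "y \<in> range (\<lambda>k::int. a + of_int k)" by blast
    qed
    then have "countable {y. to_torus y = q}" by (rule countable_subset) auto
    then have "{y. to_torus y = q} \<in> null_sets lborel" by (rule countable_imp_null_set_lborel)
    then have "AE y in lborel. to_torus y \<noteq> q" by (rule AE_I') auto
    then have "AE y in restrict_space lborel {0..<1}. to_torus y \<noteq> q"
      by (subst AE_restrict_space_iff) auto
    then show ?thesis
      unfolding torus_lebesgue_def by (subst AE_distr_iff) (auto intro!: measurable_restrict_space1)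
  qed
  have "AE x in torus_lebesgue. \<forall>q\<in>F. x \<noteq> q"
    using assms pt by (simp add: AE_ball_countable)
  then show ?thesis by eventually_elim auto
qed

lemma AE_cylinder_countable_sections:
  assumes A: "A \<in> sets (borel :: (real \<times> torus) measure)" and c: "\<And>t. countable {x. (t, x) \<in> A}"
  shows "AE z in cylinder_lebesgue. z \<notin> A"
proof -
  interpret pair_sigma_finite "lborel :: real measure" torus_lebesgue ..
  show ?thesis unfolding cylinder_lebesgue_def
  proof (rule AE_pair_measure)
    have "sets (lborel \<Otimes>\<^sub>M torus_lebesgue) = sets (borel :: (real \<times> torus) measure)"
      by (simp only: cylinder_lebesgue_def[symmetric] sets_cylinder_lebesgue)
    moreover have "{x \<in> space (lborel \<Otimes>\<^sub>M torus_lebesgue). x \<notin> A} = - A"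
      by (auto simp: space_pair_measure)
    ultimately show "{x \<in> space (lborel \<Otimes>\<^sub>M torus_lebesgue). x \<notin> A} \<in> sets (lborel \<Otimes>\<^sub>M torus_lebesgue)"
      using A by simp
    show "AE x in lborel. AE y in torus_lebesgue. (x, y) \<notin> A"
    proof (rule AE_I2)
      fix t show "AE y in torus_lebesgue. (t, y) \<notin> A" using AE_torus_notin_countable[OF c[of t]] by simp
    qed
  qed
qed

context poisson_process
begin

text \<open>The enumeration of the points is arbitrary, so the law of a single tuple \<open>(p i)\<close> is
  unknown. But the sum, over all tuples of indices \<open>n\<close>, of the laws of \<open>(p (n i))\<close>
  inside a product of disjoint boxes is a measure whose value on a product of sets is the expectation of a
  product of independent counts. So it is the product of the measures \<open>lam\<close> times Lebesgue, and
  the law of each single tuple is absolutely continuous with respect to it. By Fubini's theorem it is enough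
  that the sections of \<open>A\<close> in one space coordinate are countable.\<close>

lemma AE_tuple_in_boxes:
  fixes D :: "nat \<Rightarrow> (real \<times> torus) set"
  assumes I: "finite I" and D: "\<And>i. D i \<in> sets borel" "\<And>i. emeasure cylinder_lebesgue (D i) < \<infinity>" "disjoint_family D"
    and A: "A \<in> sets (PiM I (\<lambda>_. borel))" and n: "n \<in> I"
    and c: "\<And>y t. countable {x. y(n := (t, x)) \<in> A}"
  shows "AE \<omega> in P. (\<forall>i\<in>I. p i \<omega> \<in> D i) \<longrightarrow> (\<lambda>i\<in>I. p i \<omega>) \<notin> A"
proof -
  note D(1)[measurable] A[measurable]
  define N where "N = (\<lambda>i. density cylinder_lebesgue (\<lambda>z. ennreal lam * indicator (D i) z))"
  have sN [simp, measurable_cong]: "sets (N i) = sets borel" for i by (simp add: N_def sets_cylinder_lebesgue)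
  have Ai: "emeasure (N i) B = ennreal lam * emeasure cylinder_lebesgue (D i \<inter> B)" if "B \<in> sets borel" for i B
  proof -
    have "emeasure (N i) B = (\<integral>\<^sup>+ z. ennreal lam * indicator (D i \<inter> B) z \<partial>cylinder_lebesgue)"
      unfolding N_def using that sets_cylinder_lebesgue
      by (subst emeasure_density) (auto intro!: nn_integral_cong split: split_indicator)
    also have "\<dots> = ennreal lam * emeasure cylinder_lebesgue (D i \<inter> B)"
      using that by (subst nn_integral_cmult_indicator) (auto simp: sets_cylinder_lebesgue)
    finally show ?thesis .
  qed
  have finN: "finite_measure (N i)" for i
  proof
    have "emeasure (N i) UNIV = ennreal lam * emeasure cylinder_lebesgue (D i)"
      using Ai[of UNIV i] by simp
    then show "emeasure (N i) (space (N i)) \<noteq> \<infinity>"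
      using D(2)[of i] sets_eq_imp_space_eq[OF sN, of i] by (simp add: ennreal_mult_eq_top_iff less_top)
  qed
  interpret N: product_sigma_finite N
    using finN by (simp add: product_sigma_finite_def finite_measure.sigma_finite_measure)
  interpret C: product_sigma_finite "\<lambda>_::nat. count_space (UNIV :: nat set)"
    by (simp add: product_sigma_finite_def sigma_finite_measure_count_space)
  define C where "C = PiM I (\<lambda>_::nat. count_space (UNIV :: nat set))"
  have sfC: "sigma_finite_measure C" unfolding C_def by (rule C.sigma_finite[OF I])
  interpret CP: pair_sigma_finite C P
    using sfC by (simp add: pair_sigma_finite_def sigma_finite_measure_axioms)
  define f where "f = (\<lambda>(n :: nat \<Rightarrow> nat, \<omega>). \<lambda>i\<in>I. p (n i) \<omega>)"
  have comp: "(\<lambda>x. p (fst x i) (snd x)) \<in> borel_measurable (C \<Otimes>\<^sub>M P)" if "i \<in> I" for i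
  proof (rule measurable_compose_countable)
    show "(\<lambda>x. fst x i) \<in> C \<Otimes>\<^sub>M P \<rightarrow>\<^sub>M count_space UNIV"
      unfolding C_def using that by measurable
  qed measurable
  have f [measurable]: "f \<in> C \<Otimes>\<^sub>M P \<rightarrow>\<^sub>M PiM I (\<lambda>_. borel)"
    unfolding f_def split_beta by (intro measurable_restrict comp)
  define R where "R = PiE I D"
  have R [measurable]: "R \<in> sets (PiM I (\<lambda>_. borel))" unfolding R_def by (intro sets_PiM_I_finite I D)
  \<comment> \<open>the sum over all tuples \<open>n\<close> of indices of the law of \<open>(p (n i))\<close> inside the boxes\<close>
  define M' where "M' = distr (density (C \<Otimes>\<^sub>M P) (\<lambda>x. indicator R (f x))) (PiM I N) f"
  have sPN: "sets (PiM I N) = sets (PiM I (\<lambda>_. borel))" by (intro sets_PiM_cong) auto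
  have eM': "emeasure M' B = (\<integral>\<^sup>+ x. indicator (R \<inter> B) (f x) \<partial>(C \<Otimes>\<^sub>M P))" if "B \<in> sets (PiM I (\<lambda>_. borel))" for B
  proof -
    note that[measurable]
    have "emeasure M' B = emeasure (density (C \<Otimes>\<^sub>M P) (\<lambda>x. indicator R (f x))) (f -` B \<inter> space (C \<Otimes>\<^sub>M P))"
      unfolding M'_def using that sPN f by (subst emeasure_distr) (auto cong: measurable_cong_sets)
    also have "\<dots> = (\<integral>\<^sup>+ x. indicator R (f x) * indicator (f -` B \<inter> space (C \<Otimes>\<^sub>M P)) x \<partial>(C \<Otimes>\<^sub>M P))"
      by (subst emeasure_density) auto
    also have "\<dots> = (\<integral>\<^sup>+ x. indicator (R \<inter> B) (f x) \<partial>(C \<Otimes>\<^sub>M P))"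
      by (intro nn_integral_cong) (auto simp: indicator_def)
    finally show ?thesis .
  qed
  have "M' = PiM I N"
  proof (rule N.PiM_eqI[OF I])
    show "sets M' = sets (PiM I N)" by (simp add: M'_def)
    fix B assume "\<And>i. i \<in> I \<Longrightarrow> B i \<in> sets (N i)"
    then have B: "\<And>i. i \<in> I \<Longrightarrow> B i \<in> sets borel" by simp
    define E where "E = (\<lambda>i. if i \<in> I then D i \<inter> B i else {})"
    have E [measurable]: "E i \<in> sets borel" for i using B D by (auto simp: E_def)
    have Efin: "emeasure cylinder_lebesgue (E i) < \<infinity>" for i
    proof -
      have "emeasure cylinder_lebesgue (E i) \<le> emeasure cylinder_lebesgue (D i)"
        using D(1) by (intro emeasure_mono) (auto simp: E_def sets_cylinder_lebesgue)
      then show ?thesis using D(2)[of i] by simp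
    qed
    have Edisj: "disjoint_family E"
      using D(3) by (auto simp: disjoint_family_on_def E_def)
    have "emeasure M' (PiE I B) = (\<integral>\<^sup>+ x. indicator (R \<inter> PiE I B) (f x) \<partial>(C \<Otimes>\<^sub>M P))"
      using B I by (intro eM' sets_PiM_I_finite) auto
    also have "\<dots> = (\<integral>\<^sup>+ x. (\<Prod>i\<in>I. indicator (E i) (p (fst x i) (snd x))) \<partial>(C \<Otimes>\<^sub>M P))"
    proof (rule nn_integral_cong)
      fix x :: "(nat \<Rightarrow> nat) \<times> 'w"
      have "f x \<in> R \<inter> PiE I B \<longleftrightarrow> (\<forall>i\<in>I. p (fst x i) (snd x) \<in> E i)"
        by (auto simp: f_def R_def E_def split_beta PiE_iff)
      then show "indicator (R \<inter> PiE I B) (f x) = (\<Prod>i\<in>I. indicator (E i) (p (fst x i) (snd x)) :: ennreal)"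
        using I by (auto simp: indicator_def)
    qed
    also have "\<dots> = (\<integral>\<^sup>+ \<omega>. (\<integral>\<^sup>+ n. (\<Prod>i\<in>I. indicator (E i) (p (n i) \<omega>)) \<partial>C) \<partial>P)"
    proof (subst CP.nn_integral_snd[symmetric])
      show "(\<lambda>x. \<Prod>i\<in>I. indicator (E i) (p (fst x i) (snd x)) :: ennreal) \<in> borel_measurable (C \<Otimes>\<^sub>M P)"
        by (intro borel_measurable_prod_ennreal borel_measurable_indicator' measurable_sets_borel measurable_compose[OF comp borel_measurable_indicator] E)
    qed simp
    also have "\<dots> = (\<integral>\<^sup>+ \<omega>. (\<Prod>i\<in>I. point_count p (E i) \<omega>) \<partial>P)"
    proof (rule nn_integral_cong)
      fix \<omega>
      show "(\<integral>\<^sup>+ n. (\<Prod>i\<in>I. indicator (E i) (p (n i) \<omega>)) \<partial>C) = (\<Prod>i\<in>I. point_count p (E i) \<omega>)"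
        unfolding C_def using I
        by (subst C.product_nn_integral_prod) (auto simp: nn_integral_count_space_nat point_count_suminf)
    qed
    also have "\<dots> = (\<Prod>i\<in>I. \<integral>\<^sup>+ \<omega>. point_count p (E i) \<omega> \<partial>P)"
      using indep_vars_subset[OF counts_indep[OF E Efin Edisj], of I] by (intro indep_vars_nn_integral I) auto
    also have "\<dots> = (\<Prod>i\<in>I. emeasure (N i) (B i))"
    proof (rule prod.cong)
      fix i assume i: "i \<in> I"
      have "(\<integral>\<^sup>+ \<omega>. point_count p (E i) \<omega> \<partial>P) = ennreal (lam * measure cylinder_lebesgue (E i))"
        by (rule count_mean[OF E Efin])
      also have "\<dots> = ennreal lam * emeasure cylinder_lebesgue (E i)"
        using Efin[of i] lam_pos by (simp add: ennreal_mult emeasure_eq_ennreal_measure less_top)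
      also have "\<dots> = emeasure (N i) (B i)" using Ai[OF B[OF i], of i] i by (simp add: E_def)
      finally show "(\<integral>\<^sup>+ \<omega>. point_count p (E i) \<omega> \<partial>P) = emeasure (N i) (B i)" .
    qed simp
    finally show "emeasure M' (PiE I B) = (\<Prod>i\<in>I. emeasure (N i) (B i))" .
  qed
  moreover have "emeasure (PiM I N) A = 0"
  proof -
    define J where "J = I - {n}"
    have J: "finite J" "n \<notin> J" "insert n J = I" using I n by (auto simp: J_def)
    have "emeasure (PiM I N) A = (\<integral>\<^sup>+ x. indicator A x \<partial>PiM (insert n J) N)"
      using A sPN J(3) by simp
    also have "\<dots> = (\<integral>\<^sup>+ y. (\<integral>\<^sup>+ z. indicator A (y(n := z)) \<partial>N n) \<partial>PiM J N)"
      using A sPN J by (intro N.product_nn_integral_insert) auto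
    also have "\<dots> = (\<integral>\<^sup>+ y. 0 \<partial>PiM J N)"
    proof (rule nn_integral_cong)
      fix y assume y: "y \<in> space (PiM J N)"
      have m: "(\<lambda>z. y(n := z)) \<in> borel \<rightarrow>\<^sub>M PiM I (\<lambda>_. borel)"
        using y J by (intro measurable_PiM_single') (auto simp: space_PiM PiE_iff extensional_def J_def)
      have Ay: "{z. y(n := z) \<in> A} \<in> sets borel"
        using measurable_sets[OF m A] by (simp add: vimage_def)
      have "AE z in cylinder_lebesgue. z \<notin> {z. y(n := z) \<in> A}"
        using c by (intro AE_cylinder_countable_sections[OF Ay]) simp
      then have "AE z in cylinder_lebesgue. indicator A (y(n := z)) = (0::ennreal)"
        by eventually_elim (simp add: indicator_def)
      then have "AE z in N n. indicator A (y(n := z)) = (0::ennreal)"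
        unfolding N_def by (subst AE_density) (auto simp: sets_cylinder_lebesgue cong: measurable_cong_sets elim: eventually_mono)
      then have "(\<integral>\<^sup>+ z. indicator A (y(n := z)) \<partial>N n) = (\<integral>\<^sup>+ z. 0 \<partial>N n)" by (rule nn_integral_cong_AE)
      then show "(\<integral>\<^sup>+ z. indicator A (y(n := z)) \<partial>N n) = 0" by simp
    qed
    finally show ?thesis by simp
  qed
  ultimately have zero: "(\<integral>\<^sup>+ x. indicator (R \<inter> A) (f x) \<partial>(C \<Otimes>\<^sub>M P)) = 0"
    using eM'[OF A] by simp
  have ind: "(\<lambda>x. indicator (R \<inter> A) (f x) :: ennreal) \<in> borel_measurable (C \<Otimes>\<^sub>M P)" by measurable
  define g where "g = (\<lambda>n. \<integral>\<^sup>+ \<omega>. indicator (R \<inter> A) (f (n, \<omega>)) \<partial>P)"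
  \<comment> \<open>the given tuple is one term of the sum\<close>
  define n0 where "n0 = (\<lambda>i\<in>I. i)"
  have sing: "{n0} = PiE I (\<lambda>i. {i})" by (auto simp: n0_def PiE_iff extensional_def fun_eq_iff)
  have n0: "{n0} \<in> sets C" "emeasure C {n0} = 1"
    unfolding sing C_def using I by (auto intro!: sets_PiM_I_finite simp: C.emeasure_PiM)
  have "g n0 = (\<integral>\<^sup>+ m. g n0 * indicator {n0} m \<partial>C)"
    using n0 by (subst nn_integral_cmult_indicator) auto
  also have "\<dots> \<le> (\<integral>\<^sup>+ m. g m \<partial>C)" by (intro nn_integral_mono) (auto simp: indicator_def)
  also have "\<dots> = 0" unfolding g_def using zero by (subst nn_integral_fst[OF ind]) simp
  finally have "g n0 = 0" by simp
  moreover have "(\<lambda>\<omega>. indicator (R \<inter> A) (f (n0, \<omega>)) :: ennreal) \<in> borel_measurable P"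
  proof -
    have "n0 \<in> space C" using n0(1) sets.sets_into_space by blast
    then show ?thesis using measurable_compose[OF measurable_Pair1' ind] by simp
  qed
  ultimately have "AE \<omega> in P. indicator (R \<inter> A) (f (n0, \<omega>)) = (0::ennreal)"
    unfolding g_def by (subst (asm) nn_integral_0_iff_AE) auto
  moreover have "f (n0, \<omega>) = (\<lambda>i\<in>I. p i \<omega>)" for \<omega> by (auto simp: f_def n0_def)
  ultimately show ?thesis by (auto simp: indicator_def R_def elim!: eventually_mono split: if_splits)
qed

text \<open>Since the times are almost surely distinct, the boxes can be taken to be time slices on a
  sufficiently fine grid. There are countably many choices of such slices.\<close>

lemma AE_tuple_notin:
  assumes I: "finite I" and A: "A \<in> sets (PiM I (\<lambda>_. borel))" and n: "n \<in> I"
    and c: "\<And>y t. countable {x. y(n := (t, x)) \<in> A}"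
  shows "AE \<omega> in P. (\<lambda>i\<in>I. p i \<omega>) \<notin> A"
proof -
  define D where "D = (\<lambda>(K::nat) (j :: nat \<Rightarrow> int) i. if i \<in> I
     then {of_int (j i) / real K ..< (of_int (j i) + 1) / real K} \<times> (UNIV :: torus set) else {})"
  have 1: "AE \<omega> in P. (\<forall>i\<in>I. p i \<omega> \<in> D K j i) \<longrightarrow> (\<lambda>i\<in>I. p i \<omega>) \<notin> A"
    if j: "inj_on j I" and K: "K > 0" for K j
  proof (rule AE_tuple_in_boxes[OF I _ _ _ A n c])
    show "D K j i \<in> sets borel" for i by (simp add: D_def)
    show "emeasure cylinder_lebesgue (D K j i) < \<infinity>" for i
      unfolding D_def using cylinder_slice_finite by auto
    show "disjoint_family (D K j)"
    proof (rule ccontr)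
      assume "\<not> disjoint_family (D K j)"
      then obtain i i' z where z: "i \<noteq> i'" "z \<in> D K j i" "z \<in> D K j i'" by (auto simp: disjoint_family_on_def)
      then have ii: "i \<in> I" "i' \<in> I" by (auto simp: D_def split: if_splits)
      have "\<lfloor>fst z * real K\<rfloor> = j q" if "z \<in> D K j q" "q \<in> I" for q
        using that K by (intro floor_unique) (auto simp: D_def field_simps)
      then have "j i = j i'" using z ii by metis
      then show False using j ii z(1) by (auto dest: inj_onD)
    qed
  qed
  have "countable (UNIV \<times> PiE I (\<lambda>_. UNIV :: int set) :: (nat \<times> (nat \<Rightarrow> int)) set)"
    using I by (intro countable_SIGMA countable_PiE) auto
  moreover have "AE \<omega> in P. fst x > 0 \<longrightarrow> inj_on (snd x) I \<longrightarrow> (\<forall>i\<in>I. p i \<omega> \<in> D (fst x) (snd x) i) \<longrightarrow> (\<lambda>i\<in>I. p i \<omega>) \<notin> A" for x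
    using 1[of "snd x" "fst x"] by (cases "fst x > 0 \<and> inj_on (snd x) I") auto
  ultimately have 2: "AE \<omega> in P. \<forall>x\<in>UNIV \<times> PiE I (\<lambda>_. UNIV :: int set). fst x > 0 \<longrightarrow> inj_on (snd x) I \<longrightarrow>
      (\<forall>i\<in>I. p i \<omega> \<in> D (fst x) (snd x) i) \<longrightarrow> (\<lambda>i\<in>I. p i \<omega>) \<notin> A"
    by (subst AE_ball_countable) auto
  have 3: "AE \<omega> in P. \<forall>m. \<forall>k. m \<noteq> k \<longrightarrow> fst (p m \<omega>) \<noteq> fst (p k \<omega>)"
    using AE_distinct_times by (subst AE_all_countable, intro allI, subst AE_all_countable) auto
  from 2 3 show ?thesis
  proof eventually_elim
    case (elim \<omega>)
    let ?t = "\<lambda>i. fst (p i \<omega>)"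
    \<comment> \<open>a grid so fine that the finitely many distinct times fall in different slices\<close>
    have "\<forall>\<^sub>F K :: nat in sequentially. \<forall>i\<in>I. \<forall>k\<in>I. i \<noteq> k \<longrightarrow> 1 \<le> real K * \<bar>?t i - ?t k\<bar>"
    proof (intro eventually_ball_finite I ballI)
      fix i k
      show "\<forall>\<^sub>F K :: nat in sequentially. i \<noteq> k \<longrightarrow> 1 \<le> real K * \<bar>?t i - ?t k\<bar>"
      proof (cases "i = k")
        case False
        then have d: "\<bar>?t i - ?t k\<bar> > 0" using elim(2) by simp
        obtain K0 :: nat where K0: "real K0 * \<bar>?t i - ?t k\<bar> > 1" using reals_Archimedean3[OF d] by blast
        have "1 \<le> real K * \<bar>?t i - ?t k\<bar>" if "K \<ge> K0" for K
        proof -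
          have "real K0 * \<bar>?t i - ?t k\<bar> \<le> real K * \<bar>?t i - ?t k\<bar>"
            using that by (intro mult_right_mono) auto
          then show ?thesis using K0 by linarith
        qed
        then show ?thesis by (auto simp: eventually_sequentially)
      qed simp
    qed
    then have "\<forall>\<^sub>F K :: nat in sequentially. K > 0 \<and> (\<forall>i\<in>I. \<forall>k\<in>I. i \<noteq> k \<longrightarrow> 1 \<le> real K * \<bar>?t i - ?t k\<bar>)"
      using eventually_gt_at_top[of "0::nat"] by eventually_elim auto
    then obtain K :: nat where K: "K > 0" "\<And>i k. i \<in> I \<Longrightarrow> k \<in> I \<Longrightarrow> i \<noteq> k \<Longrightarrow> 1 \<le> real K * \<bar>?t i - ?t k\<bar>"
      unfolding eventually_sequentially by blast
    define j where "j = (\<lambda>i\<in>I. \<lfloor>?t i * real K\<rfloor>)"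
    have "inj_on j I"
    proof (rule inj_onI, rule ccontr)
      fix i k assume ik: "i \<in> I" "k \<in> I" "j i = j k" "i \<noteq> k"
      then have "\<lfloor>?t i * real K\<rfloor> = \<lfloor>?t k * real K\<rfloor>" by (simp add: j_def)
      then have "\<bar>?t i * real K - ?t k * real K\<bar> < 1" by linarith
      also have "?t i * real K - ?t k * real K = (?t i - ?t k) * real K" by (simp add: algebra_simps)
      finally show False using K(2)[OF ik(1,2,4)] by (simp add: abs_mult mult.commute)
    qed
    moreover have "p i \<omega> \<in> D K j i" if "i \<in> I" for i
    proof -
      have "of_int (j i) \<le> ?t i * real K" "?t i * real K < of_int (j i) + 1"
        using that by (simp_all add: j_def)
      then show ?thesis using that K(1) by (cases "p i \<omega>") (simp add: D_def field_simps)
    qed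
    moreover have Kj: "(K, j) \<in> UNIV \<times> PiE I (\<lambda>_. UNIV)" by (simp add: j_def)
    ultimately show ?case
      using bspec[OF elim(1) Kj] K(1) unfolding fst_conv snd_conv by blast
  qed
qed

end

section \<open>Isolated heavy points\<close>

text \<open>The half of the second Borel--Cantelli lemma needed here: infinitely many independent trials with
  the same probability of success do not all fail.\<close>

lemma (in prob_space) AE_ex_indep:
  assumes X: "indep_vars N X (UNIV :: 'i set)" and A: "\<And>i. A i \<in> sets (N i)"
    and q: "q > 0" "\<And>i. i \<in> S \<Longrightarrow> prob (X i -` A i \<inter> space M) = q" and S: "infinite S"
  shows "AE \<omega> in M. \<exists>i\<in>S. X i \<omega> \<in> A i"
proof -
  have rv [measurable]: "X i \<in> measurable M (N i)" for i using X by (simp add: indep_vars_def)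
  obtain S' where S': "S' \<subseteq> S" "countable S'" "infinite S'"
    using infinite_countable_subset'[OF S] by (metis countable_subset)
  define E where "E = {\<omega> \<in> space M. \<forall>i\<in>S'. X i \<omega> \<notin> A i}"
  have E: "E = (\<Inter>i\<in>S'. X i -` (space (N i) - A i) \<inter> space M)"
    using S'(3) measurable_space[OF rv] unfolding E_def by (cases "S' = {}") auto
  have Em: "E \<in> events"
    unfolding E using S'(2,3) A by (intro sets.countable_INT') auto
  have bound: "prob E \<le> (1 - q) ^ k" for k
  proof -
    obtain F where F: "F \<subseteq> S'" "finite F" "card F = k"
      using infinite_arbitrarily_large[OF S'(3)] by metis
    show ?thesis
    proof (cases "F = {}")
      case False
      have "prob E \<le> prob (\<Inter>i\<in>F. X i -` (space (N i) - A i) \<inter> space M)"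
        unfolding E using F False A by (intro finite_measure_mono sets.finite_INT) auto
      also have "\<dots> = (\<Prod>i\<in>F. prob (X i -` (space (N i) - A i) \<inter> space M))"
        using F False A by (intro indep_varsD[OF X]) auto
      also have "\<dots> = (\<Prod>i\<in>F. 1 - q)"
      proof (rule prod.cong)
        fix i assume i: "i \<in> F"
        have "X i -` (space (N i) - A i) \<inter> space M = space M - (X i -` A i \<inter> space M)"
          using measurable_space[OF rv] by auto
        then show "prob (X i -` (space (N i) - A i) \<inter> space M) = 1 - q"
          using q(2)[of i] i F S' A by (simp add: prob_compl subset_eq)
      qed simp
      finally show ?thesis using F by simp
    qed (use F in simp)
  qed
  obtain i0 where i0: "i0 \<in> S'" using S'(3) by (metis all_not_in_conv finite.emptyI)
  have "q \<le> 1" using q(2)[of i0] i0 S'(1) prob_le_1[of "X i0 -` A i0 \<inter> space M"] by auto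
  then have "(\<lambda>k. (1 - q) ^ k) \<longlonglongrightarrow> 0" using q by (intro LIMSEQ_realpow_zero) auto
  then have "prob E \<le> 0" by (rule LIMSEQ_le_const) (use bound in blast)
  then have "prob E = 0" by (simp add: measure_le_0_iff)
  then have "AE \<omega> in M. \<omega> \<notin> E" using Em by (intro AE_not_in) (simp add: null_sets_def emeasure_eq_measure)
  then show ?thesis using AE_space by eventually_elim (use S'(1) in \<open>auto simp: E_def\<close>)
qed

text \<open>Time is divided into blocks of length \<open>4 * M\<close>. A point in the middle half of a block
  has distance at least \<open>M\<close> from the ends of the block.\<close>

definition block :: "real \<Rightarrow> int \<Rightarrow> (real \<times> torus) set" where
  "block M j = {4 * M * of_int j ..< 4 * M * of_int j + 4 * M} \<times> UNIV"

definition mid_block :: "real \<Rightarrow> int \<Rightarrow> (real \<times> torus) set" where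
  "mid_block M j = {4 * M * of_int j + M ..< 4 * M * of_int j + 3 * M} \<times> UNIV"

definition lone_point :: "real \<Rightarrow> int \<Rightarrow> (nat \<Rightarrow> real \<times> torus) \<Rightarrow> nat \<Rightarrow> bool" where
  "lone_point M j z n \<longleftrightarrow> z n \<in> mid_block M j \<and> (\<forall>k. k \<noteq> n \<longrightarrow> z k \<notin> block M j)"

lemma mid_block_subset: "M > 0 \<Longrightarrow> mid_block M j \<subseteq> block M j"
  by (auto simp: mid_block_def block_def)

lemma block_borel [measurable]: "block M j \<in> sets borel" "mid_block M j \<in> sets borel"
  by (simp_all add: block_def mid_block_def)

lemma block_disjoint:
  assumes M: "M > 0" and z: "z \<in> block M i" "z \<in> block M j"
  shows "i = j"
proof -
  have "\<lfloor>fst z / (4 * M)\<rfloor> = k" if "z \<in> block M k" for k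
    using that M by (intro floor_unique) (auto simp: block_def field_simps)
  then show ?thesis using z by metis
qed

lemma block_volume:
  assumes M: "M > 0"
  shows "measure cylinder_lebesgue (mid_block M j) = 2 * M" "emeasure cylinder_lebesgue (mid_block M j) < \<infinity>"
    "measure cylinder_lebesgue (block M j - mid_block M j) = 2 * M"
    "emeasure cylinder_lebesgue (block M j - mid_block M j) < \<infinity>"
proof -
  show m: "measure cylinder_lebesgue (mid_block M j) = 2 * M"
    unfolding mid_block_def using M by (subst cylinder_slice_volume) auto
  have b: "measure cylinder_lebesgue (block M j) = 4 * M"
    unfolding block_def using M by (subst cylinder_slice_volume) auto
  show fm: "emeasure cylinder_lebesgue (mid_block M j) < \<infinity>" unfolding mid_block_def by (rule cylinder_slice_finite)
  have fb: "emeasure cylinder_lebesgue (block M j) < \<infinity>" unfolding block_def by (rule cylinder_slice_finite)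
  show "measure cylinder_lebesgue (block M j - mid_block M j) = 2 * M"
    using fb mid_block_subset[OF M] m b by (subst measure_Diff) (auto simp: sets_cylinder_lebesgue)
  have "emeasure cylinder_lebesgue (block M j - mid_block M j) \<le> emeasure cylinder_lebesgue (block M j)"
    by (intro emeasure_mono) (auto simp: sets_cylinder_lebesgue)
  then show "emeasure cylinder_lebesgue (block M j - mid_block M j) < \<infinity>" using fb by simp
qed

context poisson_process
begin

lemma lone_point_of_counts:
  assumes "point_count p (mid_block M j) \<omega> = of_nat 1" "point_count p (block M j - mid_block M j) \<omega> = of_nat 0"
  shows "\<exists>n. lone_point M j (\<lambda>n. p n \<omega>) n"
proof -
  have "\<exists>n. {n. p n \<omega> \<in> mid_block M j} = {n}"
  proof -
    have f: "finite {n. p n \<omega> \<in> mid_block M j}"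
      using assms(1) by (rule contrapos_pp) (simp add: point_count_def)
    then have "card {n. p n \<omega> \<in> mid_block M j} = 1"
      using assms(1) by (simp add: point_count_def emeasure_count_space)
    then show ?thesis by (auto simp: card_Suc_eq)
  qed
  then obtain n where n: "{n. p n \<omega> \<in> mid_block M j} = {n}" by blast
  have "{n. p n \<omega> \<in> block M j - mid_block M j} = {}"
    using assms(2) by (simp add: point_count_def emeasure_count_space_eq_0)
  then show ?thesis using n by (intro exI[of _ n]) (auto simp: lone_point_def)
qed

text \<open>The counts in the middle parts and in the rests of different blocks are independent. They are
  numbered alternately by the naturals, and the trial for the block \<open>e i\<close> uses the counts
  \<open>2 * i\<close> and \<open>2 * i + 1\<close>.\<close>

lemma AE_ex_lone_point:
  assumes M: "M > 0" and e: "inj (e :: nat \<Rightarrow> int)"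
  shows "AE \<omega> in P. \<exists>i. \<exists>n. lone_point M (e i) (\<lambda>n. p n \<omega>) n"
proof -
  define B where "B = (\<lambda>k. if even k then mid_block M (e (k div 2)) else block M (e (k div 2)) - mid_block M (e (k div 2)))"
  have Bm: "B k \<in> sets borel" for k by (simp add: B_def)
  have Bf: "emeasure cylinder_lebesgue (B k) < \<infinity>" for k using block_volume[OF M] by (simp add: B_def)
  have Bsub: "B k \<subseteq> block M (e (k div 2))" for k using mid_block_subset[OF M] by (auto simp: B_def)
  have Bd: "disjoint_family B"
  proof (rule ccontr)
    assume "\<not> disjoint_family B"
    then obtain k l z where z: "k \<noteq> l" "z \<in> B k" "z \<in> B l" by (auto simp: disjoint_family_on_def)
    then have "e (k div 2) = e (l div 2)" using Bsub block_disjoint[OF M] by blast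
    then have "k div 2 = l div 2" using e by (auto dest: injD)
    moreover from this have "even k = even l" using z(2,3) by (auto simp: B_def split: if_splits)
    ultimately show False using z(1) by (metis div_mult_mod_eq even_iff_mod_2_eq_zero not_mod_2_eq_1_eq_0)
  qed
  define N where "N = (\<lambda>k. point_count p (B k))"
  have ind: "indep_vars (\<lambda>_. borel) N UNIV" unfolding N_def by (rule counts_indep[OF Bm Bf Bd])
  \<comment> \<open>the indices of the two counts that belong to one block\<close>
  define H where "H = (\<lambda>i::nat. {2 * i, 2 * i + 1})"
  have "disjoint_family H" unfolding disjoint_family_on_def H_def by auto
  then have ind2: "indep_vars (\<lambda>j. PiM (H j) (\<lambda>_. borel)) (\<lambda>j \<omega>. restrict (\<lambda>i. N i \<omega>) (H j)) UNIV"
    using ind by (intro indep_vars_restrict) auto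
  define A where "A = (\<lambda>i. PiE (H i) (\<lambda>k. {of_nat (if even k then 1 else 0) :: ennreal}))"
  let ?v = "lam * (2 * M)"
  have "AE \<omega> in P. \<exists>i\<in>UNIV. restrict (\<lambda>k. N k \<omega>) (H i) \<in> A i"
  proof (rule AE_ex_indep[OF ind2])
    show "A i \<in> sets (PiM (H i) (\<lambda>_. borel))" for i unfolding A_def by (intro sets_PiM_I_finite) (auto simp: H_def)
    show "?v * exp (- ?v) * exp (- ?v) > 0" using M lam_pos by simp
    show "prob ((\<lambda>\<omega>. restrict (\<lambda>k. N k \<omega>) (H i)) -` A i \<inter> space P) = ?v * exp (- ?v) * exp (- ?v)" for i
    proof -
      have "(\<lambda>\<omega>. restrict (\<lambda>k. N k \<omega>) (H i)) -` A i \<inter> space P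
          = (\<Inter>k\<in>H i. N k -` {of_nat (if even k then 1 else 0)} \<inter> space P)"
        by (auto simp: A_def H_def PiE_iff)
      also have "prob \<dots> = (\<Prod>k\<in>H i. prob (N k -` {of_nat (if even k then 1 else 0)} \<inter> space P))"
        by (rule indep_varsD[OF ind]) (auto simp: H_def)
      also have "\<dots> = prob {\<omega> \<in> space P. point_count p (B (2 * i)) \<omega> = of_nat 1} *
          prob {\<omega> \<in> space P. point_count p (B (2 * i + 1)) \<omega> = of_nat 0}"
        by (simp add: H_def N_def vimage_def Int_def conj_commute)
      also have "\<dots> = ?v * exp (- ?v) * exp (- ?v)"
        unfolding count_law[OF Bm Bf] using block_volume[OF M] by (simp add: B_def)
      finally show ?thesis .
    qed
  qed simp
  then show ?thesis
  proof eventually_elim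
    case (elim \<omega>)
    then obtain i where i: "restrict (\<lambda>k. N k \<omega>) (H i) \<in> A i" by blast
    have "N (2 * i) \<omega> = of_nat 1" "N (2 * i + 1) \<omega> = of_nat 0"
      using i by (auto simp: A_def H_def PiE_iff)
    then show ?case
      by (intro exI[of _ i] lone_point_of_counts) (simp_all add: N_def B_def)
  qed
qed

end

locale compound_poisson = poisson_process P lam p for P :: "'w measure" and lam p +
  fixes nu :: "real measure" and w :: "nat \<Rightarrow> 'w \<Rightarrow> real"
  assumes nu: "prob_space nu" "sets nu = sets borel" "AE x in nu. x > 0"
    and w_indep: "indep_vars (\<lambda>_. borel) w UNIV"
    and w_law: "distr P borel (w n) = nu"
    and pw_indep: "indep_set (sets (vimage_algebra (space P) (\<lambda>\<omega> n. p n \<omega>) (\<Pi>\<^sub>M n\<in>UNIV. borel)))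
      (sets (vimage_algebra (space P) (\<lambda>\<omega> n. w n \<omega>) (\<Pi>\<^sub>M n\<in>UNIV. borel)))"
begin

abbreviation "Sp \<equiv> PiM (UNIV :: nat set) (\<lambda>_. borel :: (real \<times> torus) measure)"
abbreviation "Sw \<equiv> PiM (UNIV :: nat set) (\<lambda>_. borel :: real measure)"
abbreviation "Lp \<equiv> distr P Sp (\<lambda>\<omega> n. p n \<omega>)"
abbreviation "Lw \<equiv> distr P Sw (\<lambda>\<omega> n. w n \<omega>)"

lemma w_measurable [measurable]: "w n \<in> borel_measurable P"
  using w_indep by (simp add: indep_vars_def)

lemma seq_measurable [measurable]: "(\<lambda>\<omega> n. p n \<omega>) \<in> P \<rightarrow>\<^sub>M Sp" "(\<lambda>\<omega> n. w n \<omega>) \<in> P \<rightarrow>\<^sub>M Sw"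
  by (auto intro!: measurable_PiM_single' simp: space_PiM)

lemma joint_law: "Lp \<Otimes>\<^sub>M Lw =
    distr P (Sp \<Otimes>\<^sub>M Sw) (\<lambda>\<omega>. ((\<lambda>n. p n \<omega>), (\<lambda>n. w n \<omega>)))"
proof (rule pair_measure_eqI)
  interpret D1: prob_space "Lp" by (rule prob_space_distr) measurable
  interpret D2: prob_space "Lw" by (rule prob_space_distr) measurable
  show "sigma_finite_measure (Lp)" "sigma_finite_measure (Lw)"
    by unfold_locales
  show "sets (Lp \<Otimes>\<^sub>M Lw) =
    sets (distr P (Sp \<Otimes>\<^sub>M Sw) (\<lambda>\<omega>. (\<lambda>n. p n \<omega>, \<lambda>n. w n \<omega>)))"
    by (simp cong: sets_pair_measure_cong)
  fix A B assume "A \<in> sets (Lp)" "B \<in> sets (Lw)"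
  then have AB [measurable]: "A \<in> sets Sp" "B \<in> sets Sw" by simp_all
  let ?X = "(\<lambda>\<omega> n. p n \<omega>) -` A \<inter> space P" and ?Y = "(\<lambda>\<omega> n. w n \<omega>) -` B \<inter> space P"
  have "prob (?X \<inter> ?Y) = prob ?X * prob ?Y"
    by (rule indep_setD[OF pw_indep]) (intro in_vimage_algebra AB)+
  moreover have "(\<lambda>\<omega>. (\<lambda>n. p n \<omega>, \<lambda>n. w n \<omega>)) -` (A \<times> B) \<inter> space P = ?X \<inter> ?Y" by auto
  ultimately show "emeasure (Lp) A * emeasure (Lw) B =
    emeasure (distr P (Sp \<Otimes>\<^sub>M Sw) (\<lambda>\<omega>. (\<lambda>n. p n \<omega>, \<lambda>n. w n \<omega>))) (A \<times> B)"
    by (simp add: emeasure_distr emeasure_eq_measure ennreal_mult)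
qed

text \<open>Points and weights have a product law, so an event may be shown to be almost sure for the random
  weights with almost every sequence of points frozen, or, in the next lemma, the other way round.\<close>

lemma AE_joint:
  assumes Q: "{x \<in> space (Sp \<Otimes>\<^sub>M Sw). Q (fst x) (snd x)} \<in> sets (Sp \<Otimes>\<^sub>M Sw)"
    and ae: "AE z in Lp. AE \<omega> in P. Q z (\<lambda>n. w n \<omega>)"
  shows "AE \<omega> in P. Q (\<lambda>n. p n \<omega>) (\<lambda>n. w n \<omega>)"
proof -
  interpret D1: prob_space "Lp" by (rule prob_space_distr) measurable
  interpret D2: prob_space "Lw" by (rule prob_space_distr) measurable
  interpret D: pair_sigma_finite "Lp" "Lw" ..
  have "AE x in Lp \<Otimes>\<^sub>M Lw. Q (fst x) (snd x)"
  proof (rule D.AE_pair_measure)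
    show "{x \<in> space (Lp \<Otimes>\<^sub>M Lw). Q (fst x) (snd x)}
       \<in> sets (Lp \<Otimes>\<^sub>M Lw)"
      using Q by (simp add: space_pair_measure cong: sets_pair_measure_cong)
    have sec: "{y \<in> space Sw. Q z y} \<in> sets Sw" if "z \<in> space Sp" for z
    proof -
      have "Pair z -` {x \<in> space (Sp \<Otimes>\<^sub>M Sw). Q (fst x) (snd x)} \<in> sets Sw" by (rule sets_Pair1[OF Q])
      also have "Pair z -` {x \<in> space (Sp \<Otimes>\<^sub>M Sw). Q (fst x) (snd x)} = {y \<in> space Sw. Q z y}"
        using that by (auto simp: space_pair_measure)
      finally show ?thesis .
    qed
    show "AE z in Lp. AE y in Lw. Q (fst (z, y)) (snd (z, y))"
      using ae AE_space
    proof eventually_elim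
      case (elim z)
      then show ?case using sec[of z] by (subst AE_distr_iff) auto
    qed
  qed
  then have "AE x in distr P (Sp \<Otimes>\<^sub>M Sw) (\<lambda>\<omega>. ((\<lambda>n. p n \<omega>), (\<lambda>n. w n \<omega>))). Q (fst x) (snd x)"
    unfolding joint_law .
  then show ?thesis using Q by (subst (asm) AE_distr_iff) auto
qed

lemma AE_joint':
  assumes Q: "{x \<in> space (Sp \<Otimes>\<^sub>M Sw). Q (fst x) (snd x)} \<in> sets (Sp \<Otimes>\<^sub>M Sw)"
    and ae: "\<And>y. AE \<omega> in P. Q (\<lambda>n. p n \<omega>) y"
  shows "AE \<omega> in P. Q (\<lambda>n. p n \<omega>) (\<lambda>n. w n \<omega>)"
proof (rule AE_joint[OF Q])
  interpret D1: prob_space "Lp" by (rule prob_space_distr) measurable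
  interpret D2: prob_space "Lw" by (rule prob_space_distr) measurable
  interpret D: pair_sigma_finite "Lp" "Lw" ..
  have sec: "{z \<in> space Sp. Q z y} \<in> sets Sp" if "y \<in> space Sw" for y
  proof -
    have "(\<lambda>z. (z, y)) -` {x \<in> space (Sp \<Otimes>\<^sub>M Sw). Q (fst x) (snd x)} \<in> sets Sp" by (rule sets_Pair2[OF Q])
    also have "(\<lambda>z. (z, y)) -` {x \<in> space (Sp \<Otimes>\<^sub>M Sw). Q (fst x) (snd x)} = {z \<in> space Sp. Q z y}"
      using that by (auto simp: space_pair_measure)
    finally show ?thesis .
  qed
  have sec': "{y \<in> space Sw. Q z y} \<in> sets Sw" if "z \<in> space Sp" for z
  proof -
    have "Pair z -` {x \<in> space (Sp \<Otimes>\<^sub>M Sw). Q (fst x) (snd x)} \<in> sets Sw" by (rule sets_Pair1[OF Q])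
    also have "Pair z -` {x \<in> space (Sp \<Otimes>\<^sub>M Sw). Q (fst x) (snd x)} = {y \<in> space Sw. Q z y}"
      using that by (auto simp: space_pair_measure)
    finally show ?thesis .
  qed
  have "AE y in Lw. AE z in Lp. Q z y"
    using AE_space
  proof eventually_elim
    case (elim y)
    then show ?case using sec[of y] ae by (subst AE_distr_iff) auto
  qed
  then have "AE z in Lp. AE y in Lw. Q z y"
    using Q by (subst D.AE_commute) (simp_all add: space_pair_measure cong: sets_pair_measure_cong)
  then show "AE z in Lp. AE \<omega> in P. Q z (\<lambda>n. w n \<omega>)"
    using AE_space
  proof eventually_elim
    case (elim z)
    then show ?case using sec'[of z] by (subst (asm) AE_distr_iff) auto
  qed
qed

lemma w_prob: "A \<in> sets borel \<Longrightarrow> prob (w n -` A \<inter> space P) = measure nu A"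
  unfolding w_law[of n, symmetric] by (simp add: measure_distr)

lemma AE_w_pos: "AE \<omega> in P. \<forall>n. w n \<omega> > 0"
proof -
  have "AE \<omega> in P. w n \<omega> > 0" for n
    using nu(3) unfolding w_law[of n, symmetric] by (subst (asm) AE_distr_iff) auto
  then show ?thesis by (simp add: AE_all_countable)
qed

lemma ex_heavy_level: "\<exists>c>0. measure nu {c<..} > 0"
proof (rule ccontr)
  interpret nu: prob_space nu by (rule nu(1))
  assume "\<not> (\<exists>c>0. measure nu {c<..} > 0)"
  then have "measure nu {1 / real (Suc n)<..} = 0" for n
    by (metis divide_pos_pos measure_nonneg less_le of_nat_0_less_iff zero_less_Suc zero_less_one)
  then have "AE x in nu. x \<notin> {1 / real (Suc n)<..}" for n
    using nu(2) by (intro AE_not_in) (simp add: null_sets_def nu.emeasure_eq_measure)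
  then have "AE x in nu. \<forall>n. x \<notin> {1 / real (Suc n)<..}" by (simp only: AE_all_countable) blast
  with nu(3) have "AE x in nu. False"
  proof eventually_elim
    case (elim x)
    then obtain n where "inverse (real (Suc n)) < x" using reals_Archimedean by blast
    then show ?case using elim(2) by (auto simp: inverse_eq_divide)
  qed
  then show False by simp
qed

text \<open>Almost surely infinitely many blocks have a lone point. With the points frozen, these lone points
  are infinitely many fixed indices, and one of them gets a heavy weight.\<close>

lemma AE_ex_heavy_lone_point:
  assumes M: "M > 0" and e: "inj (e :: nat \<Rightarrow> int)" and c: "measure nu {c<..} > 0"
  shows "AE \<omega> in P. \<exists>i n. lone_point M (e i) (\<lambda>n. p n \<omega>) n \<and> w n \<omega> > c"
proof (rule AE_joint[where Q="\<lambda>z y. \<exists>i n. lone_point M (e i) z n \<and> y n > c"])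
  show "{x \<in> space (Sp \<Otimes>\<^sub>M Sw). \<exists>i n. lone_point M (e i) (fst x) n \<and> c < snd x n} \<in> sets (Sp \<Otimes>\<^sub>M Sw)"
    unfolding lone_point_def by measurable
  have "AE \<omega> in P. \<forall>J. \<exists>i. \<exists>n. lone_point M (e (i + J)) (\<lambda>n. p n \<omega>) n"
  proof (subst AE_all_countable, intro allI)
    fix J
    have "inj (\<lambda>i. e (i + J))" using injD[OF e] by (intro injI) (metis add_right_cancel)
    from AE_ex_lone_point[OF M this] show "AE \<omega> in P. \<exists>i. \<exists>n. lone_point M (e (i + J)) (\<lambda>n. p n \<omega>) n" .
  qed
  moreover have "{z \<in> space Sp. \<forall>J. \<exists>i. \<exists>n. lone_point M (e (i + J)) z n} \<in> sets Sp"
    unfolding lone_point_def by measurable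
  ultimately have "AE z in Lp. \<forall>J. \<exists>i. \<exists>n. lone_point M (e (i + J)) z n"
    by (subst AE_distr_iff) auto
  then show "AE z in Lp. AE \<omega> in P. \<exists>i n. lone_point M (e i) z n \<and> w n \<omega> > c"
  proof eventually_elim
    case (elim z)
    define S where "S = {n. \<exists>i. lone_point M (e i) z n}"
    have "infinite S"
    proof
      assume fin: "finite S"
      define h where "h = (\<lambda>n. SOME i. lone_point M (e i) z n)"
      obtain J where J: "\<And>n. n \<in> S \<Longrightarrow> h n < J"
        using finite_nat_set_iff_bounded[of "h ` S"] fin by auto
      obtain i n where n: "lone_point M (e (i + J)) z n" using elim by blast
      then have "lone_point M (e (h n)) z n" unfolding h_def by (rule someI)
      then have "e (h n) = e (i + J)"
        using n mid_block_subset[OF M] block_disjoint[OF M, of "z n"] unfolding lone_point_def by blast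
      then have "h n = i + J" using e by (auto dest: injD)
      moreover have "n \<in> S" using n by (auto simp: S_def)
      ultimately show False using J[of n] by simp
    qed
    then have "AE \<omega> in P. \<exists>n\<in>S. w n \<omega> \<in> {c<..}"
      using c by (intro AE_ex_indep[OF w_indep, of _ "measure nu {c<..}"]) (auto simp: w_prob)
    then show ?case by eventually_elim (auto simp: S_def)
  qed
qed

lemma AE_heavy_lone_points_unbounded:
  assumes M: "M > 0" and c: "measure nu {c<..} > 0"
  shows "AE \<omega> in P. \<forall>J::int. (\<exists>j\<ge>J. \<exists>n. lone_point M j (\<lambda>n. p n \<omega>) n \<and> w n \<omega> > c) \<and>
     (\<exists>j\<le>J. \<exists>n. lone_point M j (\<lambda>n. p n \<omega>) n \<and> w n \<omega> > c)"
proof (subst AE_all_countable, intro allI)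
  fix J :: int
  have i: "inj (\<lambda>i::nat. J + int i)" "inj (\<lambda>i::nat. J - int i)" by (auto simp: inj_def)
  from AE_ex_heavy_lone_point[OF M i(1) c] AE_ex_heavy_lone_point[OF M i(2) c]
  show "AE \<omega> in P. (\<exists>j\<ge>J. \<exists>n. lone_point M j (\<lambda>n. p n \<omega>) n \<and> w n \<omega> > c) \<and>
     (\<exists>j\<le>J. \<exists>n. lone_point M j (\<lambda>n. p n \<omega>) n \<and> w n \<omega> > c)"
  proof eventually_elim
    case (elim \<omega>)
    then obtain i1 n1 i2 n2 where
      "lone_point M (J + int i1) (\<lambda>n. p n \<omega>) n1" "w n1 \<omega> > c"
      "lone_point M (J - int i2) (\<lambda>n. p n \<omega>) n2" "w n2 \<omega> > c" by blast
    then show ?case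
      by (intro conjI exI[of _ "J + int i1"] exI[of _ "J - int i2"] exI[of _ n1] exI[of _ n2]) auto
  qed
qed

end

section \<open>From the point process to regenerating configurations\<close>

text \<open>A locally finite sum of point masses at different points, which is what the measure is almost
  surely.\<close>

locale point_masses =
  fixes \<mu> :: "(real \<times> torus) measure" and z :: "nat \<Rightarrow> real \<times> torus" and m :: "nat \<Rightarrow> real"
  assumes sets_\<mu>: "sets \<mu> = sets borel"
    and emeasure_\<mu>: "A \<in> sets borel \<Longrightarrow> emeasure \<mu> A = (\<Sum>n. ennreal (m n) * indicator A (z n))"
    and m_pos: "m n > 0"
    and z_inj: "inj z"
    and locally_finite: "finite {n. z n \<in> {- real R ..< real R} \<times> UNIV}"
begin

lemma emeasure_atom: "emeasure \<mu> {z n} = ennreal (m n)"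
proof -
  have "emeasure \<mu> {z n} = (\<Sum>k. ennreal (m k) * indicator {z n} (z k))" by (rule emeasure_\<mu>) simp
  also have "\<dots> = (\<Sum>k\<in>{n}. ennreal (m k) * indicator {z n} (z k))"
    using z_inj by (intro suminf_finite) (auto simp: indicator_def dest: injD)
  finally show ?thesis by simp
qed

lemma measure_atom: "measure \<mu> {z n} = m n"
  using m_pos[of n] by (simp add: measure_def emeasure_atom)

lemma emeasure_off_range:
  assumes "A \<in> sets borel" "A \<inter> range z = {}"
  shows "emeasure \<mu> A = 0"
proof -
  have "indicator A (z n) = (0::ennreal)" for n using assms(2) by (auto simp: indicator_def)
  then show ?thesis by (simp only: emeasure_\<mu>[OF assms(1)] mult_zero_right suminf_zero)
qed

lemma emeasure_non_atom: "q \<notin> range z \<Longrightarrow> emeasure \<mu> {q} = 0"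
  by (rule emeasure_off_range) auto

lemma finite_near: "\<exists>U. open U \<and> q \<in> U \<and> finite {n. z n \<in> U}"
proof -
  obtain R :: nat where R: "\<bar>fst q\<bar> < real R" using reals_Archimedean2 by blast
  let ?U = "{- real R <..< real R} \<times> (UNIV :: torus set)"
  have "open ?U" by (intro open_Times) auto
  moreover have "q \<in> ?U" using R by (cases q) auto
  moreover have "finite {n. z n \<in> ?U}" by (rule finite_subset[OF _ locally_finite[of R]]) auto
  ultimately show ?thesis by blast
qed

lemma not_islimpt_range: "\<not> q islimpt range z"
proof
  assume q: "q islimpt range z"
  obtain U where U: "open U" "q \<in> U" "finite {n. z n \<in> U}" using finite_near by blast
  have "range z \<inter> U = z ` {n. z n \<in> U}" by auto
  then have "finite (range z \<inter> U)" using U(3) by simp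
  moreover have "q islimpt (range z \<inter> U)"
    unfolding islimpt_def
  proof (intro allI impI)
    fix T assume T: "q \<in> T" "open T"
    then have "q \<in> T \<inter> U" "open (T \<inter> U)" using U by auto
    then show "\<exists>y\<in>range z \<inter> U. y \<in> T \<and> y \<noteq> q"
      using q unfolding islimpt_def by blast
  qed
  ultimately show False by (simp add: islimpt_finite)
qed

lemma supp_eq: "supp \<mu> = range z"
proof (intro equalityI subsetI)
  fix q assume "q \<in> range z"
  then obtain n where n: "q = z n" by blast
  show "q \<in> supp \<mu>" unfolding supp_def
  proof (intro CollectI allI impI)
    fix U assume U: "open U" "q \<in> U"
    have "0 < emeasure \<mu> {q}" using m_pos[of n] by (simp add: n emeasure_atom)
    also have "\<dots> \<le> emeasure \<mu> U" using U by (intro emeasure_mono) (auto simp: sets_\<mu>)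
    finally show "0 < emeasure \<mu> U" .
  qed
next
  fix q assume q: "q \<in> supp \<mu>"
  show "q \<in> range z"
  proof (rule ccontr)
    assume "q \<notin> range z"
    obtain U where U: "open U" "q \<in> U" "finite {n. z n \<in> U}" using finite_near by blast
    have "\<not> q islimpt range z" by (rule not_islimpt_range)
    then obtain T where T: "open T" "q \<in> T" "\<forall>y\<in>range z. y \<in> T \<longrightarrow> y = q" unfolding islimpt_def by blast
    then have "T \<inter> range z = {}" using \<open>q \<notin> range z\<close> by blast
    then have "emeasure \<mu> T = 0" using T(1) by (intro emeasure_off_range) auto
    then show False using q T(1,2) unfolding supp_def by auto
  qed
qed

lemma in_Omega: "\<mu> \<in> Omega"
proof -
  have "purely_atomic \<mu>" unfolding purely_atomic_def
  proof
    fix A assume "A \<in> sets \<mu>"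
    then have A: "A \<in> sets borel" by (simp add: sets_\<mu>)
    have "emeasure \<mu> A = (\<integral>\<^sup>+ n. ennreal (m n) * indicator A (z n) \<partial>count_space UNIV)"
      by (simp add: emeasure_\<mu>[OF A] nn_integral_count_space_nat)
    also have "\<dots> = (\<integral>\<^sup>+ n. emeasure \<mu> {z n} * indicator A (z n) \<partial>count_space UNIV)"
      by (simp add: emeasure_atom)
    also have "\<dots> = (\<integral>\<^sup>+ q. emeasure \<mu> {q} * indicator A q \<partial>count_space (range z))"
      using z_inj by (intro nn_integral_bij_count_space) (auto simp: bij_betw_def)
    also have "\<dots> = (\<integral>\<^sup>+ q. emeasure \<mu> {q} * indicator A q \<partial>count_space UNIV)"
    proof (subst nn_integral_count_space_indicator)
      show "(\<integral>\<^sup>+ q. emeasure \<mu> {q} * indicator A q * indicator (range z) q \<partial>count_space UNIV) =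
        (\<integral>\<^sup>+ q. emeasure \<mu> {q} * indicator A q \<partial>count_space UNIV)"
      proof (rule nn_integral_cong)
        fix q show "emeasure \<mu> {q} * indicator A q * indicator (range z) q = emeasure \<mu> {q} * indicator A q"
          using emeasure_non_atom[of q] by (cases "q \<in> range z") auto
      qed
    qed simp
    finally show "emeasure \<mu> A = (\<integral>\<^sup>+ q\<in>A. emeasure \<mu> {q} \<partial>count_space UNIV)" .
  qed
  moreover have "emeasure \<mu> {q} < \<infinity>" for q
    using emeasure_non_atom[of q] by (cases "q \<in> range z") (auto simp: emeasure_atom)
  ultimately show ?thesis
    unfolding Omega_def using sets_\<mu> not_islimpt_range by (simp add: supp_eq)
qed

end

lemma ex_greatest_int:
  assumes "P (j0 :: int)" and b: "\<And>j. P j \<Longrightarrow> j \<le> b"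
  shows "\<exists>j. P j \<and> (\<forall>i. P i \<longrightarrow> i \<le> j)"
proof -
  let ?S = "{j. P j \<and> j0 \<le> j}"
  have "?S \<subseteq> {j0..b}" using b by auto
  then have fin: "finite ?S" by (rule finite_subset) simp
  moreover have "?S \<noteq> {}" using assms(1) by auto
  ultimately have M: "Max ?S \<in> ?S" by (rule Max_in)
  have "i \<le> Max ?S" if "P i" for i
  proof (cases "j0 \<le> i")
    case True
    then show ?thesis using that by (intro Max_ge fin) auto
  next
    case False
    then show ?thesis using M by auto
  qed
  with M show ?thesis by blast
qed

text \<open>As \<open>s t\<close> take the time of the heavy lone point of the last suitable block that ends
  by time \<open>t\<close>. Suitable blocks arbitrarily far in the past make it exist, those in the future
  make it tend to infinity.\<close>

lemma Omega1_of_heavy_lone_points: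
  assumes pm: "point_masses \<mu> z m" and M: "M > 0"
    and up: "\<And>J. \<exists>j\<ge>J. \<exists>n. lone_point M j z n \<and> m n > 1 / (4 * M)"
    and down: "\<And>J. \<exists>j\<le>J. \<exists>n. lone_point M j z n \<and> m n > 1 / (4 * M)"
  shows "\<mu> \<in> Omega1"
proof -
  interpret point_masses \<mu> z m by fact
  define G where "G = (\<lambda>j. \<exists>n. lone_point M j z n \<and> m n > 1 / (4 * M))"
  have "\<exists>j. (G j \<and> 4 * M * (of_int j + 1) \<le> t) \<and> (\<forall>i. G i \<and> 4 * M * (of_int i + 1) \<le> t \<longrightarrow> i \<le> j)" for t
  proof -
    obtain j0 where j0: "j0 \<le> \<lfloor>t / (4 * M)\<rfloor> - 1" "G j0" using down unfolding G_def by blast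
    show ?thesis
    proof (rule ex_greatest_int[where ?j0.0 = j0 and b = "\<lfloor>t / (4 * M)\<rfloor>"])
      have "of_int j0 + 1 \<le> t / (4 * M)" using j0(1) by linarith
      then show "G j0 \<and> 4 * M * (of_int j0 + 1) \<le> t" using j0 M by (simp add: field_simps)
      fix j assume "G j \<and> 4 * M * (of_int j + 1) \<le> t"
      then have "of_int j + 1 \<le> t / (4 * M)" using M by (simp add: field_simps)
      then show "j \<le> \<lfloor>t / (4 * M)\<rfloor>" by linarith
    qed
  qed
  then obtain j where j: "\<And>t. G (j t)" "\<And>t. 4 * M * (of_int (j t) + 1) \<le> t"
    "\<And>t i. G i \<Longrightarrow> 4 * M * (of_int i + 1) \<le> t \<Longrightarrow> i \<le> j t" by metis
  obtain n where n: "\<And>t. lone_point M (j t) z (n t)" "\<And>t. m (n t) > 1 / (4 * M)"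
    using j(1) unfolding G_def by metis
  define s where "s = (\<lambda>t. fst (z (n t)))"
  have s: "4 * M * of_int (j t) + M \<le> s t" "s t < 4 * M * of_int (j t) + 3 * M" for t
    using n(1)[of t] by (cases "z (n t)"; auto simp: lone_point_def mid_block_def s_def)+
  have "s t \<le> t - M" for t using s(2)[of t] j(2)[of t] by (simp add: algebra_simps)
  moreover have "\<exists>y. supp \<mu> \<inter> ({s t - M .. s t + M} \<times> UNIV) = {(s t, y)} \<and> measure \<mu> {(s t, y)} > 1 / (4 * M)" for t
  proof (intro exI[of _ "snd (z (n t))"] conjI)
    have zt: "z (n t) = (s t, snd (z (n t)))" by (simp add: s_def)
    show "measure \<mu> {(s t, snd (z (n t)))} > 1 / (4 * M)"
      using n(2)[of t] measure_atom[of "n t"] unfolding zt[symmetric] by simp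
    have "k = n t" if "z k \<in> {s t - M .. s t + M} \<times> UNIV" for k
    proof -
      have "z k \<in> block M (j t)" using that s[of t] by (auto simp: block_def)
      then show ?thesis using n(1)[of t] unfolding lone_point_def by blast
    qed
    moreover have "z (n t) \<in> {s t - M .. s t + M} \<times> UNIV"
      using M by (subst zt) auto
    ultimately show "supp \<mu> \<inter> ({s t - M .. s t + M} \<times> UNIV) = {(s t, snd (z (n t)))}"
    proof -
      assume lone: "\<And>k. z k \<in> {s t - M..s t + M} \<times> UNIV \<Longrightarrow> k = n t" and mem: "z (n t) \<in> {s t - M..s t + M} \<times> UNIV"
      have "range z \<inter> {s t - M..s t + M} \<times> UNIV = {z (n t)}"
      proof (intro equalityI subsetI)
        fix q assume q: "q \<in> range z \<inter> {s t - M..s t + M} \<times> UNIV"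
        then obtain k where k: "q = z k" by blast
        have "z k \<in> {s t - M..s t + M} \<times> UNIV" using q unfolding k by (rule IntD2)
        then have "k = n t" by (rule lone)
        then show "q \<in> {z (n t)}" by (simp add: k)
      qed (use mem in blast)
      then show ?thesis unfolding supp_eq zt[symmetric] .
    qed
  qed
  moreover have "filterlim s at_top at_top"
    unfolding filterlim_at_top
  proof
    fix Z :: real
    obtain i where i: "i \<ge> \<lceil>Z / (4 * M)\<rceil>" "G i" using up unfolding G_def by blast
    have "Z / (4 * M) \<le> of_int i" using i(1) by linarith
    then have Z: "Z \<le> 4 * M * of_int i" using M by (simp add: field_simps)
    have "Z \<le> s t" if "t \<ge> 4 * M * (of_int i + 1)" for t
    proof -
      have "i \<le> j t" by (rule j(3)[OF i(2) that])
      then have "4 * M * of_int i \<le> 4 * M * of_int (j t)" using M by (intro mult_left_mono) auto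
      then show ?thesis using Z s(1)[of t] M by linarith
    qed
    then show "\<forall>\<^sub>F t in at_top. Z \<le> s t" using eventually_at_top_linorder by blast
  qed
  ultimately show ?thesis
    unfolding Omega1_def using in_Omega M by blast
qed

context compound_poisson
begin

lemma AE_locally_finite: "AE \<omega> in P. \<forall>R::nat. finite {n. p n \<omega> \<in> {- real R ..< real R} \<times> UNIV}"
proof (subst AE_all_countable, intro allI)
  fix R :: nat
  let ?B = "{- real R ..< real R} \<times> (UNIV :: torus set)"
  have "?B \<in> sets borel" by simp
  from AE_count_finite[OF this cylinder_slice_finite]
  show "AE \<omega> in P. finite {n. p n \<omega> \<in> ?B}"
  proof eventually_elim
    case (elim \<omega>)
    then have "point_count p ?B \<omega> \<noteq> \<infinity>" by auto
    then show ?case by (rule contrapos_np) (simp add: point_count_def)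
  qed
qed

lemma AE_point_masses:
  assumes "AE \<omega> in P. sets (\<mu> \<omega>) = sets borel \<and>
     (\<forall>A\<in>sets borel. emeasure (\<mu> \<omega>) A = (\<Sum>n. ennreal (w n \<omega>) * indicator A (p n \<omega>)))"
  shows "AE \<omega> in P. point_masses (\<mu> \<omega>) (\<lambda>n. p n \<omega>) (\<lambda>n. w n \<omega>)"
proof -
  have "AE \<omega> in P. \<forall>a. \<forall>b. a \<noteq> b \<longrightarrow> fst (p a \<omega>) \<noteq> fst (p b \<omega>)"
    using AE_distinct_times by (subst AE_all_countable, intro allI, subst AE_all_countable) auto
  then show ?thesis using assms AE_locally_finite AE_w_pos
  proof eventually_elim
    case (elim \<omega>)
    have "inj (\<lambda>n. p n \<omega>)" using elim(1) by (intro injI) metis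
    with elim show ?case by unfold_locales auto
  qed
qed

lemma AE_Omega1:
  assumes "AE \<omega> in P. sets (\<mu> \<omega>) = sets borel \<and>
     (\<forall>A\<in>sets borel. emeasure (\<mu> \<omega>) A = (\<Sum>n. ennreal (w n \<omega>) * indicator A (p n \<omega>)))"
  shows "AE \<omega> in P. \<mu> \<omega> \<in> Omega1"
proof -
  obtain c where c: "c > 0" "measure nu {c<..} > 0" using ex_heavy_level by blast
  \<comment> \<open>chosen such that the level \<open>c\<close> is the threshold in \<^const>\<open>Omega1\<close>\<close>
  define M where "M = 1 / (4 * c)"
  have M: "M > 0" "1 / (4 * M) = c" using c by (simp_all add: M_def)
  show ?thesis
    using AE_point_masses[OF assms] AE_heavy_lone_points_unbounded[OF M(1) c(2)]
  proof eventually_elim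
    case (elim \<omega>)
    then show ?case by (intro Omega1_of_heavy_lone_points[OF elim(1) M(1)]) (auto simp: M(2))
  qed
qed

end

section \<open>Absence of resonances\<close>

text \<open>A point of the universal cover is addressed by an index of the enumeration and an integer
  translation. There are countably many addresses, and they do not depend on the random configuration.\<close>

definition coord_lift :: "(nat \<Rightarrow> real \<times> torus) \<Rightarrow> nat \<times> int \<Rightarrow> real \<times> real" where
  "coord_lift z a = (fst (z (fst a)), torus_coord (snd (z (fst a))) + of_int (snd a))"

text \<open>The polygon actions \<open>chain_action m 0\<close> with the vertices given by their addresses and
  the masses by their indices.\<close>

fun index_action :: "(nat \<Rightarrow> real) \<Rightarrow> (nat \<Rightarrow> real \<times> torus) \<Rightarrow> (nat \<times> int) list \<Rightarrow> real" where
  "index_action y z (a # b # l) =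
     ((snd (coord_lift z b) - snd (coord_lift z a)) / (fst (coord_lift z b) - fst (coord_lift z a)))\<^sup>2 *
       (fst (coord_lift z b) - fst (coord_lift z a)) / 2 - y (fst a) + index_action y z (b # l)"
| "index_action y z _ = 0"

lemma index_action_snoc:
  "l \<noteq> [] \<Longrightarrow> index_action y z (l @ [b]) = index_action y z l +
     ((snd (coord_lift z b) - snd (coord_lift z (last l))) / (fst (coord_lift z b) - fst (coord_lift z (last l))))\<^sup>2 *
       (fst (coord_lift z b) - fst (coord_lift z (last l))) / 2 - y (fst (last l))"
proof (induction l rule: induct_list012)
  case (3 a c l)
  then show ?case by simp
qed auto

lemma index_action_cong:
  "(\<And>a. a \<in> set l \<Longrightarrow> z (fst a) = z' (fst a)) \<Longrightarrow> index_action y z l = index_action y z' l"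
proof (induction l rule: induct_list012)
  case (3 a c l)
  have "coord_lift z a = coord_lift z' a" "coord_lift z c = coord_lift z' c"
    using 3(3) by (simp_all add: coord_lift_def)
  then show ?case using 3 by simp
qed auto

lemma chain_action_index:
  assumes "\<And>a. m (coord_lift z a) = y (fst a)"
  shows "chain_action m 0 (map (coord_lift z) l) = index_action y z l"
  by (induction l rule: induct_list012) (auto simp: assms)

lemma measurable_fst_snd_cylinder [measurable]:
  "(fst :: real \<times> torus \<Rightarrow> real) \<in> borel_measurable borel"
  "(snd :: real \<times> torus \<Rightarrow> torus) \<in> borel_measurable borel"
  by (auto intro!: borel_measurable_continuous_onI continuous_on_fst continuous_on_snd continuous_on_id)

lemma measurable_coord_lift:
  assumes "(\<lambda>x. Z x (fst a)) \<in> borel_measurable N"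
  shows "(\<lambda>x. fst (coord_lift (Z x) a)) \<in> borel_measurable N" "(\<lambda>x. snd (coord_lift (Z x) a)) \<in> borel_measurable N"
proof -
  note assms[measurable]
  show "(\<lambda>x. fst (coord_lift (Z x) a)) \<in> borel_measurable N" "(\<lambda>x. snd (coord_lift (Z x) a)) \<in> borel_measurable N"
    unfolding coord_lift_def by simp_all
qed

lemma measurable_index_action:
  assumes "\<And>a. a \<in> set l \<Longrightarrow> (\<lambda>x. Z x (fst a)) \<in> borel_measurable N"
    and "\<And>a. a \<in> set l \<Longrightarrow> (\<lambda>x. Y x (fst a)) \<in> borel_measurable N"
  shows "(\<lambda>x. index_action (Y x) (Z x) l) \<in> borel_measurable N"
  using assms
proof (induction l rule: induct_list012)
  case (3 a b l)
  have c: "(\<lambda>x. fst (coord_lift (Z x) q)) \<in> borel_measurable N" "(\<lambda>x. snd (coord_lift (Z x) q)) \<in> borel_measurable N"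
    if "q \<in> set (a # b # l)" for q using 3(3)[OF that] by (rule measurable_coord_lift)+
  have [measurable]: "(\<lambda>x. fst (coord_lift (Z x) a)) \<in> borel_measurable N" "(\<lambda>x. snd (coord_lift (Z x) a)) \<in> borel_measurable N"
    "(\<lambda>x. fst (coord_lift (Z x) b)) \<in> borel_measurable N" "(\<lambda>x. snd (coord_lift (Z x) b)) \<in> borel_measurable N"
    "(\<lambda>x. Y x (fst a)) \<in> borel_measurable N"
    by (rule c, simp)+ (rule 3(4), simp)
  have [measurable]: "(\<lambda>x. index_action (Y x) (Z x) (b # l)) \<in> borel_measurable N" using 3 by simp
  show ?case by simp
qed auto

text \<open>The two quadratic functions of \<open>x\<close> are the energies of the last segments of two
  polygons that end at \<open>(t, x)\<close>. Equal leading coefficients force \<open>s1 = s2\<close>, and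
  then equal linear coefficients force \<open>a1 = a2\<close>.\<close>

lemma finite_quadratic_coincidences:
  fixes a1 a2 s1 s2 t c \<kappa> :: real
  assumes s: "s1 < t" "s2 < t" and ne: "(s1, a1) \<noteq> (s2, a2)" and \<kappa>: "\<kappa> \<noteq> 0"
  shows "finite {x. \<kappa> * (((x - a1) / (t - s1))\<^sup>2 * (t - s1) / 2 - ((x - a2) / (t - s2))\<^sup>2 * (t - s2) / 2) = c}"
proof -
  define b1 b2 where "b1 = 1 / (2 * (t - s1))" and "b2 = 1 / (2 * (t - s2))"
  have b: "b1 > 0" "b2 > 0" using s by (simp_all add: b1_def b2_def)
  have sq: "((x - a) / d)\<^sup>2 * d / 2 = (x - a)\<^sup>2 * (1 / (2 * d))" if "d > 0" for x a d :: real
    using that by (simp add: power2_eq_square field_simps)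
  define q where "q = [:\<kappa> * (b1 * a1\<^sup>2 - b2 * a2\<^sup>2) - c, -2 * \<kappa> * (b1 * a1 - b2 * a2), \<kappa> * (b1 - b2):]"
  have "q \<noteq> 0"
  proof
    assume "q = 0"
    then have "\<kappa> * (b1 - b2) = 0" "\<kappa> * (b1 * a1 - b2 * a2) = 0" by (simp_all add: q_def)
    then have e: "b1 = b2" "b1 * a1 = b2 * a2" using \<kappa> by simp_all
    then have "a1 = a2" using b by simp
    moreover have "s1 = s2" using e(1) s by (simp add: b1_def b2_def)
    ultimately show False using ne by simp
  qed
  then have "finite {x. poly q x = 0}" by (rule poly_roots_finite)
  moreover have "{x. \<kappa> * (((x - a1) / (t - s1))\<^sup>2 * (t - s1) / 2 - ((x - a2) / (t - s2))\<^sup>2 * (t - s2) / 2) = c}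
      \<subseteq> {x. poly q x = 0}"
  proof
    fix x assume "x \<in> {x. \<kappa> * (((x - a1) / (t - s1))\<^sup>2 * (t - s1) / 2 - ((x - a2) / (t - s2))\<^sup>2 * (t - s2) / 2) = c}"
    then have "\<kappa> * ((x - a1)\<^sup>2 * b1 - (x - a2)\<^sup>2 * b2) = c"
      using sq[of "t - s1" x a1] sq[of "t - s2" x a2] s by (simp add: b1_def b2_def)
    then have "poly q x = 0" by (simp add: q_def power2_eq_square algebra_simps)
    then show "x \<in> {x. poly q x = 0}" by simp
  qed
  ultimately show ?thesis by (rule rev_finite_subset)
qed

text \<open>A violation of \<open>resonance_free\<close>, in terms of addresses.\<close>

definition resonant :: "nat \<times> int \<Rightarrow> (nat \<times> int) list \<Rightarrow> (nat \<times> int) list \<Rightarrow> (nat \<times> int) list \<Rightarrow> (nat \<times> int) list \<Rightarrow>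
    int \<Rightarrow> int \<Rightarrow> (nat \<Rightarrow> real \<times> torus) \<Rightarrow> (nat \<Rightarrow> real) \<Rightarrow> bool" where
  "resonant b l1 l2 l3 l4 K K' z y \<longleftrightarrow>
     coord_lift z (last l1) \<noteq> coord_lift z (last l2) \<and>
     fst (coord_lift z (last l1)) < fst (coord_lift z b) \<and> fst (coord_lift z (last l2)) < fst (coord_lift z b) \<and>
     of_int K' * (index_action y z (l1 @ [b]) - index_action y z (l2 @ [b])) =
     of_int K * (index_action y z l3 - index_action y z l4)"

lemma measurable_resonant:
  assumes ne: "l1 \<noteq> []" "l2 \<noteq> []"
    and Z: "\<And>a. a \<in> set (b # l1 @ l2 @ l3 @ l4) \<Longrightarrow> (\<lambda>x. Z x (fst a)) \<in> borel_measurable N"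
    and Y: "\<And>a. a \<in> set (b # l1 @ l2 @ l3 @ l4) \<Longrightarrow> (\<lambda>x. Y x (fst a)) \<in> borel_measurable N"
  shows "{x \<in> space N. resonant b l1 l2 l3 l4 K K' (Z x) (Y x)} \<in> sets N"
proof -
  have [measurable]: "(\<lambda>x. index_action (Y x) (Z x) (l1 @ [b])) \<in> borel_measurable N"
    "(\<lambda>x. index_action (Y x) (Z x) (l2 @ [b])) \<in> borel_measurable N"
    "(\<lambda>x. index_action (Y x) (Z x) l3) \<in> borel_measurable N"
    "(\<lambda>x. index_action (Y x) (Z x) l4) \<in> borel_measurable N"
    by (rule measurable_index_action; rule Z Y; auto)+
  have c: "(\<lambda>x. fst (coord_lift (Z x) q)) \<in> borel_measurable N" "(\<lambda>x. snd (coord_lift (Z x) q)) \<in> borel_measurable N"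
    if "q \<in> set (b # l1 @ l2 @ l3 @ l4)" for q using Z[OF that] by (rule measurable_coord_lift)+
  have [measurable]: "(\<lambda>x. fst (coord_lift (Z x) b)) \<in> borel_measurable N" "(\<lambda>x. snd (coord_lift (Z x) b)) \<in> borel_measurable N"
    "(\<lambda>x. fst (coord_lift (Z x) (last l1))) \<in> borel_measurable N" "(\<lambda>x. snd (coord_lift (Z x) (last l1))) \<in> borel_measurable N"
    "(\<lambda>x. fst (coord_lift (Z x) (last l2))) \<in> borel_measurable N" "(\<lambda>x. snd (coord_lift (Z x) (last l2))) \<in> borel_measurable N"
    by (rule c, simp add: ne)+
  have "{x \<in> space N. resonant b l1 l2 l3 l4 K K' (Z x) (Y x)} = {x \<in> space N.
     (fst (coord_lift (Z x) (last l1)) \<noteq> fst (coord_lift (Z x) (last l2)) \<or>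
      snd (coord_lift (Z x) (last l1)) \<noteq> snd (coord_lift (Z x) (last l2))) \<and>
     fst (coord_lift (Z x) (last l1)) < fst (coord_lift (Z x) b) \<and> fst (coord_lift (Z x) (last l2)) < fst (coord_lift (Z x) b) \<and>
     of_int K' * (index_action (Y x) (Z x) (l1 @ [b]) - index_action (Y x) (Z x) (l2 @ [b])) =
     of_int K * (index_action (Y x) (Z x) l3 - index_action (Y x) (Z x) l4)}"
    by (auto simp: resonant_def prod_eq_iff)
  also have "\<dots> \<in> sets N" by simp
  finally show ?thesis .
qed

lemma resonant_cong:
  assumes "l1 \<noteq> []" "l2 \<noteq> []" "\<And>a. a \<in> set (b # l1 @ l2 @ l3 @ l4) \<Longrightarrow> z (fst a) = z' (fst a)"
  shows "resonant b l1 l2 l3 l4 K K' z y \<longleftrightarrow> resonant b l1 l2 l3 l4 K K' z' y"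
proof -
  have "last l1 \<in> set l1" "last l2 \<in> set l2" using assms by auto
  then have "coord_lift z (last l1) = coord_lift z' (last l1)" "coord_lift z (last l2) = coord_lift z' (last l2)"
    "coord_lift z b = coord_lift z' b" using assms(3) by (simp_all add: coord_lift_def)
  moreover have "index_action y z (l1 @ [b]) = index_action y z' (l1 @ [b])"
    "index_action y z (l2 @ [b]) = index_action y z' (l2 @ [b])"
    "index_action y z l3 = index_action y z' l3" "index_action y z l4 = index_action y z' l4"
    by (rule index_action_cong, rule assms(3), auto)+
  ultimately show ?thesis by (simp add: resonant_def)
qed

text \<open>Moving the point with index \<open>fst b\<close> along the circle changes the last segments of the
  first two polygons only.\<close>

lemma countable_resonant_section:
  assumes ne: "l1 \<noteq> []" "l2 \<noteq> []" and b: "\<And>a. a \<in> set (l1 @ l2 @ l3 @ l4) \<Longrightarrow> fst a \<noteq> fst b" and K': "K' \<noteq> 0"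
  shows "countable {x. resonant b l1 l2 l3 l4 K K' (z(fst b := (t, x))) y}"
proof -
  let ?z = "\<lambda>x. z(fst b := (t, x))"
  have la: "last l1 \<in> set l1" "last l2 \<in> set l2" using ne by auto
  have cl: "coord_lift (?z x) a = coord_lift z a" if "a \<in> set (l1 @ l2 @ l3 @ l4)" for x a
    using b[OF that] by (simp add: coord_lift_def)
  have ia: "index_action y (?z x) l = index_action y z l" if "set l \<subseteq> set (l1 @ l2 @ l3 @ l4)" for x l
    using that b by (intro index_action_cong) auto
  have ia12: "index_action y (?z x) l1 = index_action y z l1" "index_action y (?z x) l2 = index_action y z l2" for x
    by (rule ia, auto)+
  have cl12: "coord_lift (?z x) (last l1) = coord_lift z (last l1)" "coord_lift (?z x) (last l2) = coord_lift z (last l2)" for x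
    by (rule cl, simp add: la)+
  define s1 a1 s2 a2 where "s1 = fst (coord_lift z (last l1))" and "a1 = snd (coord_lift z (last l1))"
    and "s2 = fst (coord_lift z (last l2))" and "a2 = snd (coord_lift z (last l2))"
  define c where "c = of_int K * (index_action y z l3 - index_action y z l4) -
     of_int K' * (index_action y z l1 - y (fst (last l1)) - index_action y z l2 + y (fst (last l2)))"
  have cb: "coord_lift (?z x) b = (t, torus_coord x + of_int (snd b))" for x by (simp add: coord_lift_def)
  let ?F = "{X. of_int K' * (((X - a1) / (t - s1))\<^sup>2 * (t - s1) / 2 - ((X - a2) / (t - s2))\<^sup>2 * (t - s2) / 2) = c}"
  show ?thesis
  proof (cases "s1 < t \<and> s2 < t \<and> (s1, a1) \<noteq> (s2, a2)")
    case True
    have "{x. resonant b l1 l2 l3 l4 K K' (?z x) y} \<subseteq> (\<lambda>X. to_torus (X - of_int (snd b))) ` ?F"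
    proof
      fix x assume "x \<in> {x. resonant b l1 l2 l3 l4 K K' (?z x) y}"
      then have r: "of_int K' * (index_action y (?z x) (l1 @ [b]) - index_action y (?z x) (l2 @ [b])) =
         of_int K * (index_action y (?z x) l3 - index_action y (?z x) l4)" by (simp add: resonant_def)
      have i34: "index_action y (?z x) l3 = index_action y z l3" "index_action y (?z x) l4 = index_action y z l4"
        by (auto intro!: ia)
      have i1: "index_action y (?z x) (l1 @ [b]) = index_action y z l1 +
          ((torus_coord x + of_int (snd b) - a1) / (t - s1))\<^sup>2 * (t - s1) / 2 - y (fst (last l1))"
        by (simp add: index_action_snoc[OF ne(1)] cb s1_def a1_def ia12 cl12)
      have i2: "index_action y (?z x) (l2 @ [b]) = index_action y z l2 +
          ((torus_coord x + of_int (snd b) - a2) / (t - s2))\<^sup>2 * (t - s2) / 2 - y (fst (last l2))"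
        by (simp add: index_action_snoc[OF ne(2)] cb s2_def a2_def ia12 cl12)
      define X where "X = torus_coord x + of_int (snd b)"
      have "X \<in> ?F"
        using r unfolding i34 i1 i2 X_def[symmetric] c_def by (simp only: mem_Collect_eq right_diff_distrib distrib_left)
      moreover have "x = to_torus (X - of_int (snd b))" by (simp add: X_def)
      ultimately show "x \<in> (\<lambda>X. to_torus (X - of_int (snd b))) ` ?F" by blast
    qed
    moreover have "finite ?F" using True K' by (intro finite_quadratic_coincidences) auto
    ultimately show ?thesis by (intro countable_finite) (rule finite_surj)
  next
    case False
    have "{x. resonant b l1 l2 l3 l4 K K' (?z x) y} = {}"
      using False by (auto simp: resonant_def cb cl12 s1_def s2_def a1_def a2_def prod_eq_iff)
    then show ?thesis by simp
  qed
qed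

text \<open>All vertices are lifts of points of the enumeration; by injectivity, different projections have
  different indices, and the mass of an atom is the weight of its index.\<close>

lemma resonance_free_of_indices:
  assumes pm: "point_masses \<mu> z m"
    and nr: "\<And>b l1 l2 l3 l4 K K'. l1 \<noteq> [] \<Longrightarrow> l2 \<noteq> [] \<Longrightarrow> (\<forall>a\<in>set (l1 @ l2 @ l3 @ l4). fst a \<noteq> fst b) \<Longrightarrow> K' \<noteq> 0 \<Longrightarrow>
     \<not> resonant b l1 l2 l3 l4 K K' z m"
  shows "resonance_free \<mu>"
  unfolding resonance_free_def
proof (intro ballI allI impI notI)
  interpret point_masses \<mu> z m by fact
  have proj: "(fst (coord_lift z a), to_torus (snd (coord_lift z a))) = z (fst a)" for a
    by (simp add: coord_lift_def)
  have mass: "lift_mass \<mu> (coord_lift z a) = m (fst a)" for a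
    unfolding lift_mass_def proj by (rule measure_atom)
  have ex: "\<exists>a. q = coord_lift z a" if "q \<in> atom_lifts \<mu>" for q
  proof -
    have "(fst q, to_torus (snd q)) \<in> range z"
      using that unfolding supp_eq[symmetric] by (cases q) (simp add: atom_lifts_def)
    then obtain n where n: "z n = (fst q, to_torus (snd q))" by (metis rangeE)
    have "to_torus (snd q) = to_torus (torus_coord (snd (z n)))" by (simp add: n)
    then have "snd q - torus_coord (snd (z n)) \<in> \<int>" by (simp only: to_torus_eq_iff)
    then obtain k where "snd q - torus_coord (snd (z n)) = of_int k" by (elim Ints_cases)
    then have "snd q = torus_coord (snd (z n)) + of_int k" by simp
    then show ?thesis by (intro exI[of _ "(n, k)"]) (simp add: coord_lift_def n prod_eq_iff)
  qed
  define idx where "idx = (\<lambda>q. SOME a. q = coord_lift z a)"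
  have idx: "coord_lift z (idx q) = q" if "q \<in> atom_lifts \<mu>" for q
    unfolding idx_def using someI_ex[OF ex[OF that]] by simp
  fix q l1 l2 l3 l4 and K K' :: int
  assume q: "q \<in> atom_lifts \<mu>"
    and sub: "set (l1 @ l2 @ l3 @ l4) \<subseteq> {r \<in> atom_lifts \<mu>. (fst r, to_torus (snd r)) \<noteq> (fst q, to_torus (snd q))}"
    and ne: "l1 \<noteq> []" "l2 \<noteq> []" "last l1 \<noteq> last l2" and lt: "fst (last l1) < fst q" "fst (last l2) < fst q"
    and K': "K' \<noteq> 0"
    and eq: "of_int K' * (chain_action (lift_mass \<mu>) 0 (l1 @ [q]) - chain_action (lift_mass \<mu>) 0 (l2 @ [q])) =
     of_int K * (chain_action (lift_mass \<mu>) 0 l3 - chain_action (lift_mass \<mu>) 0 l4)"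
  have mp: "map (coord_lift z) (map idx l) = l" if "set l \<subseteq> atom_lifts \<mu>" for l
    using that by (induction l) (auto simp: idx)
  have subs: "set l1 \<subseteq> atom_lifts \<mu>" "set l2 \<subseteq> atom_lifts \<mu>" "set l3 \<subseteq> atom_lifts \<mu>" "set l4 \<subseteq> atom_lifts \<mu>"
    using sub by auto
  have ca: "chain_action (lift_mass \<mu>) 0 l = index_action m z (map idx l)" if "set l \<subseteq> atom_lifts \<mu>" for l
    using chain_action_index[of "lift_mass \<mu>" z m "map idx l", OF mass] mp[OF that] by simp
  have last: "coord_lift z (last (map idx l1)) = last l1" "coord_lift z (last (map idx l2)) = last l2"
    using ne subs by (auto simp: last_map intro!: idx)
  have "fst a \<noteq> fst (idx q)" if a: "a \<in> set (map idx l1 @ map idx l2 @ map idx l3 @ map idx l4)" for a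
  proof
    assume e: "fst a = fst (idx q)"
    obtain r where r: "r \<in> set (l1 @ l2 @ l3 @ l4)" "a = idx r" using a by auto
    have "r \<in> atom_lifts \<mu>" using r(1) sub by blast
    then have "(fst r, to_torus (snd r)) = z (fst a)" using proj[of a] by (simp add: r(2) idx)
    also have "\<dots> = (fst q, to_torus (snd q))" using proj[of "idx q"] by (simp add: e idx[OF q])
    finally show False using r(1) sub by blast
  qed
  then have "\<not> resonant (idx q) (map idx l1) (map idx l2) (map idx l3) (map idx l4) K K' z m"
    using ne K' by (intro nr) auto
  moreover have "resonant (idx q) (map idx l1) (map idx l2) (map idx l3) (map idx l4) K K' z m"
    unfolding resonant_def last idx[OF q]
    using ne(3) lt eq ca[of "l1 @ [q]"] ca[of "l2 @ [q]"] ca[of l3] ca[of l4] subs q by simp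
  ultimately show False by blast
qed

context compound_poisson
begin

lemma AE_not_resonant:
  assumes ne: "l1 \<noteq> []" "l2 \<noteq> []" and b: "\<And>a. a \<in> set (l1 @ l2 @ l3 @ l4) \<Longrightarrow> fst a \<noteq> fst b" and K': "K' \<noteq> 0"
  shows "AE \<omega> in P. \<not> resonant b l1 l2 l3 l4 K K' (\<lambda>n. p n \<omega>) (\<lambda>n. w n \<omega>)"
proof (rule AE_joint'[where Q="\<lambda>z y. \<not> resonant b l1 l2 l3 l4 K K' z y"])
  have "{x \<in> space (Sp \<Otimes>\<^sub>M Sw). resonant b l1 l2 l3 l4 K K' (fst x) (snd x)} \<in> sets (Sp \<Otimes>\<^sub>M Sw)"
    by (rule measurable_resonant[OF ne]) measurable
  then show "{x \<in> space (Sp \<Otimes>\<^sub>M Sw). \<not> resonant b l1 l2 l3 l4 K K' (fst x) (snd x)} \<in> sets (Sp \<Otimes>\<^sub>M Sw)"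
    by (rule sets.sets_Collect_neg)
  fix y :: "nat \<Rightarrow> real"
  let ?I = "fst ` set (b # l1 @ l2 @ l3 @ l4)"
  let ?A = "{z \<in> space (PiM ?I (\<lambda>_. borel)). resonant b l1 l2 l3 l4 K K' z y}"
  have ae: "AE \<omega> in P. (\<lambda>i\<in>?I. p i \<omega>) \<notin> ?A"
  proof (rule AE_tuple_notin[where n="fst b"])
    show "?A \<in> sets (PiM ?I (\<lambda>_. borel))"
    proof (rule measurable_resonant[OF ne])
      fix a assume "a \<in> set (b # l1 @ l2 @ l3 @ l4)"
      then have "fst a \<in> ?I" by blast
      then show "(\<lambda>x. x (fst a)) \<in> borel_measurable (PiM ?I (\<lambda>_. borel :: (real \<times> torus) measure))"
        by (rule measurable_component_singleton)
    qed simp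
    show "countable {x. z(fst b := (t, x)) \<in> ?A}" for z t
      by (rule countable_subset[OF _ countable_resonant_section[OF ne b K', where z=z and t=t and y=y and K=K]]) auto
  qed auto
  have eq: "(\<lambda>i\<in>?I. p i \<omega>) \<in> ?A \<longleftrightarrow> resonant b l1 l2 l3 l4 K K' (\<lambda>n. p n \<omega>) y" for \<omega>
  proof -
    have "resonant b l1 l2 l3 l4 K K' (\<lambda>i\<in>?I. p i \<omega>) y \<longleftrightarrow> resonant b l1 l2 l3 l4 K K' (\<lambda>n. p n \<omega>) y"
    proof (rule resonant_cong[OF ne])
      fix a assume "a \<in> set (b # l1 @ l2 @ l3 @ l4)"
      then have "fst a \<in> ?I" by blast
      then show "(\<lambda>i\<in>?I. p i \<omega>) (fst a) = p (fst a) \<omega>" by (rule restrict_apply')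
    qed
    moreover have "(\<lambda>i\<in>?I. p i \<omega>) \<in> space (PiM ?I (\<lambda>_. borel))" by (simp add: space_PiM del: list.set set_append)
    ultimately show ?thesis by blast
  qed
  show "AE \<omega> in P. \<not> resonant b l1 l2 l3 l4 K K' (\<lambda>n. p n \<omega>) y" using ae unfolding eq .
qed

lemma AE_never_resonant:
  "AE \<omega> in P. \<forall>b l1 l2 l3 l4 K K'. l1 \<noteq> [] \<longrightarrow> l2 \<noteq> [] \<longrightarrow> (\<forall>a\<in>set (l1 @ l2 @ l3 @ l4). fst a \<noteq> fst b) \<longrightarrow> K' \<noteq> 0 \<longrightarrow>
     \<not> resonant b l1 l2 l3 l4 K K' (\<lambda>n. p n \<omega>) (\<lambda>n. w n \<omega>)"
proof -
  define R where "R = (\<lambda>(b, l1, l2, l3, l4, K, K') \<omega>. l1 \<noteq> [] \<longrightarrow> l2 \<noteq> [] \<longrightarrow>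
     (\<forall>a\<in>set (l1 @ l2 @ l3 @ l4). fst a \<noteq> fst b) \<longrightarrow> K' \<noteq> 0 \<longrightarrow>
     \<not> resonant b l1 l2 l3 l4 K K' (\<lambda>n. p n \<omega>) (\<lambda>n. w n \<omega>))"
  have "AE \<omega> in P. R x \<omega>" for x
  proof -
    obtain b l1 l2 l3 l4 K K' where x: "x = (b, l1, l2, l3, l4, K, K')" by (cases x) auto
    show ?thesis
    proof (cases "l1 \<noteq> [] \<and> l2 \<noteq> [] \<and> (\<forall>a\<in>set (l1 @ l2 @ l3 @ l4). fst a \<noteq> fst b) \<and> K' \<noteq> 0")
      case True
      then have "AE \<omega> in P. \<not> resonant b l1 l2 l3 l4 K K' (\<lambda>n. p n \<omega>) (\<lambda>n. w n \<omega>)"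
        by (intro AE_not_resonant) blast+
      then show ?thesis by eventually_elim (simp add: x R_def)
    next
      case False
      then have "R x \<omega>" for \<omega> by (auto simp: x R_def)
      then show ?thesis by simp
    qed
  qed
  then have "AE \<omega> in P. \<forall>x. R x \<omega>" by (subst AE_all_countable) blast
  then show ?thesis
  proof eventually_elim
    case (elim \<omega>)
    show ?case
    proof (intro allI)
      fix b l1 l2 l3 l4 K K'
      show "l1 \<noteq> [] \<longrightarrow> l2 \<noteq> [] \<longrightarrow> (\<forall>a\<in>set (l1 @ l2 @ l3 @ l4). fst a \<noteq> fst b) \<longrightarrow> K' \<noteq> 0 \<longrightarrow>
        \<not> resonant b l1 l2 l3 l4 K K' (\<lambda>n. p n \<omega>) (\<lambda>n. w n \<omega>)"
        using elim[rule_format, of "(b, l1, l2, l3, l4, K, K')"] unfolding R_def prod.case .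
    qed
  qed
qed

theorem AE_Omega_tilde:
  assumes "AE \<omega> in P. sets (\<mu> \<omega>) = sets borel \<and>
     (\<forall>A\<in>sets borel. emeasure (\<mu> \<omega>) A = (\<Sum>n. ennreal (w n \<omega>) * indicator A (p n \<omega>)))"
  shows "AE \<omega> in P. \<mu> \<omega> \<in> Omega_tilde"
  using AE_Omega1[OF assms] AE_point_masses[OF assms] AE_never_resonant
proof eventually_elim
  case (elim \<omega>)
  have "resonance_free (\<mu> \<omega>)" by (rule resonance_free_of_indices[OF elim(2)]) (use elim(3) in blast)
  then show ?case by (rule Omega_tilde_of_resonance_free[OF elim(1)])
qed

end

theorem theorem1p7:
  fixes P :: "'w measure" and lam :: real and nu :: "real measure"
    and \<mu> :: "'w \<Rightarrow> (real \<times> torus) measure"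
  assumes "prob_space P"
    and "lam > 0"
    and "prob_space nu" and "sets nu = sets borel" and "AE w in nu. w > 0"
    and "homogeneous_compound_poisson_process P lam nu \<mu>"
  shows "AE \<omega> in P. \<mu> \<omega> \<in> Omega_tilde"
proof -
  interpret prob_space P by fact
  obtain p w where pw: "homogeneous_poisson_process P lam p"
      "indep_vars (\<lambda>_. borel) w UNIV" "\<And>n. distr P borel (w n) = nu"
      "indep_set (sets (vimage_algebra (space P) (\<lambda>\<omega> n. p n \<omega>) (\<Pi>\<^sub>M n\<in>UNIV. borel)))
        (sets (vimage_algebra (space P) (\<lambda>\<omega> n. w n \<omega>) (\<Pi>\<^sub>M n\<in>UNIV. borel)))"
      "AE \<omega> in P. sets (\<mu> \<omega>) = sets borel \<and>
        (\<forall>A\<in>sets borel. emeasure (\<mu> \<omega>) A = (\<Sum>n. ennreal (w n \<omega>) * indicator A (p n \<omega>)))"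
    using assms(6) unfolding homogeneous_compound_poisson_process_def by blast
  have "poisson_process P lam p"
    by (intro poisson_process.intro poisson_process_axioms.intro assms(1,2) pw(1))
  then interpret compound_poisson P lam p nu w
    by (intro compound_poisson.intro compound_poisson_axioms.intro assms(3-5) pw(2-4))
  show ?thesis by (rule AE_Omega_tilde[OF pw(5)])
qed

end
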